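(* Let $\rho_{\rm eq}\in W^{1,\infty}(-H,0)$ be such that $N^2=-g\frac{\rho_{\rm eq}'}{\rho_{\rm eq}}$ is a strictly positive function on $(-H,0)$. Let $s\ge0$, $T>0$, and let $(U^{\rm lin},\rho^{\rm lin})\in C([0,T];H^{s,0})$, $U^{\rm lin}=(V^{\rm lin},w^{\rm lin})$, with pressure $P^{\rm lin}$, solve the linear equations $$\begin{cases}\partial_tV+\frac1{\rho_{\rm eq}}\nabla P=0,\\ \partial_tw+\frac1{\rho_{\rm eq}}\partial_zP+\frac{\rho}{\rho_{\rm eq}}g=0,\\ \partial_t\rho+w\frac{d}{dz}\rho_{\rm eq}=0,\\ \nabla\cdot V+\partial_zw=0,\end{cases}\qquad w|_{z=-H}=w|_{z=0}=0,$$ with initial data $(U^0,\rho^0)$, $U^0=(V^0,w^0)$, and assume that the vertical component of the vorticity is zero, that is, $\nabla^\perp\cdot V^{\rm lin}=0$. Then the coefficients $(V_n,w_n,\rho_n,P_n)$ of the modal decompositions of $(V^{\rm lin},w^{\rm lin},\rho^{\rm lin},P^{\rm lin})$ defined in the context are found by solving, for all $n\ge1$, the equations $$\begin{cases}\partial_tV_n-\displaystyle\sum_{m=1}^\infty c_mc_n\alpha_{mn}\Delta\partial_tV_m+c_n\nabla\rho_n=0,\\ \partial_t\rho_n+c_n\nabla\cdot V_n=0,\end{cases}$$ where $\alpha_{mn}=\int_{-H}^0\mathbf f_m\mathbf f_n\,\rho_{\rm eq}\,dz$, with initial data given by the coefficients of the decompositions of $V^0$ and $\rho^0$, and $w_n$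 and $P_n$ are given by $$w_n=-c_n\nabla\cdot V_n\quad\text{and}\quad P_n=c_n\rho_n+c_n\sum_{m=1}^\infty\alpha_{mn}\partial_tw_m,$$ while for $n=0$ one must have $P_0=0$ and $V_0=0$.
   Context: $d\in\{1,2\}$, $H>0$, $g>0$, $\mathcal S=\mathbb R^d\times(-H,0)$ with horizontal variable $X\in\mathbb R^d$ and vertical variable $z$. $\nabla$, $\nabla^\perp$ and $\Delta$ act on $X$ only; when $d=1$, functions on $\mathbb R$ are identified with functions on $\mathbb R^2$ independent of the second variable. $V\in\mathbb R^d$ and $w\in\mathbb R$ are the horizontal and vertical components of $U$. The background density $\rho_{\rm eq}$ is bounded below by a positive constant, and (as needed for the bases below) $N$ is bounded below by a positive constant. $H^{s,0}=L^2((-H,0);H^s(\mathbb R^d))$. Let $(\mathbf f_n)_{n\ge1}$ be the orthonormal basis of $L^2((-H,0),\rho_{\rm eq}N^2dz)$ formed by the eigenfunctions of the Sturm-Liouville problem $$\frac{d}{dz}\Big(\rho_{\rm eq}\frac{d}{dz}\mathbf f_n\Big)+\frac{\rho_{\rm eq}N^2}{c_n^2}\mathbf f_n=0,\qquad\mathbf f_n(-H)=\mathbf f_n(0)=0,$$ with eigenvalues $1/c_n^2$, $c_1>c_2>\dots>0$. Set $\mathbf g_0=\alpha\rho_{\rm eq}^{-1}$ with $\alpha=\big(\int_{-H}^0\rho_{\rm eq}^{-1}\big)^{-1/2}$ and $\mathbf g_n=c_n\mathbf f_n'$ for $n\ge1$; $(\mathbf g_n)_{n\ge0}$ is an orthonormal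 basis of $L^2((-H,0),\rho_{\rm eq}dz)$. The modal decompositions are $$V=\sum_{n\ge0}V_n(t,X)\mathbf g_n(z),\quad w=\sum_{n\ge1}w_n(t,X)\mathbf f_n(z),$$ $$P=\sum_{n\ge0}P_n(t,X)\rho_{\rm eq}(z)\mathbf g_n(z),\quad\rho=\sum_{n\ge1}\frac1g\rho_n(t,X)\rho_{\rm eq}(z)N^2(z)\mathbf f_n(z).$$
   Formalization: The pressure is additionally assumed to lie in C([0,T];L²(S)), which fixes its free additive function of time; without this, zero V, w, ρ with P constant and nonzero would violate P_0=0. *)

theory Defs
  imports "HOL-Analysis.Analysis"
begin

section \<open>Test functions and distributions\<close>

definition dirderiv :: "'a::euclidean_space \<Rightarrow> ('a \<Rightarrow> real) \<Rightarrow> 'a \<Rightarrow> real" where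
  "dirderiv v f x = frechet_derivative f (at x) v"

primrec C_k :: "nat \<Rightarrow> ('a::euclidean_space \<Rightarrow> real) \<Rightarrow> bool" where
  "C_k 0 f \<longleftrightarrow> continuous_on UNIV f"
| "C_k (Suc k) f \<longleftrightarrow> (\<forall>x. f differentiable (at x)) \<and> (\<forall>b\<in>Basis. C_k k (dirderiv b f))"

definition test_function :: "'a::euclidean_space set \<Rightarrow> ('a \<Rightarrow> real) \<Rightarrow> bool" where
  "test_function \<Omega> \<phi> \<longleftrightarrow> (\<forall>k. C_k k \<phi>) \<and> compact (closure {x. \<phi> x \<noteq> 0})
     \<and> closure {x. \<phi> x \<noteq> 0} \<subseteq> \<Omega>"

text \<open>The functional on test functions of \<open>(t, x) \<in> (0,T) \<times> \<Omega>\<close> induced by a curve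
  \<open>t \<mapsto> u t\<close> of functions on \<open>\<Omega>\<close>. The integral is iterated because a curve in
  \<open>C([0,T]; L\<^sup>2(\<Omega>))\<close> consists of classes chosen separately for each \<open>t\<close>: joint measurability of
  the chosen representatives is not available, while the inner integral is continuous in \<open>t\<close>.\<close>

definition curve_distr :: "real \<Rightarrow> 'a::euclidean_space set \<Rightarrow> (real \<Rightarrow> 'a \<Rightarrow> real)
    \<Rightarrow> (real \<times> 'a \<Rightarrow> real) \<Rightarrow> real" where
  "curve_distr T \<Omega> u \<phi> = (LBINT t:{0<..<T}. (LBINT x:\<Omega>. u t x * \<phi> (t, x)))"

definition ddiff :: "'a::euclidean_space \<Rightarrow> (('a \<Rightarrow> real) \<Rightarrow> real) \<Rightarrow> ('a \<Rightarrow> real) \<Rightarrow> real" where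
  "ddiff v F \<phi> = - F (dirderiv v \<phi>)"

text \<open>Derivatives of distributions on \<open>(0,T) \<times> \<real>\<^sup>d\<close> (\<open>dt\<close>, \<open>dX\<close>, \<open>lapX\<close>) and on
  \<open>(0,T) \<times> (\<real>\<^sup>d \<times> (-H,0))\<close> (\<open>dt\<close>, \<open>strip_dX\<close>, \<open>strip_dz\<close>).\<close>

abbreviation dt :: "((real \<times> 'a::euclidean_space \<Rightarrow> real) \<Rightarrow> real) \<Rightarrow> (real \<times> 'a \<Rightarrow> real) \<Rightarrow> real" where
  "dt \<equiv> ddiff (1, 0)"

abbreviation dX :: "'d::finite \<Rightarrow> ((real \<times> (real^'d) \<Rightarrow> real) \<Rightarrow> real)
    \<Rightarrow> (real \<times> (real^'d) \<Rightarrow> real) \<Rightarrow> real" where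
  "dX i \<equiv> ddiff (0, axis i 1)"

definition lapX :: "((real \<times> (real^'d::finite) \<Rightarrow> real) \<Rightarrow> real) \<Rightarrow> (real \<times> (real^'d) \<Rightarrow> real) \<Rightarrow> real" where
  "lapX F \<phi> = (\<Sum>i\<in>UNIV. dX i (dX i F) \<phi>)"

abbreviation strip_dX :: "'d::finite \<Rightarrow> ((real \<times> ((real^'d) \<times> real) \<Rightarrow> real) \<Rightarrow> real)
    \<Rightarrow> (real \<times> ((real^'d) \<times> real) \<Rightarrow> real) \<Rightarrow> real" where
  "strip_dX i \<equiv> ddiff (0, (axis i 1, 0))"

abbreviation strip_dz :: "((real \<times> ((real^'d::finite) \<times> real) \<Rightarrow> real) \<Rightarrow> real)
    \<Rightarrow> (real \<times> ((real^'d) \<times> real) \<Rightarrow> real) \<Rightarrow> real" where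
  "strip_dz \<equiv> ddiff (0, (0, 1))"

section \<open>Function spaces\<close>

definition strip :: "real \<Rightarrow> ((real^'d::finite) \<times> real) set" where
  "strip H = UNIV \<times> {-H<..<0}"

definition C_L2 :: "real \<Rightarrow> 'a::euclidean_space set \<Rightarrow> (real \<Rightarrow> 'a \<Rightarrow> real) \<Rightarrow> bool" where
  "C_L2 T \<Omega> u \<longleftrightarrow>
     (\<forall>t\<in>{0..T}. set_borel_measurable lborel \<Omega> (u t)
        \<and> (\<integral>\<^sup>+x\<in>\<Omega>. ennreal ((u t x)\<^sup>2) \<partial>lborel) < \<infinity>)
   \<and> (\<forall>t\<^sub>0\<in>{0..T}. ((\<lambda>t. \<integral>\<^sup>+x\<in>\<Omega>. ennreal ((u t x - u t\<^sub>0 x)\<^sup>2) \<partial>lborel) \<longlongrightarrow> 0)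
        (at t\<^sub>0 within {0..T}))"

text \<open>\<open>v\<close> is the Fourier transform \<open>\<integral> exp(-i x\<cdot>\<xi>) u(x) dx\<close> of \<open>u \<in> L\<^sup>2(\<real>\<^sup>d)\<close>, in the sense of
  tempered distributions (transposition). Test functions separate the elements of \<open>L\<^sup>2\<close>, so
  \<open>v\<close> is unique up to a null set.\<close>

definition fourier_transform :: "((real^'d::finite) \<Rightarrow> real) \<Rightarrow> ((real^'d) \<Rightarrow> complex) \<Rightarrow> bool" where
  "fourier_transform u v \<longleftrightarrow> v \<in> borel_measurable borel
     \<and> (\<integral>\<^sup>+\<xi>. ennreal ((cmod (v \<xi>))\<^sup>2) \<partial>lborel) < \<infinity>
     \<and> (\<forall>\<phi>. test_function UNIV \<phi> \<longrightarrow>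
          (LBINT \<xi>. v \<xi> * of_real (\<phi> \<xi>)) =
          (LBINT x. of_real (u x) * (LBINT \<xi>. cis (- (x \<bullet> \<xi>)) * of_real (\<phi> \<xi>))))"

text \<open>Squared norm of \<open>H\<^sup>s(\<real>\<^sup>d)\<close>, \<open>s \<ge> 0\<close>, as
  \<open>\<parallel>u\<parallel>\<^sup>2 + \<parallel>\<bar>\<xi>\<bar>\<^sup>s \<^bold>F u\<parallel>\<^sup>2\<close> in \<open>L\<^sup>2\<close>; by Plancherel this is equivalent to
  \<open>\<parallel>(1 + \<bar>\<xi>\<bar>\<^sup>2)\<^sup>s\<^sup>/\<^sup>2 \<^bold>F u\<parallel>\<^sup>2\<close>. The infimum runs over the representatives of a single class.\<close>

definition Hs_sqnorm :: "real \<Rightarrow> ((real^'d::finite) \<Rightarrow> real) \<Rightarrow> ennreal" where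
  "Hs_sqnorm s u = (\<integral>\<^sup>+x. ennreal ((u x)\<^sup>2) \<partial>lborel)
     + (INF v\<in>{v. fourier_transform u v}.
          \<integral>\<^sup>+\<xi>. ennreal (norm \<xi> powr (2 * s) * (cmod (v \<xi>))\<^sup>2) \<partial>lborel)"

definition Hs0_sqnorm :: "real \<Rightarrow> real \<Rightarrow> ((real^'d::finite) \<times> real \<Rightarrow> real) \<Rightarrow> ennreal" where
  "Hs0_sqnorm s H u = (\<integral>\<^sup>+z\<in>{-H<..<0}. Hs_sqnorm s (\<lambda>X. u (X, z)) \<partial>lborel)"

definition C_Hs0 :: "real \<Rightarrow> real \<Rightarrow> real \<Rightarrow> (real \<Rightarrow> (real^'d::finite) \<times> real \<Rightarrow> real) \<Rightarrow> bool" where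
  "C_Hs0 s H T u \<longleftrightarrow>
     (\<forall>t\<in>{0..T}. set_borel_measurable lborel (strip H) (u t) \<and> Hs0_sqnorm s H (u t) < \<infinity>)
   \<and> (\<forall>t\<^sub>0\<in>{0..T}. ((\<lambda>t. Hs0_sqnorm s H (\<lambda>p. u t p - u t\<^sub>0 p)) \<longlongrightarrow> 0) (at t\<^sub>0 within {0..T}))"

definition has_weak_deriv :: "real \<Rightarrow> real \<Rightarrow> (real \<Rightarrow> real) \<Rightarrow> (real \<Rightarrow> real) \<Rightarrow> bool" where
  "has_weak_deriv a b u u' \<longleftrightarrow>
     set_integrable lborel {a<..<b} u \<and> set_integrable lborel {a<..<b} u'
   \<and> (\<forall>\<phi>. test_function {a<..<b} \<phi> \<longrightarrow>
        (LBINT z:{a<..<b}. u z * deriv \<phi> z) = - (LBINT z:{a<..<b}. u' z * \<phi> z))"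

definition W_1_infty :: "real \<Rightarrow> real \<Rightarrow> (real \<Rightarrow> real) \<Rightarrow> (real \<Rightarrow> real) \<Rightarrow> bool" where
  "W_1_infty a b u u' \<longleftrightarrow> has_weak_deriv a b u u'
     \<and> (\<exists>C. AE z in lborel. z \<in> {a<..<b} \<longrightarrow> \<bar>u z\<bar> \<le> C \<and> \<bar>u' z\<bar> \<le> C)"

section \<open>The normal modes\<close>

definition N_sq :: "real \<Rightarrow> (real \<Rightarrow> real) \<Rightarrow> (real \<Rightarrow> real) \<Rightarrow> real \<Rightarrow> real" where
  "N_sq grav \<rho>eq \<rho>eq' z = - grav * \<rho>eq' z / \<rho>eq z"

definition orthonormal_basis :: "real \<Rightarrow> (real \<Rightarrow> real) \<Rightarrow> nat \<Rightarrow> (nat \<Rightarrow> real \<Rightarrow> real) \<Rightarrow> bool" where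
  "orthonormal_basis H \<omega> k e \<longleftrightarrow>
     (\<forall>n\<ge>k. set_borel_measurable lborel {-H<..<0} (e n))
   \<and> (\<forall>m\<ge>k. \<forall>n\<ge>k. set_integrable lborel {-H<..<0} (\<lambda>z. e m z * e n z * \<omega> z)
        \<and> (LBINT z:{-H<..<0}. e m z * e n z * \<omega> z) = (if m = n then 1 else 0))
   \<and> (\<forall>u. set_borel_measurable lborel {-H<..<0} u
        \<and> set_integrable lborel {-H<..<0} (\<lambda>z. (u z)\<^sup>2 * \<omega> z) \<longrightarrow>
        (\<lambda>K. \<integral>\<^sup>+z\<in>{-H<..<0}. ennreal
              ((u z - (\<Sum>n=k..K. (LBINT y:{-H<..<0}. u y * e n y * \<omega> y) * e n z))\<^sup>2 * \<omega> z) \<partial>lborel)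
          \<longlonglongrightarrow> 0)"

text \<open>The modes are indexed by \<open>n \<ge> 1\<close>; \<open>f 0\<close> and \<open>c 0\<close> are irrelevant. As \<open>N\<^sup>2\<close> is only bounded,
  the outer derivative of the Sturm-Liouville equation is a weak one.\<close>

definition SL_modes :: "real \<Rightarrow> real \<Rightarrow> (real \<Rightarrow> real) \<Rightarrow> (real \<Rightarrow> real)
    \<Rightarrow> (nat \<Rightarrow> real \<Rightarrow> real) \<Rightarrow> (nat \<Rightarrow> real) \<Rightarrow> bool" where
  "SL_modes H grav \<rho>eq \<rho>eq' f c \<longleftrightarrow>
     (\<forall>n\<ge>1. c n > 0) \<and> (\<forall>m\<ge>1. \<forall>n>m. c n < c m)
   \<and> (\<forall>n\<ge>1. continuous_on {-H..0} (f n) \<and> (\<forall>z\<in>{-H<..<0}. f n differentiable (at z))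
        \<and> f n (-H) = 0 \<and> f n 0 = 0
        \<and> has_weak_deriv (-H) 0 (\<lambda>z. \<rho>eq z * deriv (f n) z)
            (\<lambda>z. - (\<rho>eq z * N_sq grav \<rho>eq \<rho>eq' z / (c n)\<^sup>2 * f n z)))
   \<and> orthonormal_basis H (\<lambda>z. \<rho>eq z * N_sq grav \<rho>eq \<rho>eq' z) 1 f"

definition g_mode :: "real \<Rightarrow> (real \<Rightarrow> real) \<Rightarrow> (nat \<Rightarrow> real \<Rightarrow> real) \<Rightarrow> (nat \<Rightarrow> real)
    \<Rightarrow> nat \<Rightarrow> real \<Rightarrow> real" where
  "g_mode H \<rho>eq f c n z =
     (if n = 0 then (LBINT y:{-H<..<0}. 1 / \<rho>eq y) powr (-1/2) / \<rho>eq z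
      else c n * deriv (f n) z)"

definition alpha :: "real \<Rightarrow> (real \<Rightarrow> real) \<Rightarrow> (nat \<Rightarrow> real \<Rightarrow> real) \<Rightarrow> nat \<Rightarrow> nat \<Rightarrow> real" where
  "alpha H \<rho>eq f m n = (LBINT z:{-H<..<0}. f m z * f n z * \<rho>eq z)"

text \<open>\<open>u(X,\<cdot>) = \<Sum>n\<ge>k. a n X \<cdot> e n\<close> in \<open>L\<^sup>2(-H,0)\<close>, for almost every \<open>X\<close>. All weights are bounded
  above and below, so the weighted \<open>L\<^sup>2\<close> spaces give the same convergence.\<close>

definition modal_decomposition :: "real \<Rightarrow> nat \<Rightarrow> (nat \<Rightarrow> real \<Rightarrow> real)
    \<Rightarrow> ((real^'d::finite) \<times> real \<Rightarrow> real) \<Rightarrow> (nat \<Rightarrow> (real^'d) \<Rightarrow> real) \<Rightarrow> bool" where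
  "modal_decomposition H k e u a \<longleftrightarrow>
     (\<forall>n\<ge>k. a n \<in> borel_measurable borel)
   \<and> (AE X in lborel. (\<lambda>K. \<integral>\<^sup>+z\<in>{-H<..<0}.
        ennreal ((u (X, z) - (\<Sum>n=k..K. a n X * e n z))\<^sup>2) \<partial>lborel) \<longlonglongrightarrow> 0)"

section \<open>The linear equations\<close>

text \<open>Vanishing of the traces at \<open>z = -H\<close> and \<open>z = 0\<close>. The traces are distributions on \<open>\<real>\<^sup>d\<close>: for a
  velocity field with \<open>\<nabla> \<cdot> V + \<partial>\<^sub>z w = 0\<close>, each average \<open>\<integral> w(X,\<cdot>) \<eta>(X) dX\<close> has an
  integrable derivative, hence a continuous representative on \<open>[-H,0]\<close>.\<close>

definition zero_traces :: "real \<Rightarrow> ((real^'d::finite) \<times> real \<Rightarrow> real) \<Rightarrow> bool" where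
  "zero_traces H w \<longleftrightarrow> (\<forall>\<eta>. test_function UNIV \<eta> \<longrightarrow>
     (\<exists>h. continuous_on {-H..0} h \<and> h (-H) = 0 \<and> h 0 = 0
        \<and> (AE z in lborel. z \<in> {-H<..<0} \<longrightarrow> (LBINT X. w (X, z) * \<eta> X) = h z)))"

text \<open>In the second equation, \<open>(1/\<rho>eq) \<partial>\<^sub>zP\<close> is the product of a \<open>W\<^sup>1\<^sup>,\<^sup>\<infinity>\<close> function and
  the derivative of an \<open>L\<^sup>2\<close> function, i.e. \<open>\<partial>\<^sub>z(P/\<rho>eq) + P \<rho>eq'/\<rho>eq\<^sup>2\<close>. Horizontal derivatives
  commute with multiplication by functions of \<open>z\<close>. The equations determine \<open>P\<close> only
  up to a function of time; requiring \<open>C_L2 T (strip H) P\<close> selects the one decaying in \<open>X\<close>.\<close>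

definition linear_equations :: "real \<Rightarrow> real \<Rightarrow> real \<Rightarrow> (real \<Rightarrow> real) \<Rightarrow> (real \<Rightarrow> real)
    \<Rightarrow> (real \<Rightarrow> (real^'d::finite) \<times> real \<Rightarrow> (real^'d)) \<Rightarrow> (real \<Rightarrow> (real^'d) \<times> real \<Rightarrow> real)
    \<Rightarrow> (real \<Rightarrow> (real^'d) \<times> real \<Rightarrow> real) \<Rightarrow> (real \<Rightarrow> (real^'d) \<times> real \<Rightarrow> real) \<Rightarrow> bool" where
  "linear_equations H grav T \<rho>eq \<rho>eq' V w \<rho> P \<longleftrightarrow>
     (\<forall>\<phi>. test_function ({0<..<T} \<times> strip H) \<phi> \<longrightarrow>
        (\<forall>i. dt (curve_distr T (strip H) (\<lambda>t p. V t p $ i)) \<phi>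
             + strip_dX i (curve_distr T (strip H) (\<lambda>t p. 1 / \<rho>eq (snd p) * P t p)) \<phi> = 0)
      \<and> dt (curve_distr T (strip H) w) \<phi>
          + (strip_dz (curve_distr T (strip H) (\<lambda>t p. P t p / \<rho>eq (snd p))) \<phi>
             + curve_distr T (strip H) (\<lambda>t p. P t p * \<rho>eq' (snd p) / (\<rho>eq (snd p))\<^sup>2) \<phi>)
          + curve_distr T (strip H) (\<lambda>t p. \<rho> t p / \<rho>eq (snd p) * grav) \<phi> = 0
      \<and> dt (curve_distr T (strip H) \<rho>) \<phi>
          + curve_distr T (strip H) (\<lambda>t p. w t p * \<rho>eq' (snd p)) \<phi> = 0
      \<and> (\<Sum>i\<in>UNIV. strip_dX i (curve_distr T (strip H) (\<lambda>t p. V t p $ i)) \<phi>)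
          + strip_dz (curve_distr T (strip H) w) \<phi> = 0)
   \<and> (\<forall>t\<in>{0..T}. zero_traces H (w t))"

text \<open>For \<open>d = 2\<close> the only nontrivial instance is \<open>\<nabla>\<^sup>\<bottom> \<cdot> V = \<partial>\<^sub>1V\<^sub>2 - \<partial>\<^sub>2V\<^sub>1 = 0\<close> (up to sign);
  for \<open>d = 1\<close> there is none, in accordance with the independence of the second variable.\<close>

definition zero_vertical_vorticity ::
    "real \<Rightarrow> real \<Rightarrow> (real \<Rightarrow> (real^'d::finite) \<times> real \<Rightarrow> (real^'d)) \<Rightarrow> bool" where
  "zero_vertical_vorticity H T V \<longleftrightarrow>
     (\<forall>\<phi>. test_function ({0<..<T} \<times> strip H) \<phi> \<longrightarrow>
        (\<forall>i j. strip_dX i (curve_distr T (strip H) (\<lambda>t p. V t p $ j)) \<phi>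
             - strip_dX j (curve_distr T (strip H) (\<lambda>t p. V t p $ i)) \<phi> = 0))"

end

theory Submission
  imports Defs
begin

text \<open>Testing the linear equations with products \<open>\<phi>(t,X) e(z)\<close> gives, for fixed \<open>\<phi>\<close>, linear functionals
  of \<open>e\<close> that are continuous under bounded pointwise convergence; such functionals are determined by
  smooth \<open>e\<close>, so that \<open>e\<close> may be replaced by the (merely Lipschitz) modes. The equations for \<open>V\<close> and
  \<open>\<rho>\<close> then give the corresponding modal ones. The equation for \<open>w\<close> is tested with \<open>\<rho>eq f\<^sub>n\<close>, which
  vanishes at both ends, and \<open>\<rho>eq f\<^sub>n\<close> is expanded in the basis \<open>\<rho>eq N\<^sup>2 f\<^sub>m\<close>; this is the origin of the
  series with the coefficients \<open>\<alpha>\<^sub>m\<^sub>n\<close>. In the divergence equation \<open>e = \<rho>eq g\<^sub>n\<close> does not vanish at the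
  ends, and the vanishing traces of \<open>w\<close> are used instead, at each fixed time. Absence of vertical
  vorticity turns \<open>\<nabla>\<nabla>\<cdot>V\<^sub>m\<close> into \<open>\<Delta>V\<^sub>m\<close>. The mode \<open>V\<^sub>0\<close> is divergence and curl free, hence
  harmonic, and \<open>P\<^sub>0\<close> has zero gradient; both are square integrable, hence zero. This Liouville theorem is
  proved by averaging against the kernels \<open>s\<^sup>d k(s(y - x))\<close>: the average of a harmonic function is
  independent of \<open>s\<close>, while it tends to \<open>0\<close> as \<open>s \<rightarrow> 0\<close> by the Cauchy-Schwarz inequality.\<close>

section \<open>Differential calculus of test functions\<close>

text \<open>The coefficients are merely bounded, so the Sturm-Liouville equation is used as a first
  order system between two families of profiles: \<open>F n\<close> has derivative
  \<open>G n / (c n * R)\<close> and vanishes at both ends, while \<open>G n\<close> has derivative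
  \<open>grav * Rp * F n / c n\<close> and does not. Everything done with the modes is an
  integration by parts in this pair. Such derivatives exist only almost everywhere, so a profile is
  always written as a constant plus \<open>prim q\<close>, the integral of a function
  \<open>q\<close> supported in the interval; the product rule for these primitives is Fubini's
  theorem on two triangles. Vanishing at both ends then just means zero total integral of
  \<open>q\<close>. A second obstacle is time. A curve in the square integrable functions has a
  representative chosen separately for each \<open>t\<close>, so nothing may be integrated jointly
  in \<open>t\<close> and \<open>X\<close>. Pairings are formed at fixed \<open>t\<close>, are
  continuous in \<open>t\<close>, and only then are integrated. The same continuity leads back from
  equations tested in time to every single \<open>t\<close>, which is where the trace condition and
  the Liouville theorem apply.\<close>

lemma dirderiv_eqI: "(f has_derivative f') (at x) \<Longrightarrow> dirderiv v f x = f' v"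
  unfolding dirderiv_def by (metis frechet_derivative_at)

lemma has_derivative_frechet:
  "f differentiable (at x) \<Longrightarrow> (f has_derivative (\<lambda>v. dirderiv v f x)) (at x)"
  unfolding dirderiv_def using frechet_derivative_works by (metis eta_contract_eq)

lemma dirderiv_expand:
  fixes f :: "'a::euclidean_space \<Rightarrow> real"
  assumes "f differentiable (at x)"
  shows "dirderiv v f x = (\<Sum>b\<in>Basis. (v \<bullet> b) * dirderiv b f x)"
proof -
  interpret linear "\<lambda>v. dirderiv v f x"
    using has_derivative_frechet[OF assms] has_derivative_linear by blast
  have "dirderiv v f x = dirderiv (\<Sum>b\<in>Basis. (v \<bullet> b) *\<^sub>R b) f x"
    by (simp add: euclidean_representation)
  also have "\<dots> = (\<Sum>b\<in>Basis. (v \<bullet> b) * dirderiv b f x)"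
    by (subst sum) (simp add: scaleR)
  finally show ?thesis .
qed

lemma C_k_continuous: "C_k k f \<Longrightarrow> continuous_on UNIV f"
  by (cases k) (auto intro!: continuous_at_imp_continuous_on differentiable_imp_continuous_within)

lemma C_k_Suc_imp: "C_k (Suc k) f \<Longrightarrow> C_k k f"
proof (induction k arbitrary: f)
  case 0
  then show ?case using C_k_continuous by fastforce
next
  case (Suc k)
  then show ?case by (metis C_k.simps(2))
qed

lemma C_k_const [simp]: "C_k k (\<lambda>x. a)"
proof (induction k arbitrary: a)
  case (Suc k)
  have "dirderiv b (\<lambda>x::'a. a) = (\<lambda>x. 0)" for b
    by (rule ext) (rule dirderiv_eqI[where f' = "\<lambda>_. 0"], simp)
  then show ?case using Suc by (metis C_k.simps(2) differentiable_const)
qed simp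

lemma C_k_add:
  assumes "C_k k f" "C_k k g" shows "C_k k (\<lambda>x. f x + g x)"
  using assms
proof (induction k arbitrary: f g)
  case 0
  then show ?case by (auto intro: continuous_intros)
next
  case (Suc k)
  have "dirderiv b (\<lambda>x. f x + g x) = (\<lambda>x. dirderiv b f x + dirderiv b g x)" for b
    by (rule ext, rule dirderiv_eqI[where f' = "\<lambda>v. dirderiv v f _ + dirderiv v g _"])
       (use Suc.prems in \<open>auto intro!: has_derivative_add has_derivative_frechet\<close>)
  then show ?case using Suc by auto
qed

lemma C_k_mult:
  assumes "C_k k f" "C_k k g" shows "C_k k (\<lambda>x. f x * g x)"
  using assms
proof (induction k arbitrary: f g)
  case 0
  then show ?case by (auto intro: continuous_intros)
next
  case (Suc k)
  have *: "dirderiv b (\<lambda>x. f x * g x) = (\<lambda>x. f x * dirderiv b g x + dirderiv b f x * g x)" for b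
    by (rule ext, rule dirderiv_eqI[where f' = "\<lambda>v. f _ * dirderiv v g _ + dirderiv v f _ * g _"])
       (use Suc.prems in \<open>auto intro!: has_derivative_mult has_derivative_frechet\<close>)
  \<comment> \<open>The product rule leaves one factor undifferentiated, so the induction hypothesis
    also needs the factors themselves one order lower.\<close>
  have "C_k k f" "C_k k g" using Suc.prems C_k_Suc_imp by blast+
  then show ?case using Suc by (auto simp: * intro!: C_k_add)
qed

lemma C_k_cmult: "C_k k f \<Longrightarrow> C_k k (\<lambda>x. a * f x)"
  by (intro C_k_mult C_k_const)

lemma C_k_diff: "C_k k f \<Longrightarrow> C_k k g \<Longrightarrow> C_k k (\<lambda>x. f x - g x)"
  using C_k_add[of k f "\<lambda>x. -1 * g x"] C_k_cmult[of k g "-1"] by simp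

lemma C_k_sum:
  "(\<And>i. i \<in> I \<Longrightarrow> C_k k (f i)) \<Longrightarrow> C_k k (\<lambda>x. \<Sum>i\<in>I. f i x)"
  by (induction I rule: infinite_finite_induct) (auto intro: C_k_add)

lemma C_k_prod:
  "(\<And>i. i \<in> I \<Longrightarrow> C_k k (f i)) \<Longrightarrow> C_k k (\<lambda>x. \<Prod>i\<in>I. f i x)"
  by (induction I rule: infinite_finite_induct) (auto intro: C_k_mult)

lemma C_k_inner [simp]: "C_k k (\<lambda>x. x \<bullet> v)"
proof (cases k)
  case (Suc l)
  have "dirderiv b (\<lambda>x. x \<bullet> v) = (\<lambda>x. b \<bullet> v)" for b
    by (rule ext, rule dirderiv_eqI[where f' = "\<lambda>u. u \<bullet> v"]) (auto intro!: derivative_eq_intros)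
  then show ?thesis unfolding Suc by (auto simp: differentiable_def intro!: exI derivative_eq_intros)
qed (auto intro: continuous_intros)

lemma C_k_affine:
  fixes A :: "'b::euclidean_space \<Rightarrow> 'a::euclidean_space"
  assumes "bounded_linear A" "C_k k f" shows "C_k k (\<lambda>x. f (A x + c))"
  using assms(2)
proof (induction k arbitrary: f)
  case 0
  then show ?case
    using continuous_on_compose2[of UNIV f UNIV "\<lambda>x. A x + c"]
      continuous_on_add[OF linear_continuous_on[OF assms(1), of UNIV] continuous_on_const[of UNIV c]]
    by auto
next
  case (Suc k)
  have d: "((\<lambda>x. f (A x + c)) has_derivative (\<lambda>v. dirderiv (A v) f (A x + c))) (at x)" for x
  proof -
    have 1: "((\<lambda>x. A x + c) has_derivative A) (at x)"
      by (rule has_derivative_add_const) (rule bounded_linear_imp_has_derivative[OF assms(1)])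
    have "(f has_derivative (\<lambda>v. dirderiv v f (A x + c))) (at (A x + c))"
      using Suc.prems by (auto intro!: has_derivative_frechet)
    from has_derivative_compose[OF 1 this] show ?thesis .
  qed
  \<comment> \<open>The image \<open>A b\<close> of a basis vector need not be a basis vector, hence
    the expansion into basis directions before the induction hypothesis applies.\<close>
  have "dirderiv b (\<lambda>x. f (A x + c)) = (\<lambda>x. \<Sum>b'\<in>Basis. (A b \<bullet> b') * dirderiv b' f (A x + c))" for b
    by (rule ext, subst dirderiv_eqI[OF d], rule dirderiv_expand) (use Suc.prems in auto)
  then show ?case using Suc d
    by (auto simp: differentiable_def intro!: C_k_sum C_k_cmult)
qed

lemma C_k_dirderiv: "C_k (Suc k) f \<Longrightarrow> C_k k (dirderiv v f)"
proof -
  assume a: "C_k (Suc k) f"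
  have "dirderiv v f = (\<lambda>x. \<Sum>b\<in>Basis. (v \<bullet> b) * dirderiv b f x)"
    by (rule ext, rule dirderiv_expand) (use a in auto)
  then show ?thesis using a by (auto intro!: C_k_sum C_k_cmult)
qed

subsection \<open>Smooth bumps\<close>

text \<open>The classical smooth function \<open>exp (- 1/t)\<close>, extended by zero, with an
  extra power of \<open>1/t\<close>. The powers make the family closed under differentiation up to
  linear combinations, so smoothness becomes an induction.\<close>

definition flat :: "nat \<Rightarrow> real \<Rightarrow> real" where
  "flat n t = (if t \<le> 0 then 0 else (1/t) ^ n * exp (- (1/t)))"

lemma flat_nonneg: "0 \<le> flat n t"
  by (simp add: flat_def)

lemma flat_pos: "t > 0 \<Longrightarrow> flat n t > 0"
  by (simp add: flat_def)

lemma flat_0_le_1: "flat 0 t \<le> 1"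
  by (simp add: flat_def)

lemma flat_div_tendsto_0: "((\<lambda>t. flat n t) \<longlongrightarrow> 0) (at 0)"
proof -
  have "((\<lambda>t. flat n t) \<longlongrightarrow> 0) (at_left 0)"
    by (rule tendsto_eventually) (auto simp: eventually_at_left_field flat_def intro!: exI[of _ "-1"])
  moreover have "((\<lambda>t. flat n t) \<longlongrightarrow> 0) (at_right 0)"
  proof -
    have "((\<lambda>t::real. inverse t ^ n / exp (inverse t)) \<longlongrightarrow> 0) (at_right 0)"
      by (rule filterlim_compose[OF tendsto_power_div_exp_0 filterlim_inverse_at_top_right])
    then show ?thesis
      by (rule Lim_transform_eventually)
         (auto simp: eventually_at_right_field flat_def exp_minus field_simps intro!: exI[of _ 1])
  qed
  ultimately show ?thesis by (simp add: filterlim_split_at)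
qed

lemma flat_deriv: "(flat n has_real_derivative (flat (n+2) t - real n * flat (n+1) t)) (at t)"
proof (cases "t = 0")
  case True
  \<comment> \<open>Dividing by \<open>h\<close> raises the power of \<open>1/h\<close> by one, so
    the difference quotient at the origin is \<open>flat (Suc n)\<close> itself, which tends to
    zero.\<close>
  have "((\<lambda>h. (flat n (0 + h) - flat n 0) / h) \<longlongrightarrow> 0) (at 0)"
    by (rule Lim_transform_eventually[OF flat_div_tendsto_0[of "Suc n"]])
       (auto simp: eventually_at flat_def field_simps intro!: exI[of _ 1])
  then show ?thesis using True by (simp add: DERIV_def flat_def)
next
  case False
  show ?thesis
  proof (cases "t < 0")
    case True
    have "((\<lambda>_. 0) has_real_derivative 0) (at t)" by simp
    then have "(flat n has_real_derivative 0) (at t)"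
      by (rule has_field_derivative_transform_within_open[where S = "{..<0}"]) (use True in \<open>auto simp: flat_def\<close>)
    then show ?thesis using True by (simp add: flat_def)
  next
    case False
    with \<open>t \<noteq> 0\<close> have t: "t > 0" by simp
    have u: "((\<lambda>t. 1/t) has_real_derivative - ((1/t)^2)) (at t)"
      by (rule derivative_eq_intros refl | use t in \<open>simp add: power2_eq_square\<close>)+
    have e: "((\<lambda>t. exp (- (1/t))) has_real_derivative exp (- (1/t)) * (1/t)^2) (at t)"
      by (rule DERIV_cong[OF DERIV_chain2[OF DERIV_exp DERIV_minus[OF u]]]) simp
    \<comment> \<open>For \<open>n = 0\<close> the truncated exponent \<open>n - 1\<close> is
      harmless because the factor \<open>real n\<close> vanishes.\<close>
    have alg: "real n * (- y\<^sup>2 * y ^ (n - 1)) * E + E * y\<^sup>2 * y ^ n = y^(n+2) * E - real n * (y^(n+1) * E)"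
      for y E :: real
      by (cases n) (simp_all add: algebra_simps power2_eq_square)
    have "((\<lambda>t. (1/t) ^ n * exp (- (1/t))) has_real_derivative
        (flat (n+2) t - real n * flat (n+1) t)) (at t)"
      by (rule DERIV_cong[OF DERIV_mult[OF DERIV_power[OF u] e]])
         (use t alg[of "1/t" "exp (- (1/t))"] in \<open>simp add: flat_def del: power_divide\<close>)
    then show ?thesis
      by (rule has_field_derivative_transform_within_open[where S = "{0<..}"]) (use t in \<open>auto simp: flat_def\<close>)
  qed
qed

lemma flat_compose_deriv:
  assumes "(p has_derivative p') (at x)"
  shows "((\<lambda>x. flat n (p x)) has_derivative
    (\<lambda>v. (flat (n+2) (p x) - real n * flat (n+1) (p x)) * p' v)) (at x)"
  using has_derivative_compose[OF assms flat_deriv[unfolded has_field_derivative_def]]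
  by simp

text \<open>A derivative of \<open>flat n (p x)\<close> is a combination of
  \<open>flat (n+2)\<close> and \<open>flat (n+1)\<close> at \<open>p x\<close>, times a smooth
  derivative of \<open>p\<close>; the induction on \<open>k\<close> therefore runs over all
  \<open>n\<close> at once.\<close>

lemma C_k_flat:
  assumes "\<And>k. C_k k p" shows "C_k k (\<lambda>x. flat n (p x))"
proof (induction k arbitrary: n)
  case 0
  have "continuous_on UNIV (flat n)"
    using flat_deriv DERIV_isCont continuous_at_imp_continuous_on by blast
  then show ?case using assms[of 0]
    by simp (metis continuous_on_compose2 subset_UNIV)
next
  case (Suc k)
  have p: "p differentiable (at x)" for x using assms[of 1] by simp
  note d = flat_compose_deriv[OF has_derivative_frechet[OF p], of n]
  have 1: "C_k k (dirderiv b (\<lambda>x. flat n (p x)))" for b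
  proof -
    have eq: "dirderiv b (\<lambda>x. flat n (p x)) =
        (\<lambda>x. (flat (n+2) (p x) - real n * flat (n+1) (p x)) * dirderiv b p x)"
      by (rule ext, rule dirderiv_eqI[OF d])
    show ?thesis unfolding eq
      by (intro C_k_mult C_k_diff C_k_const Suc.IH C_k_dirderiv assms)
  qed
  have 2: "(\<lambda>x. flat n (p x)) differentiable (at x)" for x
    using d unfolding differentiable_def by blast
  show ?case unfolding C_k.simps(2) by (intro conjI allI ballI 1 2)
qed

subsection \<open>Test functions\<close>

lemma test_functionI:
  assumes "\<And>k. C_k k \<phi>" "compact K" "K \<subseteq> \<Omega>" "\<And>x. \<phi> x \<noteq> 0 \<Longrightarrow> x \<in> K"
  shows "test_function \<Omega> \<phi>"
proof -
  have "closure {x. \<phi> x \<noteq> 0} \<subseteq> K"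
    by (rule closure_minimal) (use assms in \<open>auto intro: compact_imp_closed\<close>)
  then show ?thesis unfolding test_function_def
    using assms by (auto intro!: bounded_subset[OF compact_imp_bounded[OF assms(2)]])
qed

lemma test_functionD:
  assumes "test_function \<Omega> \<phi>"
  obtains K where "compact K" "K \<subseteq> \<Omega>" "\<And>x. x \<notin> K \<Longrightarrow> \<phi> x = 0"
  using assms closure_subset[of "{x. \<phi> x \<noteq> 0}"] unfolding test_function_def by blast

lemma test_function_C_k: "test_function \<Omega> \<phi> \<Longrightarrow> C_k k \<phi>"
  by (simp add: test_function_def)

lemma test_function_differentiable: "test_function \<Omega> \<phi> \<Longrightarrow> \<phi> differentiable (at x)"
  using test_function_C_k[of \<Omega> \<phi> 1] by simp

lemma test_function_has_derivative:
  "test_function \<Omega> \<phi> \<Longrightarrow> (\<phi> has_derivative (\<lambda>v. dirderiv v \<phi> x)) (at x)"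
  by (intro has_derivative_frechet test_function_differentiable)

lemma test_function_continuous: "test_function \<Omega> \<phi> \<Longrightarrow> continuous_on UNIV \<phi>"
  using test_function_C_k C_k_continuous by blast

lemma test_function_borel [measurable_dest]: "test_function \<Omega> \<phi> \<Longrightarrow> \<phi> \<in> borel_measurable borel"
  using test_function_continuous borel_measurable_continuous_onI by blast

lemma test_function_bounded:
  fixes \<phi> :: "'a::euclidean_space \<Rightarrow> real"
  assumes "test_function \<Omega> \<phi>" obtains B where "B > 0" "\<And>x. \<bar>\<phi> x\<bar> \<le> B"
proof -
  obtain K where K: "compact K" "\<And>x. x \<notin> K \<Longrightarrow> \<phi> x = 0" using test_functionD[OF assms] by metis
  have "bounded (\<phi> ` K)"
    by (intro compact_imp_bounded compact_continuous_image K continuous_on_subset[OF test_function_continuous[OF assms]]) auto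
  then obtain B where "B > 0" "\<forall>x\<in>K. \<bar>\<phi> x\<bar> \<le> B" unfolding bounded_pos by auto
  then show ?thesis using that[of B] K by (metis abs_zero less_eq_real_def)
qed

lemma test_function_mono: "test_function \<Omega> \<phi> \<Longrightarrow> \<Omega> \<subseteq> \<Omega>' \<Longrightarrow> test_function \<Omega>' \<phi>"
  unfolding test_function_def by blast

lemma test_function_dirderiv:
  fixes \<phi> :: "'a::euclidean_space \<Rightarrow> real"
  assumes "test_function \<Omega> \<phi>" shows "test_function \<Omega> (dirderiv v \<phi>)"
proof -
  obtain K where K: "compact K" "K \<subseteq> \<Omega>" "\<And>x. x \<notin> K \<Longrightarrow> \<phi> x = 0" using test_functionD[OF assms] by metis
  have "dirderiv v \<phi> x = 0" if "x \<notin> K" for x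
  proof -
    have "((\<lambda>_. 0) has_derivative (\<lambda>_. 0)) (at x)" by simp
    then have "(\<phi> has_derivative (\<lambda>_. 0)) (at x)"
      by (rule has_derivative_transform_within_open[where s = "- K"])
         (use K that in \<open>auto simp: open_Compl compact_imp_closed\<close>)
    then show ?thesis by (rule dirderiv_eqI)
  qed
  then show ?thesis
    by (intro test_functionI[OF C_k_dirderiv[OF test_function_C_k[OF assms]] K(1,2)]) blast
qed

lemma test_function_cmult: "test_function \<Omega> \<phi> \<Longrightarrow> test_function \<Omega> (\<lambda>x. a * \<phi> x)"
  by (rule test_functionD, assumption)
    (rule test_functionI, rule C_k_cmult, rule test_function_C_k, assumption+, auto)

lemma test_function_add:
  assumes "test_function \<Omega> \<phi>" "test_function \<Omega> \<psi>" shows "test_function \<Omega> (\<lambda>x. \<phi> x + \<psi> x)"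
proof -
  obtain K where K: "compact K" "K \<subseteq> \<Omega>" "\<And>x. x \<notin> K \<Longrightarrow> \<phi> x = 0" using test_functionD[OF assms(1)] by metis
  obtain L where L: "compact L" "L \<subseteq> \<Omega>" "\<And>x. x \<notin> L \<Longrightarrow> \<psi> x = 0" using test_functionD[OF assms(2)] by metis
  show ?thesis
  proof (rule test_functionI[of _ "K \<union> L"])
    show "\<And>x. \<phi> x + \<psi> x \<noteq> 0 \<Longrightarrow> x \<in> K \<union> L" using K(3) L(3) by fastforce
  qed (use K L in \<open>auto intro: C_k_add test_function_C_k[OF assms(1)] test_function_C_k[OF assms(2)]\<close>)
qed

lemma test_function_diff:
  "test_function \<Omega> \<phi> \<Longrightarrow> test_function \<Omega> \<psi> \<Longrightarrow> test_function \<Omega> (\<lambda>x. \<phi> x - \<psi> x)"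
  using test_function_add[of \<Omega> \<phi> "\<lambda>x. (-1) * \<psi> x"] test_function_cmult[of \<Omega> \<psi> "-1"] by simp

lemma C_k_fst: "C_k k \<phi> \<Longrightarrow> C_k k (\<lambda>p::'a::euclidean_space \<times> 'b::euclidean_space. \<phi> (fst p))"
  using C_k_affine[OF bounded_linear_fst, of k \<phi> 0] by simp

lemma C_k_snd: "C_k k \<phi> \<Longrightarrow> C_k k (\<lambda>p::'a::euclidean_space \<times> 'b::euclidean_space. \<phi> (snd p))"
  using C_k_affine[OF bounded_linear_snd, of k \<phi> 0] by simp

lemma test_function_tensor:
  fixes \<phi> :: "'a::euclidean_space \<Rightarrow> real" and \<psi> :: "'b::euclidean_space \<Rightarrow> real"
  assumes "test_function \<Omega> \<phi>" "test_function \<Omega>' \<psi>"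
  shows "test_function (\<Omega> \<times> \<Omega>') (\<lambda>p. \<phi> (fst p) * \<psi> (snd p))"
proof -
  obtain K where K: "compact K" "K \<subseteq> \<Omega>" "\<And>x. x \<notin> K \<Longrightarrow> \<phi> x = 0" using test_functionD[OF assms(1)] by metis
  obtain L where L: "compact L" "L \<subseteq> \<Omega>'" "\<And>x. x \<notin> L \<Longrightarrow> \<psi> x = 0" using test_functionD[OF assms(2)] by metis
  show ?thesis
  proof (rule test_functionI[of _ "K \<times> L"])
    show "\<And>x. \<phi> (fst x) * \<psi> (snd x) \<noteq> 0 \<Longrightarrow> x \<in> K \<times> L"
      using K(3) L(3) by (metis mem_Times_iff mult_eq_0_iff)
  qed (use K L in \<open>auto intro!: C_k_mult C_k_fst C_k_snd test_function_C_k[OF assms(1)] test_function_C_k[OF assms(2)] compact_Times\<close>)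
qed

lemma test_function_tensor_strip:
  fixes \<phi> :: "real \<times> 'a::euclidean_space \<Rightarrow> real" and e :: "'b::euclidean_space \<Rightarrow> real"
  assumes "test_function (I \<times> UNIV) \<phi>" "test_function J e"
  shows "test_function (I \<times> (UNIV \<times> J)) (\<lambda>p. \<phi> (fst p, fst (snd p)) * e (snd (snd p)))"
proof -
  obtain K where K: "compact K" "K \<subseteq> I \<times> UNIV" "\<And>x. x \<notin> K \<Longrightarrow> \<phi> x = 0" using test_functionD[OF assms(1)] by metis
  obtain L where L: "compact L" "L \<subseteq> J" "\<And>x. x \<notin> L \<Longrightarrow> e x = 0" using test_functionD[OF assms(2)] by metis
  \<comment> \<open>The supports are given for \<open>((t, X), z)\<close>, whereas points of the
    strip problem are bracketed as \<open>(t, (X, z))\<close>; \<open>?g\<close>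
    reassociates.\<close>
  let ?g = "\<lambda>q::(real \<times> 'a) \<times> 'b. (fst (fst q), (snd (fst q), snd q))"
  have bl: "bounded_linear (\<lambda>p::real \<times> ('a \<times> 'b). (fst p, fst (snd p)))"
    "bounded_linear (\<lambda>p::real \<times> ('a \<times> 'b). snd (snd p))"
    by (intro bounded_linear_Pair bounded_linear_fst bounded_linear_fst_comp bounded_linear_snd bounded_linear_snd_comp)+
  show ?thesis
  proof (rule test_functionI[of _ "?g ` (K \<times> L)"])
    show "compact (?g ` (K \<times> L))"
      by (intro compact_continuous_image compact_Times K L continuous_intros)
    show "?g ` (K \<times> L) \<subseteq> I \<times> (UNIV \<times> J)" using K(2) L(2) by fastforce
    show "x \<in> ?g ` (K \<times> L)" if "\<phi> (fst x, fst (snd x)) * e (snd (snd x)) \<noteq> 0" for x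
    proof -
      have "(fst x, fst (snd x)) \<in> K" "snd (snd x) \<in> L" using that K(3) L(3) by force+
      then show ?thesis by (intro image_eqI[of _ _ "((fst x, fst (snd x)), snd (snd x))"]) auto
    qed
    show "C_k k (\<lambda>p::real \<times> ('a \<times> 'b). \<phi> (fst p, fst (snd p)) * e (snd (snd p)))" for k
      using C_k_affine[OF bl(1) test_function_C_k[OF assms(1)], of k 0]
        C_k_affine[OF bl(2) test_function_C_k[OF assms(2)], of k 0]
      by (auto intro!: C_k_mult)
  qed
qed

lemma dirderiv_compose_linear:
  assumes "bounded_linear A" "f differentiable (at (A x + c))"
  shows "dirderiv v (\<lambda>x. f (A x + c)) x = dirderiv (A v) f (A x + c)"
  by (rule dirderiv_eqI[OF has_derivative_compose])
     (rule has_derivative_add_const, rule bounded_linear_imp_has_derivative[OF assms(1)],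
      rule has_derivative_frechet[OF assms(2)])

lemma dirderiv_mult:
  assumes "f differentiable (at x)" "g differentiable (at x)"
  shows "dirderiv v (\<lambda>x. f x * g x) x = f x * dirderiv v g x + dirderiv v f x * g x"
  by (rule dirderiv_eqI[where f' = "\<lambda>v. f x * dirderiv v g x + dirderiv v f x * g x"])
     (auto intro!: has_derivative_mult has_derivative_frechet assms)

lemma dirderiv_zero: "f differentiable (at x) \<Longrightarrow> dirderiv 0 f x = 0"
  using dirderiv_expand[of f x 0] by simp

lemma dirderiv_real: "(e::real \<Rightarrow> real) differentiable (at z) \<Longrightarrow> dirderiv v e z = v * deriv e z"
  by (rule dirderiv_eqI[where f' = "\<lambda>v. v * deriv e z"])
     (metis DERIV_deriv_iff_real_differentiable has_field_derivative_def mult.commute mult_commute_abs)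

lemma test_function_deriv: "test_function \<Omega> e \<Longrightarrow> test_function \<Omega> (deriv (e::real \<Rightarrow> real))"
proof -
  assume a: "test_function \<Omega> e"
  then have "deriv e = dirderiv 1 e" by (auto simp: dirderiv_real test_function_differentiable fun_eq_iff)
  then show ?thesis using a test_function_dirderiv by metis
qed

lemma dirderiv_tensor_strip:
  fixes \<phi> :: "real \<times> 'a::euclidean_space \<Rightarrow> real" and e :: "real \<Rightarrow> real"
  assumes "test_function \<Omega> \<phi>" "test_function J e"
  shows "dirderiv (s, (Y, a)) (\<lambda>p. \<phi> (fst p, fst (snd p)) * e (snd (snd p))) (t, (X, z))
    = dirderiv (s, Y) \<phi> (t, X) * e z + \<phi> (t, X) * (a * deriv e z)"
proof -
  have bl: "bounded_linear (\<lambda>p::real \<times> ('a \<times> real). (fst p, fst (snd p)))"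
    "bounded_linear (\<lambda>p::real \<times> ('a \<times> real). snd (snd p))"
    by (intro bounded_linear_Pair bounded_linear_fst bounded_linear_fst_comp bounded_linear_snd bounded_linear_snd_comp)+
  note d = test_function_differentiable[OF assms(1)] test_function_differentiable[OF assms(2)]
  have 1: "(\<lambda>p::real \<times> ('a \<times> real). \<phi> (fst p, fst (snd p))) differentiable (at (t,(X,z)))"
    "(\<lambda>p::real \<times> ('a \<times> real). e (snd (snd p))) differentiable (at (t,(X,z)))"
    using differentiable_chain_at[OF bounded_linear_imp_differentiable[OF bl(1)] d(1)]
      differentiable_chain_at[OF bounded_linear_imp_differentiable[OF bl(2)] d(2)]
    by (auto simp: o_def)
  show ?thesis
    using dirderiv_compose_linear[OF bl(1), of \<phi> "(t,(X,z))" 0] dirderiv_compose_linear[OF bl(2), of e "(t,(X,z))" 0]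
    by (subst dirderiv_mult[OF 1]) (simp add: d dirderiv_real)
qed

lemma dirderiv_tensor:
  fixes \<theta> :: "real \<Rightarrow> real" and \<eta> :: "'a::euclidean_space \<Rightarrow> real"
  assumes "test_function I \<theta>" "test_function J \<eta>"
  shows "dirderiv (0, Y) (\<lambda>p. \<theta> (fst p) * \<eta> (snd p)) (t, X) = \<theta> t * dirderiv Y \<eta> X"
proof -
  note d = test_function_differentiable[OF assms(1)] test_function_differentiable[OF assms(2)]
  have 1: "(\<lambda>p::real \<times> 'a. \<theta> (fst p)) differentiable (at (t,X))"
    "(\<lambda>p::real \<times> 'a. \<eta> (snd p)) differentiable (at (t,X))"
    using differentiable_chain_at[OF bounded_linear_imp_differentiable[OF bounded_linear_fst] d(1)]
      differentiable_chain_at[OF bounded_linear_imp_differentiable[OF bounded_linear_snd] d(2)]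
    by (auto simp: o_def)
  show ?thesis
    using dirderiv_compose_linear[OF bounded_linear_fst, of \<theta> "(t,X)" 0 "(0,Y)"]
      dirderiv_compose_linear[OF bounded_linear_snd, of \<eta> "(t,X)" 0 "(0,Y)"]
    by (subst dirderiv_mult[OF 1]) (simp add: d dirderiv_zero)
qed

lemma test_function_section:
  fixes \<phi> :: "real \<times> 'a::euclidean_space \<Rightarrow> real"
  assumes "test_function (I \<times> UNIV) \<phi>"
  shows "test_function UNIV (\<lambda>X. \<phi> (t, X))" "dirderiv (0, Y) \<phi> (t, X) = dirderiv Y (\<lambda>X. \<phi> (t, X)) X"
proof -
  obtain K where K: "compact K" "\<And>x. x \<notin> K \<Longrightarrow> \<phi> x = 0" using test_functionD[OF assms] by metis
  have bl: "bounded_linear (\<lambda>X::'a. (0::real, X))"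
    by (intro bounded_linear_Pair bounded_linear_ident bounded_linear_zero)
  show "test_function UNIV (\<lambda>X. \<phi> (t, X))"
  proof (rule test_functionI[of _ "snd ` K"])
    show "compact (snd ` K)" by (intro compact_continuous_image K continuous_intros)
    show "X \<in> snd ` K" if "\<phi> (t, X) \<noteq> 0" for X
      using K(2) that by (intro image_eqI[of _ _ "(t, X)"]) auto
    show "C_k k (\<lambda>X. \<phi> (t, X))" for k
      using C_k_affine[OF bl test_function_C_k[OF assms], of k "(t, 0)"] by simp
  qed simp
  show "dirderiv (0, Y) \<phi> (t, X) = dirderiv Y (\<lambda>X. \<phi> (t, X)) X"
    using dirderiv_compose_linear[OF bl, of \<phi> X "(t,0)" Y] test_function_differentiable[OF assms] by simp
qed

subsection \<open>Symmetry of second derivatives\<close>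

text \<open>The mean value theorem, used once in direction \<open>u\<close> and once in direction
  \<open>v\<close>, turns the quotient into the mixed derivative at a nearby point, and this
  derivative is continuous. As the second difference is symmetric in \<open>u\<close> and
  \<open>v\<close>, the two orders of differentiation must have the same limit.\<close>

lemma double_difference:
  fixes f :: "'a::euclidean_space \<Rightarrow> real"
  assumes "\<And>k. C_k k f"
  shows "((\<lambda>h. (f (x + h *\<^sub>R u + h *\<^sub>R v) - f (x + h *\<^sub>R u) - f (x + h *\<^sub>R v) + f x) / h\<^sup>2)
    \<longlongrightarrow> dirderiv v (dirderiv u f) x) (at_right 0)"
proof -
  have along: "((\<lambda>s. g (y + s *\<^sub>R w)) has_real_derivative dirderiv w g (y + s *\<^sub>R w)) (at s)"
    if "C_k 1 g" for g :: "'a \<Rightarrow> real" and y w s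
  proof -
    have g: "(g has_derivative (\<lambda>v. dirderiv v g (y + s *\<^sub>R w))) (at (y + s *\<^sub>R w))"
      using that by (intro has_derivative_frechet) simp
    have "((\<lambda>s. y + s *\<^sub>R w) has_derivative (\<lambda>h. h *\<^sub>R w)) (at s)"
      by (auto intro!: derivative_eq_intros)
    from has_derivative_compose[OF this g]
    have "((\<lambda>s. g (y + s *\<^sub>R w)) has_derivative (\<lambda>h. dirderiv (h *\<^sub>R w) g (y + s *\<^sub>R w))) (at s)" .
    moreover have "dirderiv (h *\<^sub>R w) g (y + s *\<^sub>R w) = h * dirderiv w g (y + s *\<^sub>R w)" for h
      using linear_cmul[OF has_derivative_linear[OF g], of h w] by simp
    ultimately show ?thesis by (simp add: has_field_derivative_def mult_commute_abs)
  qed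
  have ex: "\<exists>s t. 0 \<le> s \<and> s \<le> h \<and> 0 \<le> t \<and> t \<le> h \<and>
      (f (x + h *\<^sub>R u + h *\<^sub>R v) - f (x + h *\<^sub>R u) - f (x + h *\<^sub>R v) + f x)
      = h\<^sup>2 * dirderiv v (dirderiv u f) (x + s *\<^sub>R u + t *\<^sub>R v)" if h: "h > 0" for h
  proof -
    define p where "p = (\<lambda>s. f ((x + h *\<^sub>R v) + s *\<^sub>R u) - f (x + s *\<^sub>R u))"
    have "(p has_real_derivative (dirderiv u f ((x + h *\<^sub>R v) + s *\<^sub>R u) - dirderiv u f (x + s *\<^sub>R u))) (at s)" for s
      unfolding p_def by (intro DERIV_diff along assms)
    from MVT2[OF h this] obtain s where s: "0 < s" "s < h"
      "p h - p 0 = h * (dirderiv u f ((x + h *\<^sub>R v) + s *\<^sub>R u) - dirderiv u f (x + s *\<^sub>R u))" by auto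
    have "C_k 1 (dirderiv u f)" by (intro C_k_dirderiv assms)
    from MVT2[OF h along[OF this, of "x + s *\<^sub>R u" v]] obtain t where t: "0 < t" "t < h"
      "dirderiv u f (x + s *\<^sub>R u + h *\<^sub>R v) - dirderiv u f (x + s *\<^sub>R u) = h * dirderiv v (dirderiv u f) (x + s *\<^sub>R u + t *\<^sub>R v)"
      by auto
    have "p h - p 0 = h * (h * dirderiv v (dirderiv u f) (x + s *\<^sub>R u + t *\<^sub>R v))"
      using s(3) t(3) by (simp add: algebra_simps)
    then show ?thesis using s t unfolding p_def
      by (intro exI[of _ s] exI[of _ t]) (simp add: algebra_simps power2_eq_square)
  qed
  then obtain s t where st: "\<And>h. h > 0 \<Longrightarrow> 0 \<le> s h \<and> s h \<le> h \<and> 0 \<le> t h \<and> t h \<le> h \<and>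
      (f (x + h *\<^sub>R u + h *\<^sub>R v) - f (x + h *\<^sub>R u) - f (x + h *\<^sub>R v) + f x)
      = h\<^sup>2 * dirderiv v (dirderiv u f) (x + s h *\<^sub>R u + t h *\<^sub>R v)" by metis
  have pos: "eventually (\<lambda>h::real. h > 0) (at_right 0)" by (simp add: eventually_at_right_less)
  have id: "((\<lambda>h::real. h) \<longlongrightarrow> 0) (at_right 0)" by simp
  have "(s \<longlongrightarrow> 0) (at_right 0)" "(t \<longlongrightarrow> 0) (at_right 0)"
    by (rule tendsto_sandwich[OF _ _ tendsto_const id]; rule eventually_mono[OF pos]; use st in blast)+
  then have "((\<lambda>h. x + s h *\<^sub>R u + t h *\<^sub>R v) \<longlongrightarrow> x + 0 *\<^sub>R u + 0 *\<^sub>R v) (at_right 0)"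
    by (intro tendsto_intros)
  moreover have "isCont (dirderiv v (dirderiv u f)) x"
    using C_k_continuous[of 0 "dirderiv v (dirderiv u f)"] C_k_dirderiv assms
    by (metis UNIV_I continuous_on_eq_continuous_at open_UNIV)
  ultimately have "((\<lambda>h. dirderiv v (dirderiv u f) (x + s h *\<^sub>R u + t h *\<^sub>R v)) \<longlongrightarrow> dirderiv v (dirderiv u f) x) (at_right 0)"
    using isCont_tendsto_compose by auto
  then show ?thesis
    by (rule Lim_transform_eventually) (use st in \<open>auto intro: eventually_mono[OF pos]\<close>)
qed

lemma dirderiv_commute:
  fixes f :: "'a::euclidean_space \<Rightarrow> real"
  assumes "test_function \<Omega> f"
  shows "dirderiv u (dirderiv v f) = dirderiv v (dirderiv u f)"
proof
  fix x
  have c: "C_k k f" for k using assms by (rule test_function_C_k)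
  show "dirderiv u (dirderiv v f) x = dirderiv v (dirderiv u f) x"
    by (rule tendsto_unique[OF _ double_difference[OF c, of x v u]])
       (use double_difference[OF c, of x u v] in \<open>simp_all add: algebra_simps\<close>)
qed

section \<open>Functionals continuous under bounded pointwise convergence\<close>

definition bnd_borel :: "('a::euclidean_space \<Rightarrow> real) \<Rightarrow> bool" where
  "bnd_borel h \<longleftrightarrow> h \<in> borel_measurable borel \<and> (\<exists>B. \<forall>x. \<bar>h x\<bar> \<le> B)"

lemma bnd_borelI: "h \<in> borel_measurable borel \<Longrightarrow> (\<And>x. \<bar>h x\<bar> \<le> B) \<Longrightarrow> bnd_borel h"
  unfolding bnd_borel_def by blast

lemma bnd_borel_measurable [measurable_dest]: "bnd_borel h \<Longrightarrow> h \<in> borel_measurable borel"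
  by (simp add: bnd_borel_def)

lemma bnd_borelE:
  assumes "bnd_borel h" obtains B where "B > 0" "\<And>x. \<bar>h x\<bar> \<le> B"
proof -
  obtain B where "\<And>x. \<bar>h x\<bar> \<le> B" using assms unfolding bnd_borel_def by blast
  then have "\<bar>h x\<bar> \<le> max 1 B" for x using le_max_iff_disj by blast
  then show ?thesis by (intro that[of "max 1 B"]) auto
qed

lemma bnd_borel_add: assumes "bnd_borel h" "bnd_borel g" shows "bnd_borel (\<lambda>x. h x + g x)"
proof -
  obtain B where "\<And>x. \<bar>h x\<bar> \<le> B" using bnd_borelE[OF assms(1)] by metis
  moreover obtain C where "\<And>x. \<bar>g x\<bar> \<le> C" using bnd_borelE[OF assms(2)] by metis
  ultimately have "\<bar>h x + g x\<bar> \<le> B + C" for x by (meson abs_triangle_ineq add_mono order_trans)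
  then show ?thesis using assms by (intro bnd_borelI) (auto dest: bnd_borel_measurable)
qed

lemma bnd_borel_mult: assumes "bnd_borel h" "bnd_borel g" shows "bnd_borel (\<lambda>x. h x * g x)"
proof -
  obtain B where "B > 0" "\<And>x. \<bar>h x\<bar> \<le> B" using bnd_borelE[OF assms(1)] by metis
  moreover obtain C where "\<And>x. \<bar>g x\<bar> \<le> C" using bnd_borelE[OF assms(2)] by metis
  ultimately have "\<bar>h x * g x\<bar> \<le> B * C" for x by (simp add: abs_mult mult_mono')
  then show ?thesis using assms by (intro bnd_borelI) (auto dest: bnd_borel_measurable)
qed

lemma bnd_borel_const [simp]: "bnd_borel (\<lambda>x. a)"
  by (rule bnd_borelI[of _ "\<bar>a\<bar>"]) auto

lemma bnd_borel_cmult: "bnd_borel h \<Longrightarrow> bnd_borel (\<lambda>x. a * h x)"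
  by (intro bnd_borel_mult bnd_borel_const)

lemma bnd_borel_diff: "bnd_borel h \<Longrightarrow> bnd_borel g \<Longrightarrow> bnd_borel (\<lambda>x. h x - g x)"
  using bnd_borel_add[of h "\<lambda>x. -1 * g x"] bnd_borel_cmult[of g "-1"] by simp

lemma bnd_borel_indicator: "A \<in> sets borel \<Longrightarrow> bnd_borel (indicat_real A)"
  by (rule bnd_borelI[of _ 1]) (auto simp: indicator_def)

lemma bnd_borel_sum: "(\<And>i. i \<in> I \<Longrightarrow> bnd_borel (h i)) \<Longrightarrow> bnd_borel (\<lambda>x. \<Sum>i\<in>I. h i x)"
  by (induction I rule: infinite_finite_induct) (auto intro: bnd_borel_add)

lemma bnd_borel_test_function: "test_function \<Omega> \<phi> \<Longrightarrow> bnd_borel \<phi>"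
  by (metis test_function_bounded test_function_borel bnd_borelI)

text \<open>These are the integrals against finite signed Borel measures, described by the only two
  properties that are used, so that no representing measure has to be constructed. The name
  abbreviates bounded convergence and linearity.\<close>

definition bcl :: "(('a::euclidean_space \<Rightarrow> real) \<Rightarrow> real) \<Rightarrow> bool" where
  "bcl F \<longleftrightarrow>
     (\<forall>h g a. bnd_borel h \<longrightarrow> bnd_borel g \<longrightarrow> F (\<lambda>x. h x + a * g x) = F h + a * F g)
   \<and> (\<forall>h k B. (\<forall>n. bnd_borel (h n) \<and> (\<forall>x. \<bar>h n x\<bar> \<le> B)) \<longrightarrow> bnd_borel k
        \<longrightarrow> (\<forall>x. (\<lambda>n. h n x) \<longlonglongrightarrow> k x) \<longrightarrow> (\<lambda>n. F (h n)) \<longlonglongrightarrow> F k)"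

lemma bcl_lin: "bcl F \<Longrightarrow> bnd_borel h \<Longrightarrow> bnd_borel g \<Longrightarrow> F (\<lambda>x. h x + a * g x) = F h + a * F g"
  unfolding bcl_def by blast

lemma bcl_lim:
  assumes "bcl F" "\<And>n. bnd_borel (h n)" "\<And>n x. \<bar>h n x\<bar> \<le> B" "bnd_borel k" "\<And>x. (\<lambda>n. h n x) \<longlonglongrightarrow> k x"
  shows "(\<lambda>n. F (h n)) \<longlonglongrightarrow> F k"
  using assms unfolding bcl_def by blast

lemma bcl_add: "bcl F \<Longrightarrow> bnd_borel h \<Longrightarrow> bnd_borel g \<Longrightarrow> F (\<lambda>x. h x + g x) = F h + F g"
  using bcl_lin[of F h g 1] by simp

lemma bcl_diff: "bcl F \<Longrightarrow> bnd_borel h \<Longrightarrow> bnd_borel g \<Longrightarrow> F (\<lambda>x. h x - g x) = F h - F g"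
  using bcl_lin[of F h g "-1"] by simp

lemma bcl_0: "bcl F \<Longrightarrow> F (\<lambda>x. 0) = 0"
  using bcl_lin[of F "\<lambda>x. 0" "\<lambda>x. 0" 1] by simp

lemma bcl_cmult: "bcl F \<Longrightarrow> bnd_borel g \<Longrightarrow> F (\<lambda>x. a * g x) = a * F g"
  using bcl_lin[of F "\<lambda>x. 0" g a] bcl_0[of F] by simp

lemma bclI:
  assumes "\<And>h g a. bnd_borel h \<Longrightarrow> bnd_borel g \<Longrightarrow> F (\<lambda>x. h x + a * g x) = F h + a * F g"
    and "\<And>h k B. (\<And>n. bnd_borel (h n)) \<Longrightarrow> (\<And>n x. \<bar>h n x\<bar> \<le> B) \<Longrightarrow> bnd_borel k
        \<Longrightarrow> (\<And>x. (\<lambda>n. h n x) \<longlonglongrightarrow> k x) \<Longrightarrow> (\<lambda>n. F (h n)) \<longlonglongrightarrow> F k"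
  shows "bcl F"
  unfolding bcl_def using assms by blast

lemma bcl_plus: assumes "bcl F" "bcl G" shows "bcl (\<lambda>h. F h + b * G h)"
proof (rule bclI)
  fix h g :: "'a \<Rightarrow> real" and a assume "bnd_borel h" "bnd_borel g"
  then show "F (\<lambda>x. h x + a * g x) + b * G (\<lambda>x. h x + a * g x) = F h + b * G h + a * (F g + b * G g)"
    using assms by (simp add: bcl_lin algebra_simps)
next
  fix h :: "nat \<Rightarrow> 'a \<Rightarrow> real" and k :: "'a \<Rightarrow> real" and B :: real
  assume "\<And>n. bnd_borel (h n)" "\<And>n x. \<bar>h n x\<bar> \<le> B" "bnd_borel k" "\<And>x. (\<lambda>n. h n x) \<longlonglongrightarrow> k x"
  then show "(\<lambda>n. F (h n) + b * G (h n)) \<longlonglongrightarrow> F k + b * G k"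
    by (intro tendsto_intros bcl_lim[OF assms(1)] bcl_lim[OF assms(2)])
qed

lemma bcl_compose_mult:
  assumes "bcl F" "bnd_borel k" shows "bcl (\<lambda>h. F (\<lambda>x. h x * k x))"
proof (rule bclI)
  fix h g :: "'a \<Rightarrow> real" and a assume "bnd_borel h" "bnd_borel g"
  then show "F (\<lambda>x. (h x + a * g x) * k x) = F (\<lambda>x. h x * k x) + a * F (\<lambda>x. g x * k x)"
    using bcl_lin[OF assms(1), of "\<lambda>x. h x * k x" "\<lambda>x. g x * k x" a] assms(2)
    by (simp add: bnd_borel_mult algebra_simps)
next
  fix h :: "nat \<Rightarrow> 'a \<Rightarrow> real" and l :: "'a \<Rightarrow> real" and B :: real
  assume h: "\<And>n. bnd_borel (h n)" "\<And>n x. \<bar>h n x\<bar> \<le> B" "bnd_borel l" "\<And>x. (\<lambda>n. h n x) \<longlonglongrightarrow> l x"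
  obtain C where C: "C > 0" "\<And>x. \<bar>k x\<bar> \<le> C" using bnd_borelE[OF assms(2)] by metis
  show "(\<lambda>n. F (\<lambda>x. h n x * k x)) \<longlonglongrightarrow> F (\<lambda>x. l x * k x)"
  proof (rule bcl_lim[OF assms(1), where B = "B * C"])
    show "\<bar>h n x * k x\<bar> \<le> B * C" for n x
      using h(2)[of n x] C by (simp add: abs_mult mult_mono')
  qed (use h assms in \<open>auto intro!: bnd_borel_mult tendsto_intros\<close>)
qed

section \<open>Smooth approximation of boxes, and uniqueness of functionals given on test
  functions\<close>

lemma flat_0_tendsto_1: "(flat 0 \<longlongrightarrow> 1) at_top"
proof -
  have "((\<lambda>t::real. exp (- inverse t)) \<longlongrightarrow> exp (- 0)) at_top"
    by (intro tendsto_intros tendsto_inverse_0_at_top filterlim_ident)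
  then have "((\<lambda>t::real. exp (- inverse t)) \<longlongrightarrow> 1) at_top" by simp
  then show ?thesis
    by (rule Lim_transform_eventually)
       (auto simp: flat_def inverse_eq_divide intro!: eventually_mono[OF eventually_gt_at_top[of 0]])
qed

text \<open>Each face of the box contributes a factor \<open>flat 0 (n * d - 1)\<close>, with
  \<open>d\<close> the signed distance to that face. The shift by 1 keeps the support at distance
  \<open>1/n\<close> from the boundary, and the factor \<open>n\<close> drives the value to the
  limit 1 of \<open>flat 0\<close> at infinity.\<close>

lemma box_approx:
  fixes a b :: "'a::euclidean_space"
  obtains \<psi> :: "nat \<Rightarrow> 'a \<Rightarrow> real" where "\<And>n. test_function (box a b) (\<psi> n)" "\<And>n x. \<bar>\<psi> n x\<bar> \<le> 1"
    "\<And>x. (\<lambda>n. \<psi> n x) \<longlonglongrightarrow> indicator (box a b) x"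
proof
  define \<psi> :: "nat \<Rightarrow> 'a \<Rightarrow> real" where
    "\<psi> n x = (\<Prod>i\<in>Basis. flat 0 (real (Suc n) * (x \<bullet> i - a \<bullet> i) - 1) * flat 0 (real (Suc n) * (b \<bullet> i - x \<bullet> i) - 1))" for n x
  show "test_function (box a b) (\<psi> n)" for n
  proof (rule test_functionI)
    let ?e = "(1 / real (Suc n)) *\<^sub>R One :: 'a"
    have e: "?e \<bullet> i = 1 / real (Suc n)" if "i \<in> Basis" for i
      using that by (simp add: inner_sum_left inner_Basis)
    show "compact (cbox (a + ?e) (b - ?e))" by simp
    show "cbox (a + ?e) (b - ?e) \<subseteq> box a b"
    proof
      fix x assume x: "x \<in> cbox (a + ?e) (b - ?e)"
      show "x \<in> box a b" unfolding mem_box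
      proof
        fix i :: 'a assume i: "i \<in> Basis"
        have "1 / real (Suc n) > 0" by simp
        then show "a \<bullet> i < x \<bullet> i \<and> x \<bullet> i < b \<bullet> i"
          using x i e[OF i] unfolding mem_box inner_add_left inner_diff_left by (smt (verit))
      qed
    qed
    show "C_k k (\<psi> n)" for k
      unfolding \<psi>_def by (intro C_k_prod C_k_mult C_k_flat C_k_diff C_k_const C_k_inner)
    fix x assume "\<psi> n x \<noteq> 0"
    then have nz: "flat 0 (real (Suc n) * (x \<bullet> i - a \<bullet> i) - 1) \<noteq> 0"
      "flat 0 (real (Suc n) * (b \<bullet> i - x \<bullet> i) - 1) \<noteq> 0" if "i \<in> Basis" for i
      using that unfolding \<psi>_def by auto
    have "real (Suc n) * (x \<bullet> i - a \<bullet> i) \<ge> 1" "real (Suc n) * (b \<bullet> i - x \<bullet> i) \<ge> 1" if "i \<in> Basis" for i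
      using nz[OF that] unfolding flat_def by (auto split: if_splits)
    then have "x \<bullet> i - a \<bullet> i \<ge> 1 / real (Suc n)" "b \<bullet> i - x \<bullet> i \<ge> 1 / real (Suc n)" if "i \<in> Basis" for i
      using that by (simp_all add: field_simps)
    then show "x \<in> cbox (a + ?e) (b - ?e)"
      unfolding mem_box inner_add_left inner_diff_left using e by (smt (verit))
  qed
  show "\<bar>\<psi> n x\<bar> \<le> 1" for n x
  proof -
    have "0 \<le> \<psi> n x" unfolding \<psi>_def by (intro prod_nonneg) (simp add: flat_nonneg)
    moreover have "\<psi> n x \<le> 1" unfolding \<psi>_def
      by (intro prod_le_1) (auto simp: flat_nonneg flat_0_le_1 intro!: mult_le_one)
    ultimately show ?thesis by simp
  qed
  show "(\<lambda>n. \<psi> n x) \<longlonglongrightarrow> indicator (box a b) x" for x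
  proof (cases "x \<in> box a b")
    case True
    have one: "(\<lambda>n. flat 0 (real (Suc n) * d - 1)) \<longlonglongrightarrow> 1" if "d > 0" for d
    proof (rule filterlim_compose[OF flat_0_tendsto_1])
      have "filterlim (\<lambda>n. d * real (Suc n)) at_top sequentially"
        by (intro filterlim_tendsto_pos_mult_at_top[OF tendsto_const that]
            filterlim_compose[OF filterlim_real_sequentially filterlim_Suc])
      from filterlim_tendsto_add_at_top[OF tendsto_const[of "-1"] this]
      show "filterlim (\<lambda>n. real (Suc n) * d - 1) at_top sequentially" by (simp add: algebra_simps)
    qed
    have "(\<lambda>n. \<psi> n x) \<longlonglongrightarrow> (\<Prod>i\<in>(Basis::'a set). 1 * 1)"
      unfolding \<psi>_def using True by (intro tendsto_prod tendsto_mult one) (auto simp: mem_box)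
    then show ?thesis using True by simp
  next
    case False
    then obtain i where i: "i \<in> Basis" "x \<bullet> i - a \<bullet> i \<le> 0 \<or> b \<bullet> i - x \<bullet> i \<le> 0"
      unfolding mem_box by force
    have "\<psi> n x = 0" for n
    proof -
      have "real (Suc n) * (x \<bullet> i - a \<bullet> i) - 1 \<le> 0 \<or> real (Suc n) * (b \<bullet> i - x \<bullet> i) - 1 \<le> 0"
        using i(2) mult_nonneg_nonpos[of "real (Suc n)"] by (smt (verit) of_nat_0_le_iff)
      then have "flat 0 (real (Suc n) * (x \<bullet> i - a \<bullet> i) - 1) * flat 0 (real (Suc n) * (b \<bullet> i - x \<bullet> i) - 1) = 0"
        unfolding flat_def by auto
      then show ?thesis unfolding \<psi>_def using i(1) by (intro prod_zero) auto
    qed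
    then show ?thesis using False by simp
  qed
qed

text \<open>This is uniqueness of signed measures. Boxes are limits of test functions, they are
  stable under intersection and generate the Borel sets, so the Dynkin class argument reaches all
  indicators; monotone approximation then reaches bounded functions.\<close>

theorem bcl_vanishes:
  fixes A B :: "'a::euclidean_space"
  assumes F: "bcl F" and 0: "\<And>\<psi>. test_function (box A B) \<psi> \<Longrightarrow> F \<psi> = 0" and h: "bnd_borel h"
  shows "F (\<lambda>x. h x * indicator (box A B) x) = 0"
proof -
  let ?I = "indicat_real (box A B)"
  define G where "G = (\<lambda>h. F (\<lambda>x. h x * ?I x))"
  have G: "bcl G" unfolding G_def by (intro bcl_compose_mult F bnd_borel_indicator) simp
  have box0: "F (indicator (box a b)) = 0" if "box a b \<subseteq> box A B" for a b
  proof -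
    obtain \<psi> where \<psi>: "\<And>n. test_function (box a b) (\<psi> n)" "\<And>n x. \<bar>\<psi> n x\<bar> \<le> 1"
      "\<And>x. (\<lambda>n. \<psi> n x) \<longlonglongrightarrow> indicator (box a b) x" using box_approx[of a b] by metis
    have "(\<lambda>n. F (\<psi> n)) \<longlonglongrightarrow> F (indicator (box a b))"
      by (rule bcl_lim[OF F _ \<psi>(2) _ \<psi>(3)])
         (auto intro: bnd_borel_test_function[OF \<psi>(1)] bnd_borel_indicator)
    moreover have "F (\<psi> n) = 0" for n using 0 \<psi>(1) that test_function_mono by blast
    ultimately show ?thesis by (simp add: LIMSEQ_const_iff)
  qed
  have ind: "indicat_real S x * ?I x = indicat_real (S \<inter> box A B) x" for S x by (simp add: indicator_def)
  have "indicat_real ({} :: 'a set) = (\<lambda>x. 0)" by auto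
  then have G0: "G (indicator {}) = 0" using bcl_0[OF G] by simp
  have sets0: "G (indicator S) = 0" if "S \<in> sets borel" for S
  proof -
    let ?E = "range (\<lambda>(a, b). box a b :: 'a set)"
    have 1: "Int_stable ?E" by (auto simp: Int_stable_def box_Int_box)
    have 2: "?E \<subseteq> Pow UNIV" by auto
    have 3: "S \<in> sigma_sets UNIV ?E" using that unfolding borel_eq_box by simp
    from 1 2 3 show ?thesis
    proof (induction rule: sigma_sets_induct_disjoint)
      case (basic S)
      then obtain a b where S: "S = box a b" by auto
      show ?case unfolding G_def ind S box_Int_box by (rule box0) (auto simp: mem_box)
    next
      case empty
      show ?case by (rule G0)
    next
      case (compl S)
      then have S: "S \<in> sets borel" unfolding borel_eq_box by simp
      have "indicat_real (UNIV - S) = (\<lambda>x. 1 - indicator S x)" by (auto simp: indicator_def)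
      \<comment> \<open>\<open>G\<close> cuts off to the box, so the constant 1 plays the part of
        the indicator of the whole box, which is itself a limit of test functions.\<close>
      moreover have "G (\<lambda>x. 1) = 0" unfolding G_def using box0[of A B] by simp
      ultimately show ?case using compl S
        by (simp add: bcl_diff[OF G] bnd_borel_indicator)
    next
      case (union S)
      have S: "S i \<in> sets borel" for i using union unfolding borel_eq_box by auto
      have "G (indicator (\<Union>i<n. S i)) = 0" for n
      proof (induction n)
        case 0
        have "(\<Union>i<0. S i) = {}" by blast
        then show ?case by (simp only: G0)
      next
        case (Suc n)
        have "S n \<inter> S i = {}" if "i < n" for i
          using disjoint_family_onD[OF union(1), of n i] that by auto
        then have "S n \<inter> (\<Union>i<n. S i) = {}" by blast
        then have e: "indicat_real (\<Union>i<Suc n. S i) = (\<lambda>x. indicator (\<Union>i<n. S i) x + indicator (S n) x)"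
          by (simp add: lessThan_Suc Un_commute indicator_disj_union fun_eq_iff)
        have U: "(\<Union>i<n. S i) \<in> sets borel" using S by auto
        have "G (indicator (\<Union>i<Suc n. S i)) = G (indicator (\<Union>i<n. S i)) + G (indicator (S n))"
          unfolding e by (rule bcl_add[OF G bnd_borel_indicator[OF U] bnd_borel_indicator[OF S]])
        then show ?case by (simp only: Suc union(3) add_0)
      qed
      moreover have "(\<lambda>n. G (indicator (\<Union>i<n. S i))) \<longlonglongrightarrow> G (indicator (\<Union>i. S i))"
      proof (rule bcl_lim[OF G, where B = 1])
        show "(\<lambda>n. indicat_real (\<Union>i<n. S i) x) \<longlonglongrightarrow> indicator (\<Union>i. S i) x" for x
          by (rule LIMSEQ_indicator_UN)
      qed (use S in \<open>auto intro!: bnd_borel_indicator simp: indicator_def\<close>)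
      ultimately show ?case by (simp add: LIMSEQ_const_iff)
    qed
  qed
  \<comment> \<open>The upper bound travels through the induction because continuity is available
    only along uniformly bounded sequences.\<close>
  have pos0: "G u = 0" if u: "u \<in> borel_measurable borel" "\<And>x. 0 \<le> u x" "\<exists>B. \<forall>x. u x \<le> B" for u
    using u
  proof (induction rule: borel_measurable_induct_real)
    case (set S)
    then show ?case using sets0 by simp
  next
    case (mult u c)
    show ?case
    proof (cases "c = 0")
      case True then show ?thesis using bcl_0[OF G] by simp
    next
      case False
      then have "c > 0" using mult by simp
      obtain B where "\<forall>x. c * u x \<le> B" using mult.prems by blast
      then have B: "\<forall>x. u x \<le> B / c" using \<open>c > 0\<close> by (simp add: field_simps)
      then have "bnd_borel u" using mult by (intro bnd_borelI[of _ "B / c"]) auto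
      moreover have "G u = 0" using mult B by blast
      ultimately show ?thesis by (simp add: bcl_cmult[OF G])
    qed
  next
    case (add u v)
    obtain B where B: "\<forall>x. v x + u x \<le> B" using add.prems by blast
    have b: "\<forall>x. u x \<le> B" "\<forall>x. v x \<le> B" using B add by (smt (verit))+
    then have "bnd_borel u" "bnd_borel v" using add by (auto intro!: bnd_borelI[of _ B])
    moreover have "G u = 0" "G v = 0" using add b by blast+
    ultimately show ?case by (simp add: bcl_add[OF G])
  next
    case (seq U)
    obtain B where B: "\<forall>x. u x \<le> B" using seq.prems by blast
    note lim = \<open>\<And>x. x \<in> space borel \<Longrightarrow> (\<lambda>i. U i x) \<longlonglongrightarrow> u x\<close>
    have "incseq (\<lambda>i. U i x)" for x
      using \<open>incseq U\<close> by (auto simp: incseq_def le_fun_def)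
    then have le: "U i x \<le> u x" for i x
      using incseq_le[OF _ lim] by simp
    have leB: "\<forall>x. U i x \<le> B" for i using B le order_trans by blast
    have U: "bnd_borel (U n)" for n
      using leB \<open>\<And>i x. 0 \<le> U i x\<close> by (intro bnd_borelI[OF \<open>\<And>i. U i \<in> borel_measurable borel\<close>, of _ B]) auto
    have "(\<lambda>n. G (U n)) \<longlonglongrightarrow> G u"
    proof (rule bcl_lim[OF G U, where B = B])
      show "\<bar>U n x\<bar> \<le> B" for n x
        using leB \<open>\<And>i x. 0 \<le> U i x\<close> by simp
      show "bnd_borel u" using B u(2) by (intro bnd_borelI[OF u(1), of B]) auto
    qed (use lim in auto)
    moreover have "G (U n) = 0" for n using seq leB by blast
    ultimately show ?case by (simp add: LIMSEQ_const_iff)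
  qed
  obtain B where B: "\<And>x. \<bar>h x\<bar> \<le> B" using bnd_borelE[OF h] by metis
  \<comment> \<open>Adding the bound makes the function nonnegative; the constant is removed again
    by linearity.\<close>
  have "G (\<lambda>x. h x + B) = 0"
  proof (rule pos0)
    show "0 \<le> h x + B" for x using B[of x] by linarith
    show "\<exists>C. \<forall>x. h x + B \<le> C" using B by (intro exI[of _ "2 * B"]) (smt (verit))
  qed (use h in measurable)
  moreover have "G (\<lambda>x. B) = 0"
    by (rule pos0) (use B[of 0] in auto)
  ultimately have "G h = 0" using bcl_add[OF G h bnd_borel_const[of B]] by simp
  then show ?thesis unfolding G_def .
qed

section \<open>Integral functionals and the fundamental lemma of the calculus of variations\<close>

lemma bcl_integral:
  assumes "integrable lborel u" shows "bcl (\<lambda>h. LINT x|lborel. u x * h x)"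
proof -
  have int: "integrable lborel (\<lambda>x. u x * h x)" if h: "bnd_borel h" for h
  proof -
    obtain B where "\<And>x. \<bar>h x\<bar> \<le> B" using bnd_borelE[OF h] by metis
    then show ?thesis using h assms
      by (intro Bochner_Integration.integrable_bound[OF integrable_mult_left[OF assms, of B]])
         (auto simp: abs_mult intro!: mult_left_mono AE_I2 dest: bnd_borel_measurable order_trans[OF _ abs_ge_self])
  qed
  show ?thesis
  proof (rule bclI)
    fix h g :: "'a \<Rightarrow> real" and a assume "bnd_borel h" "bnd_borel g"
    moreover have "(\<lambda>x. u x * (h x + a * g x)) = (\<lambda>x. u x * h x + a * (u x * g x))"
      by (simp add: algebra_simps fun_eq_iff)
    ultimately show "(LINT x|lborel. u x * (h x + a * g x)) = (LINT x|lborel. u x * h x) + a * (LINT x|lborel. u x * g x)"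
      using int by simp
  next
    fix h :: "nat \<Rightarrow> 'a \<Rightarrow> real" and k :: "'a \<Rightarrow> real" and B :: real
    assume h: "\<And>n. bnd_borel (h n)" "\<And>n x. \<bar>h n x\<bar> \<le> B" "bnd_borel k" "\<And>x. (\<lambda>n. h n x) \<longlonglongrightarrow> k x"
    show "(\<lambda>n. LINT x|lborel. u x * h n x) \<longlonglongrightarrow> (LINT x|lborel. u x * k x)"
    proof (rule integral_dominated_convergence[where w = "\<lambda>x. \<bar>u x\<bar> * B"])
      show "AE x in lborel. norm (u x * h n x) \<le> \<bar>u x\<bar> * B" for n
        using h(2) by (auto simp: abs_mult intro!: mult_left_mono AE_I2)
    qed (use h assms in \<open>auto intro!: tendsto_intros AE_I2 dest: bnd_borel_measurable\<close>)
  qed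
qed

text \<open>Vanishing on test functions passes to all bounded multipliers by
  \<open>bcl_vanishes\<close>; the sign of the function is such a multiplier and produces its
  absolute value.\<close>

lemma integrable_vanishes_on_box:
  fixes u :: "'a::euclidean_space \<Rightarrow> real"
  assumes u: "integrable lborel (\<lambda>x. u x * indicator (box A B) x)"
    and 0: "\<And>\<psi>. test_function (box A B) \<psi> \<Longrightarrow> (LINT x|lborel. u x * \<psi> x) = 0"
  shows "AE x in lborel. x \<in> box A B \<longrightarrow> u x = 0"
proof -
  define v where "v x = u x * indicator (box A B) x" for x
  have u: "integrable lborel v" using assms(1) unfolding v_def .
  have v[measurable]: "v \<in> borel_measurable borel" using borel_measurable_integrable[OF u] by simp
  have "(\<lambda>x. sgn (v x)) = (\<lambda>x. if v x > 0 then 1 else if v x < 0 then - 1 else 0)"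
    by (auto simp: sgn_if)
  then have sg: "bnd_borel (\<lambda>x. sgn (v x))"
    by (intro bnd_borelI[of _ 1]) (simp_all add: sgn_if)
  have "(LINT x|lborel. v x * (sgn (v x) * indicator (box A B) x)) = 0"
  proof (rule bcl_vanishes[OF bcl_integral[OF u] _ sg])
    fix \<psi> assume \<psi>: "test_function (box A B) \<psi>"
    obtain K where K: "K \<subseteq> box A B" "\<And>x. x \<notin> K \<Longrightarrow> \<psi> x = 0" using test_functionD[OF \<psi>] by metis
    have "(\<lambda>x. v x * \<psi> x) = (\<lambda>x. u x * \<psi> x)"
      using K by (intro ext, case_tac "x \<in> K") (auto simp: v_def)
    then show "(LINT x|lborel. v x * \<psi> x) = 0" using 0[OF \<psi>] by presburger
  qed
  moreover have "(\<lambda>x. v x * (sgn (v x) * indicator (box A B) x)) = (\<lambda>x. \<bar>v x\<bar>)"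
    by (auto simp: v_def indicator_def sgn_if fun_eq_iff)
  ultimately have "(LINT x|lborel. \<bar>v x\<bar>) = 0" by simp
  then have "AE x in lborel. \<bar>v x\<bar> = 0"
    using integral_nonneg_eq_0_iff_AE[of lborel "\<lambda>x. \<bar>v x\<bar>"] u by simp
  then show ?thesis by eventually_elim (auto simp: v_def indicator_def)
qed

section \<open>Indefinite integrals on an interval\<close>

lemma integrable_tensor:
  fixes f :: "'a::euclidean_space \<Rightarrow> real" and g :: "'b::euclidean_space \<Rightarrow> real"
  assumes f: "integrable lborel f" and g: "integrable lborel g"
  shows "integrable (lborel \<Otimes>\<^sub>M lborel) (\<lambda>p. f (fst p) * g (snd p))"
proof (rule lborel_pair.Fubini_integrable)
  have [measurable]: "f \<in> borel_measurable borel" "g \<in> borel_measurable borel"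
    using borel_measurable_integrable[OF f] borel_measurable_integrable[OF g] by simp_all
  show "(\<lambda>p. f (fst p) * g (snd p)) \<in> borel_measurable (lborel \<Otimes>\<^sub>M lborel)" by measurable
  have "integrable lborel (\<lambda>x. \<bar>f x\<bar> * (LINT y|lborel. \<bar>g y\<bar>))" using f by simp
  then show "integrable lborel (\<lambda>x. LINT y|lborel. norm (f (fst (x, y)) * g (snd (x, y))))"
    by (simp add: abs_mult)
  show "AE x in lborel. integrable lborel (\<lambda>y. f (fst (x, y)) * g (snd (x, y)))" using g by simp
qed

text \<open>Starting at minus infinity avoids a base point. For \<open>q\<close> supported in an
  interval the primitive is zero to its left and equals the total integral to its right, so zero
  mean is the same as vanishing at both ends.\<close>

definition prim :: "(real \<Rightarrow> real) \<Rightarrow> real \<Rightarrow> real" where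
  "prim q z = (LINT y|lborel. q y * indicator {..z} y)"

lemma integrable_mult_indicator_real:
  "integrable lborel q \<Longrightarrow> S \<in> sets borel \<Longrightarrow> integrable lborel (\<lambda>x::'a::euclidean_space. (q x::real) * indicator S x)"
  by (metis (no_types, lifting) Bochner_Integration.integrable_cong integrable_mult_indicator mult.commute real_scaleR_def sets_lborel)

lemma prim_bound: "integrable lborel q \<Longrightarrow> \<bar>prim q z\<bar> \<le> (LINT y|lborel. \<bar>q y\<bar>)"
proof -
  assume q: "integrable lborel q"
  have "\<bar>prim q z\<bar> \<le> (LINT y|lborel. \<bar>q y * indicator {..z} y\<bar>)"
    unfolding prim_def by (rule integral_abs_bound)
  also have "\<dots> \<le> (LINT y|lborel. \<bar>q y\<bar>)"
    by (intro integral_mono integrable_abs integrable_mult_indicator_real q) (auto simp: indicator_def)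
  finally show ?thesis .
qed

lemma AE_neq: "AE x in lborel. x \<noteq> (z::real)"
  by (rule AE_lborel_singleton)

lemma prim_isCont: assumes "integrable lborel q" shows "isCont (prim q) z"
  unfolding continuous_at_sequentially o_def
proof (intro allI impI)
  fix s assume s: "s \<longlonglongrightarrow> z"
  have [measurable]: "q \<in> borel_measurable borel" using borel_measurable_integrable[OF assms] by simp
  show "(\<lambda>n. prim q (s n)) \<longlonglongrightarrow> prim q z" unfolding prim_def
  proof (rule integral_dominated_convergence[where w = "\<lambda>y. \<bar>q y\<bar>"])
    \<comment> \<open>At \<open>y = z\<close> the indicators may oscillate along the sequence, but a
      single point is null.\<close>
    show "AE y in lborel. (\<lambda>n. q y * indicator {..s n} y) \<longlonglongrightarrow> q y * indicator {..z} y"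
      using AE_neq[of z]
    proof eventually_elim
      case (elim y)
      have "eventually (\<lambda>n. indicat_real {..s n} y = indicator {..z} y) sequentially"
      proof (cases "y < z")
        case True
        with order_tendstoD(1)[OF s True] show ?thesis by (auto elim!: eventually_mono simp: indicator_def)
      next
        case False
        then have "z < y" using elim by simp
        from order_tendstoD(2)[OF s this] show ?thesis using False elim by (auto elim!: eventually_mono simp: indicator_def)
      qed
      then show ?case by (intro tendsto_intros tendsto_eventually)
    qed
    show "AE y in lborel. norm (q y * indicator {..s n} y) \<le> \<bar>q y\<bar>" for n
      by (auto simp: indicator_def)
  qed (use assms in auto)
qed

lemma prim_continuous: "integrable lborel q \<Longrightarrow> continuous_on S (prim q)"
  by (intro continuous_at_imp_continuous_on ballI prim_isCont)

lemma prim_borel [measurable_dest]: "integrable lborel q \<Longrightarrow> prim q \<in> borel_measurable borel"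
  by (intro borel_measurable_continuous_onI prim_continuous)

lemma bnd_borel_prim: "integrable lborel q \<Longrightarrow> bnd_borel (prim q)"
  by (intro bnd_borelI[OF prim_borel prim_bound])

lemma prim_left:
  assumes "\<And>y. y \<notin> {a<..<b} \<Longrightarrow> q y = 0" "z \<le> a" shows "prim q z = 0"
proof -
  have "q y * indicator {..z} y = 0" for y using assms by (cases "y \<le> z") auto
  then have "(\<lambda>y. q y * indicator {..z} y) = (\<lambda>y. 0)" by (intro ext)
  then show ?thesis unfolding prim_def by simp
qed

lemma prim_right:
  assumes "\<And>y. y \<notin> {a<..<b} \<Longrightarrow> q y = 0" "b \<le> z" shows "prim q z = (LINT y|lborel. q y)"
proof -
  have "q y * indicator {..z} y = q y" for y using assms by (cases "y \<le> z") auto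
  then have "(\<lambda>y. q y * indicator {..z} y) = q" by (intro ext)
  then show ?thesis unfolding prim_def by simp
qed

lemma prim_cong_AE:
  assumes "AE y in lborel. q1 y = q2 y" "q1 \<in> borel_measurable borel" "q2 \<in> borel_measurable borel"
  shows "prim q1 z = prim q2 z"
  unfolding prim_def by (rule integral_cong_AE) (use assms in \<open>auto elim: eventually_mono\<close>)

lemma prim_add: "integrable lborel q1 \<Longrightarrow> integrable lborel q2 \<Longrightarrow>
    prim (\<lambda>y. q1 y + c * q2 y) z = prim q1 z + c * prim q2 z"
proof -
  assume a: "integrable lborel q1" "integrable lborel q2"
  have "(\<lambda>y. (q1 y + c * q2 y) * indicator {..z} y) = (\<lambda>y. q1 y * indicator {..z} y + c * (q2 y * indicator {..z} y))"
    by (simp add: algebra_simps)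
  then show ?thesis unfolding prim_def
    using integrable_mult_indicator_real[OF a(1), of "{..z}"] integrable_mult_indicator_real[OF a(2), of "{..z}"] by simp
qed

lemma integrable_mult_bnd_borel:
  fixes q :: "'a::euclidean_space \<Rightarrow> real"
  assumes q: "integrable lborel q" and h: "bnd_borel h" shows "integrable lborel (\<lambda>x. q x * h x)"
proof -
  obtain B where B: "\<And>x. \<bar>h x\<bar> \<le> B" using bnd_borelE[OF h] by metis
  have "\<bar>q x * h x\<bar> \<le> \<bar>q x * B\<bar>" for x
    using B[of x] by (auto simp: abs_mult intro!: mult_left_mono)
  then show ?thesis using h q
    by (intro Bochner_Integration.integrable_bound[OF integrable_mult_left[OF q, of B]])
       (auto dest: bnd_borel_measurable)
qed

text \<open>The product is an integral of \<open>q1 x * q2 y\<close> over the square below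
  \<open>z\<close>. Cutting the square along its diagonal and integrating out the smaller variable
  in each triangle gives the two terms of the product rule.\<close>

lemma prim_mult:
  assumes q1: "integrable lborel q1" and q2: "integrable lborel q2"
  shows "prim q1 z * prim q2 z = prim (\<lambda>y. q1 y * prim q2 y + prim q1 y * q2 y) z"
proof -
  define f where "f = (\<lambda>x. q1 x * indicator {..z} x)"
  define g where "g = (\<lambda>x. q2 x * indicator {..z} x)"
  have f: "integrable lborel f" and g: "integrable lborel g"
    unfolding f_def g_def by (intro integrable_mult_indicator_real q1 q2; simp)+
  have [measurable]: "f \<in> borel_measurable borel" "g \<in> borel_measurable borel"
    "q1 \<in> borel_measurable borel" "q2 \<in> borel_measurable borel"
    using f g q1 q2 borel_measurable_integrable by auto
  let ?h = "\<lambda>p::real \<times> real. f (fst p) * g (snd p)"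
  let ?L = "\<lambda>p::real \<times> real. ?h p * indicator {p. snd p \<le> fst p} p"
  let ?U = "\<lambda>p::real \<times> real. ?h p * indicator {p. fst p < snd p} p"
  have h: "integrable (lborel \<Otimes>\<^sub>M lborel) ?h" by (rule integrable_tensor[OF f g])
  have m: "{p::real \<times> real. snd p \<le> fst p} \<in> sets (lborel \<Otimes>\<^sub>M lborel)"
    "{p::real \<times> real. fst p < snd p} \<in> sets (lborel \<Otimes>\<^sub>M lborel)"
    unfolding lborel_prod sets_lborel
    by (intro borel_closed borel_open closed_Collect_le open_Collect_less continuous_intros)+
  have LU: "integrable (lborel \<Otimes>\<^sub>M lborel) ?L" "integrable (lborel \<Otimes>\<^sub>M lborel) ?U"
    using integrable_mult_indicator[OF m(1) h] integrable_mult_indicator[OF m(2) h] by (simp_all add: mult.commute)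
  have P: "integrable lborel (\<lambda>x. q1 x * prim q2 x)" "integrable lborel (\<lambda>x. prim q1 x * q2 x)"
    using integrable_mult_bnd_borel[OF q1 bnd_borel_prim[OF q2]] integrable_mult_bnd_borel[OF q2 bnd_borel_prim[OF q1]]
    by (simp_all add: mult.commute)
  have "prim q1 z * prim q2 z = (LINT x|lborel. LINT y|lborel. f x * g y)"
    unfolding prim_def f_def g_def by simp
  also have "\<dots> = (LINT p|(lborel \<Otimes>\<^sub>M lborel). ?h p)"
    using lborel_pair.integral_fst'[OF h] by simp
  also have "\<dots> = (LINT p|(lborel \<Otimes>\<^sub>M lborel). ?L p + ?U p)"
    by (rule Bochner_Integration.integral_cong) (auto simp: indicator_def)
  also have "(LINT p|(lborel \<Otimes>\<^sub>M lborel). ?L p + ?U p) = (LINT p|(lborel \<Otimes>\<^sub>M lborel). ?L p) + (LINT p|(lborel \<Otimes>\<^sub>M lborel). ?U p)"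
    by (rule Bochner_Integration.integral_add[OF LU])
  also have "(LINT p|(lborel \<Otimes>\<^sub>M lborel). ?L p) = (LINT x|lborel. q1 x * prim q2 x * indicator {..z} x)"
  proof -
    have "(LINT p|(lborel \<Otimes>\<^sub>M lborel). ?L p) = (LINT x|lborel. LINT y|lborel. ?L (x, y))"
      using lborel_pair.integral_fst'[OF LU(1)] by simp
    moreover have "(LINT y|lborel. ?L (x, y)) = q1 x * prim q2 x * indicator {..z} x" for x
    proof -
      have "(\<lambda>y. ?L (x, y)) = (\<lambda>y. (q1 x * indicator {..z} x) * (q2 y * indicator {..x} y))"
        by (auto simp: f_def g_def indicator_def fun_eq_iff)
      then show ?thesis unfolding prim_def by simp
    qed
    ultimately show ?thesis by simp
  qed
  also have "(LINT p|(lborel \<Otimes>\<^sub>M lborel). ?U p) = (LINT y|lborel. prim q1 y * q2 y * indicator {..z} y)"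
  proof -
    have "(LINT p|(lborel \<Otimes>\<^sub>M lborel). ?U p) = (LINT y|lborel. LINT x|lborel. ?U (x, y))"
      using lborel_pair.integral_snd[of "\<lambda>x y. ?U (x, y)"] LU(2) by (simp add: case_prod_beta')
    moreover have "(LINT x|lborel. ?U (x, y)) = prim q1 y * q2 y * indicator {..z} y" for y
    proof -
      have "(\<lambda>x. ?U (x, y)) = (\<lambda>x. f x * g y * indicator {..<y} x)"
        by (auto simp: indicator_def fun_eq_iff)
      then have "(LINT x|lborel. ?U (x, y)) = (LINT x|lborel. f x * g y * indicator {..<y} x)"
        by presburger
      \<comment> \<open>The two triangles have to be disjoint, so this one omits the diagonal;
        closing \<open>{..<y}\<close> to \<open>{..y}\<close> adds one point. For \<open>y\<close>
        below \<open>z\<close> the cut-off of \<open>x\<close> at \<open>z\<close> is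
        automatic.\<close>
      also have "\<dots> = (LINT x|lborel. (q2 y * indicator {..z} y) * (q1 x * indicator {..y} x))"
      proof (rule integral_cong_AE)
        show "AE x in lborel. f x * g y * indicator {..<y} x = (q2 y * indicator {..z} y) * (q1 x * indicator {..y} x)"
          using AE_neq[of y] by eventually_elim (auto simp: f_def g_def indicator_def)
      qed measurable
      finally show ?thesis unfolding prim_def by simp
    qed
    ultimately show ?thesis by simp
  qed
  also have "(LINT x|lborel. q1 x * prim q2 x * indicator {..z} x) + (LINT y|lborel. prim q1 y * q2 y * indicator {..z} y)
      = prim (\<lambda>y. q1 y * prim q2 y + prim q1 y * q2 y) z"
    using prim_add[OF P, of 1 z] by (simp add: prim_def)
  finally show ?thesis .
qed

text \<open>One factor vanishing at both ends is enough for the product to do so. The second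
  conclusion is integration by parts without boundary terms; the constant \<open>C\<close> is kept
  so that the other factor may have any end values.\<close>

lemma prim_product_zero_ends:
  assumes q1: "integrable lborel q1" and q2: "integrable lborel q2"
    and s: "\<And>y. y \<notin> {a<..<b} \<Longrightarrow> q1 y = 0" "\<And>y. y \<notin> {a<..<b} \<Longrightarrow> q2 y = 0"
    and 0: "(LINT y|lborel. q2 y) = 0"
  shows "(C + prim q1 z) * prim q2 z = prim (\<lambda>y. q1 y * prim q2 y + (C + prim q1 y) * q2 y) z"
    and "(LINT y|lborel. q1 y * prim q2 y + (C + prim q1 y) * q2 y) = 0"
    and "integrable lborel (\<lambda>y. q1 y * prim q2 y + (C + prim q1 y) * q2 y)"
proof -
  let ?q = "\<lambda>y. q1 y * prim q2 y + (C + prim q1 y) * q2 y"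
  have P: "integrable lborel (\<lambda>x. q1 x * prim q2 x + prim q1 x * q2 x)"
    using integrable_mult_bnd_borel[OF q1 bnd_borel_prim[OF q2]] integrable_mult_bnd_borel[OF q2 bnd_borel_prim[OF q1]]
    by (simp add: mult.commute)
  have e: "?q = (\<lambda>y. (q1 y * prim q2 y + prim q1 y * q2 y) + C * q2 y)" by (auto simp: algebra_simps)
  show i: "integrable lborel ?q" unfolding e using P q2 by simp
  have eq: "(C + prim q1 z) * prim q2 z = prim ?q z" for z
    unfolding e prim_add[OF P q2] using prim_mult[OF q1 q2, of z] by (simp add: algebra_simps)
  show "(C + prim q1 z) * prim q2 z = prim ?q z" by (rule eq)
  have "(LINT y|lborel. ?q y) = prim ?q b"
    by (rule prim_right[symmetric, of a b]) (use s in auto)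
  also have "\<dots> = 0" using eq[of b] prim_right[of a b q2 b] s 0 by simp
  finally show "(LINT y|lborel. ?q y) = 0" .
qed

text \<open>Zero mean is what keeps the support compact: beyond the support the primitive equals
  either zero or the total integral.\<close>

lemma prim_test_function:
  assumes r: "test_function {a<..<b} r" and 0: "(LINT y|lborel. r y) = 0"
  shows "test_function {a<..<b} (prim r)" "deriv (prim r) = r" "integrable lborel r"
proof -
  obtain K where K: "compact K" "K \<subseteq> {a<..<b}" "\<And>x. x \<notin> K \<Longrightarrow> r x = 0" using test_functionD[OF r] by metis
  have c: "continuous_on S r" for S using test_function_continuous[OF r] continuous_on_subset by blast
  have supp: "r y = 0" if "y \<notin> {a<..<b}" for y using K that by blast
  have ri: "integrable lborel (\<lambda>x. r x * indicator {u..v} x)" for u v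
    using borel_integrable_atLeastAtMost'[OF c, of u v] unfolding set_integrable_def by (simp add: mult.commute)
  have "r x * indicator {a..b} x = r x" for x using supp[of x] by (cases "x \<in> {a..b}") auto
  then have rI: "(\<lambda>x. r x * indicator {a..b} x) = r" by (intro ext)
  show int: "integrable lborel r" using ri[of a b] unfolding rI .
  have d: "(prim r has_real_derivative r z) (at z)" for z
  proof -
    \<comment> \<open>A starting point strictly to the left of both the support and
      \<open>z\<close>, so that the primitive is an integral over a compact interval and the
      fundamental theorem applies at the interior point \<open>z\<close>.\<close>
    define A where "A = min a z - 1"
    have "prim r x = integral {A..x} r" for x
    proof -
      have "prim r x = (LINT y|lborel. r y * indicator {A..x} y)"
      proof -
        have "r y * indicator {..x} y = r y * indicator {A..x} y" for y
          using supp[of y] by (cases "y \<in> {a<..<b}") (auto simp: A_def indicator_def)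
        then show ?thesis unfolding prim_def by presburger
      qed
      also have "\<dots> = (LBINT y:{A..x}. r y)" by (simp add: set_lebesgue_integral_def mult.commute)
      also have "\<dots> = integral {A..x} r"
        using ri[of A x] by (intro set_borel_integral_eq_integral) (simp add: set_integrable_def mult.commute)
      finally show ?thesis .
    qed
    then have e: "prim r = (\<lambda>x. integral {A..x} r)" by auto
    have "((\<lambda>x. integral {A..x} r) has_real_derivative r z) (at z within {A..z+1})"
      by (rule integral_has_real_derivative[OF c]) (auto simp: A_def)
    then show ?thesis unfolding e
      by (simp add: at_within_Icc_at A_def)
  qed
  show "deriv (prim r) = r" using DERIV_imp_deriv[OF d] by blast
  have dd: "dirderiv b (prim r) = (\<lambda>x. b * r x)" for b
    by (rule ext, rule dirderiv_eqI[where f' = "\<lambda>v. v * r _"])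
       (use d in \<open>simp add: has_field_derivative_def mult.commute[of _ "r _"] mult_commute_abs\<close>)
  have diff: "prim r differentiable (at x)" for x using d real_differentiable_def by blast
  have C: "C_k k (prim r)" for k
  proof (cases k)
    case 0 then show ?thesis using prim_continuous[OF int] by simp
  next
    case (Suc l)
    then show ?thesis using diff test_function_C_k[OF r] by (simp add: dd)
  qed
  show "test_function {a<..<b} (prim r)"
  proof (cases "K = {}")
    case True
    then have "r = (\<lambda>_. 0)" using K by auto
    then have "prim r z = 0" for z by (simp add: prim_def)
    then show ?thesis by (intro test_functionI[OF C, of "{}"]) auto
  next
    case False
    \<comment> \<open>The new support is the convex hull of \<open>K\<close>, since the primitive
      need not vanish in gaps of \<open>K\<close>.\<close>
    have KI: "Inf K \<in> K" "Sup K \<in> K" "\<And>x. x \<in> K \<Longrightarrow> Inf K \<le> x \<and> x \<le> Sup K"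
      using closed_contains_Inf[OF False] closed_contains_Sup[OF False] K(1)
        compact_imp_bounded compact_imp_closed bounded_imp_bdd_below bounded_imp_bdd_above cInf_lower cSup_upper by metis+
    show ?thesis
    proof (rule test_functionI[OF C])
      show "compact {Inf K..Sup K}" by simp
      show "{Inf K..Sup K} \<subseteq> {a<..<b}" using KI K(2) by (auto simp: subset_iff)
      fix x assume nz: "prim r x \<noteq> 0"
      show "x \<in> {Inf K..Sup K}"
      proof (rule ccontr)
        assume x: "x \<notin> {Inf K..Sup K}"
        have "(\<lambda>y. r y * indicator {..x} y) = (\<lambda>y. 0) \<or> (\<lambda>y. r y * indicator {..x} y) = r"
        proof (cases "x < Inf K")
          case True
          have "r y * indicator {..x} y = 0" for y
            using True KI(3)[of y] K(3)[of y] by (cases "y \<in> K") auto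
          then have "(\<lambda>y. r y * indicator {..x} y) = (\<lambda>y. 0)" by (intro ext)
          then show ?thesis ..
        next
          case False
          then have "x > Sup K" using x by simp
          then have "r y * indicator {..x} y = r y" for y
            using KI(3)[of y] K(3)[of y] by (cases "y \<in> K") auto
          then have "(\<lambda>y. r y * indicator {..x} y) = r" by (intro ext)
          then show ?thesis ..
        qed
        then have "prim r x = 0" unfolding prim_def using 0 by auto
        then show False using nz by simp
      qed
    qed
  qed
qed

section \<open>Weak equations in one variable, tested with nonsmooth profiles\<close>

lemma integrable_Ioo: "integrable lborel (indicat_real {a<..<b::real})"
  by (cases "a \<le> b") auto

lemma integrable_bnd_borel_Ioo:
  "bnd_borel q \<Longrightarrow> integrable lborel (\<lambda>y. q y * indicator {a<..<b::real} y)"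
  using integrable_mult_bnd_borel[OF integrable_Ioo] by (simp add: mult.commute)

text \<open>If every test function had zero integral, \<open>bcl_vanishes\<close> would give the
  interval length zero. Any test function with nonzero integral can then be normalised.\<close>

lemma unit_mass_test_function:
  fixes a b :: real
  assumes "a < b" obtains \<kappa> where "test_function {a<..<b} \<kappa>" "(LINT y|lborel. \<kappa> y) = 1"
proof -
  have ii: "integrable lborel (indicat_real {a<..<b})" by (rule integrable_Ioo)
  have "\<exists>\<psi>. test_function {a<..<b} \<psi> \<and> (LINT y|lborel. \<psi> y) \<noteq> 0"
  proof (rule ccontr)
    assume n: "\<nexists>\<psi>. test_function {a<..<b} \<psi> \<and> (LINT y|lborel. \<psi> y) \<noteq> 0"
    have z: "(LINT y|lborel. indicator {a<..<b} y * \<psi> y) = 0" if t: "test_function {a<..<b} \<psi>" for \<psi>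
    proof -
      obtain K where K: "K \<subseteq> {a<..<b}" "\<And>x. x \<notin> K \<Longrightarrow> \<psi> x = 0" using test_functionD[OF t] by metis
      have "(\<lambda>y. indicator {a<..<b} y * \<psi> y) = \<psi>" using K by (fastforce simp: indicator_def)
      then show ?thesis using n t by simp
    qed
    have "(LINT y|lborel. indicator {a<..<b} y * (1 * indicator (box a b) y)) = (0::real)"
      by (rule bcl_vanishes[OF bcl_integral[OF ii]]) (use z in \<open>simp_all add: box_real\<close>)
    then have "(LINT y|lborel. indicat_real {a<..<b} y) = 0" by (simp add: box_real flip: indicator_inter_arith)
    then show False using assms by simp
  qed
  then obtain \<psi> where \<psi>: "test_function {a<..<b} \<psi>" "(LINT y|lborel. \<psi> y) \<noteq> 0" by blast
  show ?thesis
    by (rule that[of "\<lambda>y. (1 / (LINT y|lborel. \<psi> y)) * \<psi> y"])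
       (use \<psi> test_function_cmult[OF \<psi>(1), of "1 / (LINT y|lborel. \<psi> y)"] in auto)
qed

lemma bcl_prim:
  assumes "a < b" "bcl F" shows "bcl (\<lambda>q. F (prim (\<lambda>y. q y * indicator {a<..<b} y)))"
proof (rule bclI)
  fix h g :: "real \<Rightarrow> real" and c :: real
    assume hg: "bnd_borel h" "bnd_borel g"
    have "prim (\<lambda>y. (h y + c * g y) * indicator {a<..<b} y)
      = (\<lambda>z. prim (\<lambda>y. h y * indicator {a<..<b} y) z + c * prim (\<lambda>y. g y * indicator {a<..<b} y) z)"
      using prim_add[OF integrable_bnd_borel_Ioo[OF hg(1), of a b] integrable_bnd_borel_Ioo[OF hg(2), of a b], of c]
      by (intro ext) (simp add: algebra_simps)
    then show "F (prim (\<lambda>y. (h y + c * g y) * indicator {a<..<b} y))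
      = F (prim (\<lambda>y. h y * indicator {a<..<b} y)) + c * F (prim (\<lambda>y. g y * indicator {a<..<b} y))"
      using bcl_lin[OF assms(2) bnd_borel_prim[OF integrable_bnd_borel_Ioo[OF hg(1), of a b]] bnd_borel_prim[OF integrable_bnd_borel_Ioo[OF hg(2), of a b]], of c] by simp
next
  fix h :: "nat \<Rightarrow> real \<Rightarrow> real" and k B
  assume h: "\<And>n. bnd_borel (h n)" "\<And>n x. \<bar>h n x\<bar> \<le> B" "bnd_borel k" "\<And>x. (\<lambda>n. h n x) \<longlonglongrightarrow> k x"
  have [measurable]: "h n \<in> borel_measurable borel" "k \<in> borel_measurable borel" for n
    using h bnd_borel_measurable by auto
  have B: "B \<ge> 0" using h(2)[of 0 0] by linarith
  show "(\<lambda>n. F (prim (\<lambda>y. h n y * indicator {a<..<b} y))) \<longlonglongrightarrow> F (prim (\<lambda>y. k y * indicator {a<..<b} y))"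
  proof (rule bcl_lim[OF assms(2), where B = "B * (b - a)"])
    show "\<bar>prim (\<lambda>y. h n y * indicator {a<..<b} y) x\<bar> \<le> B * (b - a)" for n x
    proof -
      have "(LINT y|lborel. \<bar>h n y * indicator {a<..<b} y\<bar>) \<le> (LINT y|lborel. B * indicator {a<..<b} y)"
        by (intro integral_mono integrable_abs integrable_bnd_borel_Ioo h) (use h(2) in \<open>auto simp: indicator_def\<close>)
      also have "\<dots> = B * (b - a)" using assms by simp
      finally show ?thesis using prim_bound[OF integrable_bnd_borel_Ioo[OF h(1)]] order_trans by blast
    qed
    show "(\<lambda>n. prim (\<lambda>y. h n y * indicator {a<..<b} y) x) \<longlonglongrightarrow> prim (\<lambda>y. k y * indicator {a<..<b} y) x" for x
      unfolding prim_def
    proof (rule integral_dominated_convergence[where w = "\<lambda>y. B * indicator {a<..<b} y"])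
      show "AE y in lborel. norm (h n y * indicator {a<..<b} y * indicator {..x} y) \<le> B * indicator {a<..<b} y" for n
        using h(2)[of n] B by (auto simp: indicator_def)
    qed (use h integrable_Ioo[of a b] in \<open>auto intro!: tendsto_intros AE_I2\<close>)
  qed (intro bnd_borel_prim integrable_bnd_borel_Ioo h)+
qed

text \<open>The equation involves both \<open>e\<close> and its derivative, so it is regarded as a
  functional of the derivative \<open>q\<close> alone, with \<open>e = prim q\<close>. Only test
  functions of zero mean are derivatives of test functions; the others are corrected by a multiple
  of a fixed unit mass \<open>\<kappa>\<close>.\<close>

theorem weak_equation_extend:
  assumes ab: "a < b" and F1: "bcl F1" and F2: "bcl F2"
    and loc: "\<And>h. bnd_borel h \<Longrightarrow> F2 (\<lambda>x. h x * indicator {a<..<b} x) = F2 h"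
    and eq: "\<And>e. test_function {a<..<b} e \<Longrightarrow> F1 e + F2 (deriv e) = 0"
    and q: "bnd_borel q" "\<And>y. y \<notin> {a<..<b} \<Longrightarrow> q y = 0" "(LINT y|lborel. q y) = 0"
  shows "F1 (prim q) + F2 q = 0"
proof -
  let ?I = "indicat_real {a<..<b}"
  obtain \<kappa> where \<kappa>: "test_function {a<..<b} \<kappa>" "(LINT y|lborel. \<kappa> y) = 1"
    using unit_mass_test_function[OF ab] by metis
  have supp: "(\<lambda>y. e y * ?I y) = e" if t: "test_function {a<..<b} e" for e
  proof -
    obtain K where K: "K \<subseteq> {a<..<b}" "\<And>x. x \<notin> K \<Longrightarrow> e x = 0" using test_functionD[OF t] by metis
    then show ?thesis by (fastforce simp: indicator_def)
  qed
  have int: "integrable lborel (\<lambda>y. q y * ?I y)" if "bnd_borel q" for q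
    using integrable_bnd_borel_Ioo[OF that] .
  define m where "m q = (LINT y|lborel. q y * ?I y)" for q
  have m: "bcl m" unfolding m_def using bcl_integral[OF integrable_Ioo, of a b] by (simp add: mult.commute)
  define P where "P q = prim (\<lambda>y. q y * ?I y)" for q
  \<comment> \<open>By linearity this is the equation evaluated at
    \<open>q - m q * \<kappa>\<close>, which has zero mean. It therefore vanishes on all test
    functions, and the correction disappears when \<open>q\<close> already has zero mean.\<close>
  define M where "M q = (F1 (P q) + 1 * F2 q) + (- (F1 (P \<kappa>) + F2 \<kappa>)) * m q" for q
  have M: "bcl M" unfolding M_def
    by (intro bcl_plus m F2) (unfold P_def, rule bcl_prim[OF ab F1])
  have "M (\<lambda>x. q x * indicator (box a b) x) = 0"
  proof (rule bcl_vanishes[OF M _ q(1)])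
    fix \<psi> assume "test_function (box a b) \<psi>"
    then have \<psi>: "test_function {a<..<b} \<psi>" by (simp add: box_real)
    define r where "r = (\<lambda>y. \<psi> y - m \<psi> * \<kappa> y)"
    have r: "test_function {a<..<b} r" unfolding r_def by (intro test_function_diff test_function_cmult \<psi> \<kappa>)
    have i: "integrable lborel \<psi>" "integrable lborel \<kappa>"
      using int[OF bnd_borel_test_function[OF \<psi>]] int[OF bnd_borel_test_function[OF \<kappa>(1)]] supp[OF \<psi>] supp[OF \<kappa>(1)] by auto
    have "(LINT y|lborel. r y) = (LINT y|lborel. \<psi> y) - m \<psi>"
      unfolding r_def using i \<kappa>(2) by simp
    also have "\<dots> = 0" unfolding m_def supp[OF \<psi>] by simp
    finally have r0: "(LINT y|lborel. r y) = 0" .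
    note t = prim_test_function[OF r r0]
    have "prim r = (\<lambda>z. prim \<psi> z + (- m \<psi>) * prim \<kappa> z)"
      using prim_add[OF i, of "- m \<psi>"] by (auto simp: r_def)
    then have "F1 (prim r) = F1 (prim \<psi>) + (- m \<psi>) * F1 (prim \<kappa>)"
      using bcl_lin[OF F1 bnd_borel_prim[OF i(1)] bnd_borel_prim[OF i(2)], of "- m \<psi>"] by simp
    moreover have "F2 r = F2 \<psi> + (- m \<psi>) * F2 \<kappa>"
      using bcl_lin[OF F2 bnd_borel_test_function[OF \<psi>] bnd_borel_test_function[OF \<kappa>(1)], of "- m \<psi>"]
      by (simp add: r_def)
    moreover have "F1 (prim r) + F2 r = 0" using eq[OF t(1)] t(2) by simp
    ultimately show "M \<psi> = 0" unfolding M_def P_def supp[OF \<psi>] supp[OF \<kappa>(1)] by (simp add: algebra_simps)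
  qed
  moreover have "(\<lambda>x. q x * indicator (box a b) x) = q" using q(2) by (auto simp: box_real indicator_def fun_eq_iff)
  moreover have "P q = prim q" "m q = 0"
  proof -
    have "(\<lambda>y. q y * ?I y) = q" using q(2) by (auto simp: indicator_def fun_eq_iff)
    then show "P q = prim q" "m q = 0" unfolding P_def m_def using q(3) by simp_all
  qed
  ultimately show ?thesis unfolding M_def by simp
qed

text \<open>The lemma of du Bois-Reymond. The difference of \<open>u\<close> and
  \<open>prim v\<close> is orthogonal to every bounded function of zero mean, hence is constant;
  weak derivatives thereby become genuine primitives.\<close>

theorem weak_derivative_prim:
  assumes ab: "a < b" and u: "integrable lborel u" and v: "integrable lborel v"
    and s: "\<And>y. y \<notin> {a<..<b} \<Longrightarrow> v y = 0" "\<And>y. y \<notin> {a<..<b} \<Longrightarrow> u y = 0"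
    and eq: "\<And>e. test_function {a<..<b} e \<Longrightarrow> (LINT y|lborel. u y * deriv e y) = - (LINT y|lborel. v y * e y)"
  obtains C where "AE z in lborel. z \<in> {a<..<b} \<longrightarrow> u z = C + prim v z"
proof -
  let ?I = "indicat_real {a<..<b}"
  have sI: "(\<lambda>x. u x * (h x * ?I x)) = (\<lambda>x. u x * h x)" for h
    using s(2) by (auto simp: indicator_def fun_eq_iff)
  have bI: "bnd_borel ?I" by (rule bnd_borel_indicator) simp
  have bp: "bnd_borel (prim v)" using bnd_borel_prim[OF v] .
  define D where "D y = (u y - prim v y) * ?I y" for y
  have DI: "D y = D y * ?I y" for y by (simp add: D_def indicator_def)
  have iI: "integrable lborel ?I" by (rule integrable_Ioo)
  have "integrable lborel (\<lambda>y. prim v y * ?I y)"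
    using integrable_mult_bnd_borel[OF iI bp] by (simp add: mult.commute)
  then have D: "integrable lborel D" unfolding D_def
    using integrable_mult_bnd_borel[OF u bI] by (simp add: algebra_simps)
  have zero: "(LINT y|lborel. D y * q y) = 0"
    if q: "bnd_borel q" "\<And>y. y \<notin> {a<..<b} \<Longrightarrow> q y = 0" "(LINT y|lborel. q y) = 0" for q
  proof -
    have qI: "(\<lambda>y. q y * ?I y) = q" using q(2) by (auto simp: indicator_def fun_eq_iff)
    have iq: "integrable lborel q" using integrable_mult_bnd_borel[OF iI q(1)] qI by (simp add: mult.commute)
    \<comment> \<open>The weak equation with the nonsmooth test profile \<open>prim q\<close>;
      subtracting the integration by parts in \<open>2\<close> removes the common term and leaves
      the difference \<open>D\<close> against \<open>q\<close>.\<close>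
    have 1: "(LINT y|lborel. v y * prim q y) + (LINT y|lborel. u y * q y) = 0"
      by (rule weak_equation_extend[OF ab bcl_integral[OF v] bcl_integral[OF u] _ _ q]) (use eq sI in simp_all)
    have 2: "(LINT y|lborel. v y * prim q y + (0 + prim v y) * q y) = 0"
      by (rule prim_product_zero_ends(2)[OF v iq s(1) q(2,3)])
    have i: "integrable lborel (\<lambda>y. v y * prim q y)" "integrable lborel (\<lambda>y. prim v y * q y)" "integrable lborel (\<lambda>y. u y * q y)"
      using integrable_mult_bnd_borel[OF v bnd_borel_prim[OF iq]] integrable_mult_bnd_borel[OF iq bp]
        integrable_mult_bnd_borel[OF u q(1)] by (simp_all add: mult.commute)
    have "D y * q y = u y * q y - prim v y * q y" for y
      using q(2)[of y] by (cases "y \<in> {a<..<b}") (auto simp: D_def algebra_simps)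
    then show ?thesis using 1 2 i by simp
  qed
  \<comment> \<open>The constant must be the mean value of \<open>D\<close>; accordingly
    \<open>k\<close> below is the mean value of the test function, and subtracting it makes the test
    profile admissible for \<open>zero\<close>.\<close>
  define C where "C = (LINT y|lborel. D y) / (b - a)"
  have "AE x in lborel. x \<in> box a b \<longrightarrow> D x - C = 0"
  proof (rule integrable_vanishes_on_box)
    have e: "(\<lambda>x. (D x - C) * indicator (box a b) x) = (\<lambda>x. D x - C * ?I x)"
      using DI by (auto simp: box_real algebra_simps)
    show "integrable lborel (\<lambda>x. (D x - C) * indicator (box a b) x)" unfolding e using D integrable_Ioo[of a b] by simp
    fix \<psi> assume "test_function (box a b) \<psi>"
    then have \<psi>: "test_function {a<..<b} \<psi>" by (simp add: box_real)
    obtain K where K: "K \<subseteq> {a<..<b}" "\<And>x. x \<notin> K \<Longrightarrow> \<psi> x = 0" using test_functionD[OF \<psi>] by metis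
    have \<psi>I: "(\<lambda>y. ?I y * \<psi> y) = \<psi>" using K by (fastforce simp: indicator_def)
    note b\<psi> = bnd_borel_test_function[OF \<psi>]
    have i\<psi>: "integrable lborel \<psi>" using integrable_mult_bnd_borel[OF iI b\<psi>] unfolding \<psi>I .
    define k where "k = (LINT y|lborel. \<psi> y) / (b - a)"
    have "(LINT y|lborel. D y * (\<psi> y - k * ?I y)) = 0"
    proof (rule zero)
      show "bnd_borel (\<lambda>y. \<psi> y - k * ?I y)" by (intro bnd_borel_diff bnd_borel_cmult b\<psi> bI)
      show "(LINT y|lborel. \<psi> y - k * ?I y) = 0" using i\<psi> ab by (simp add: k_def)
      show "\<psi> y - k * ?I y = 0" if "y \<notin> {a<..<b}" for y using that K(1) K(2)[of y] by (auto simp: indicator_def subset_iff)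
    qed
    moreover have "(\<lambda>y. D y * (\<psi> y - k * ?I y)) = (\<lambda>y. D y * \<psi> y - k * D y)"
      using DI by (auto simp: algebra_simps fun_eq_iff)
    ultimately have "(LINT y|lborel. D y * \<psi> y) - k * (LINT y|lborel. D y) = 0"
      using integrable_mult_bnd_borel[OF D b\<psi>] D by simp
    then show "(LINT x|lborel. (D x - C) * \<psi> x) = 0"
      using integrable_mult_bnd_borel[OF D b\<psi>] i\<psi> by (simp add: left_diff_distrib k_def C_def)
  qed
  then have "AE z in lborel. z \<in> {a<..<b} \<longrightarrow> u z = C + prim v z"
    by eventually_elim (auto simp: box_real D_def)
  then show ?thesis by (rule that)
qed

text \<open>Nonempty open sets are not null, so the function vanishes on the open interval;
  continuity carries this to the end points, where the boundary values are read off later.\<close>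

lemma continuous_AE_zero:
  fixes g :: "real \<Rightarrow> real"
  assumes ab: "a < b" and g: "continuous_on {a..b} g" and 0: "AE z in lborel. z \<in> {a<..<b} \<longrightarrow> g z = 0"
    and z: "z \<in> {a..b}"
  shows "g z = 0"
proof (rule continuous_constant_on_closure[where f = g and a = 0 and x = z and S = "{a<..<b}"])
  show "continuous_on (closure {a<..<b}) g" "z \<in> closure {a<..<b}" using assms by auto
  fix x assume x: "x \<in> {a<..<b}"
  show "g x = 0"
  proof (rule ccontr)
    assume nz: "g x \<noteq> 0"
    let ?S = "{a<..<b} \<inter> g -` (- {0})"
    have "open ?S" by (rule continuous_open_preimage) (auto intro: continuous_on_subset[OF g])
    moreover have "AE z in lborel. z \<notin> ?S" using 0 by eventually_elim auto
    moreover have "?S \<in> sets lborel" using \<open>open ?S\<close> by simp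
    ultimately have "?S \<in> null_sets lborel" using AE_iff_null_sets by blast
    then have "negligible ?S" by (metis negligible_iff_null_sets null_sets_completionI)
    moreover have "x \<in> ?S" using x nz by simp
    ultimately show False using open_not_negligible[OF \<open>open ?S\<close>] by blast
  qed
qed

section \<open>Square integrable functions and curves\<close>

lemma lborel_Fubini:
  fixes h :: "'a::euclidean_space \<times> 'b::euclidean_space \<Rightarrow> real"
  assumes "integrable lborel h"
  shows "(LINT p|lborel. h p) = (LINT x|lborel. LINT y|lborel. h (x, y))"
    "AE x in lborel. integrable lborel (\<lambda>y. h (x, y))"
    "integrable lborel (\<lambda>x. LINT y|lborel. h (x, y))"
  using lborel_pair.integral_fst'[of h] lborel_pair.AE_integrable_fst'[of h] lborel_pair.integrable_fst'[of h] assms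
  by (simp_all add: lborel_prod)

lemma lborel_AE_pair:
  fixes Q :: "'a::euclidean_space \<times> 'b::euclidean_space \<Rightarrow> bool"
  assumes "AE p in lborel. Q p" shows "AE x in lborel. AE y in lborel. Q (x, y)"
  by (rule lborel_pair.AE_pair) (subst lborel_prod, rule assms)

definition sq_int :: "('a::euclidean_space \<Rightarrow> real) \<Rightarrow> bool" where
  "sq_int u \<longleftrightarrow> u \<in> borel_measurable borel \<and> integrable lborel (\<lambda>x. (u x)\<^sup>2)"

definition sqn :: "('a::euclidean_space \<Rightarrow> real) \<Rightarrow> real" where
  "sqn u = (LINT x|lborel. (u x)\<^sup>2)"

lemma sq_int_borel [measurable_dest]: "sq_int u \<Longrightarrow> u \<in> borel_measurable borel"
  by (simp add: sq_int_def)

lemma sq_intD: "sq_int u \<Longrightarrow> integrable lborel (\<lambda>x. (u x)\<^sup>2)"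
  by (simp add: sq_int_def)

lemma sqn_nonneg: "sqn u \<ge> 0"
  by (simp add: sqn_def)

lemma abs_mult_le_squares: "\<bar>a * b\<bar> \<le> a\<^sup>2 + (b::real)\<^sup>2"
proof -
  have "0 \<le> (\<bar>a\<bar> - \<bar>b\<bar>)\<^sup>2" by simp
  then have "2 * (\<bar>a\<bar> * \<bar>b\<bar>) \<le> a\<^sup>2 + b\<^sup>2" by (simp add: power2_diff)
  moreover have "0 \<le> \<bar>a\<bar> * \<bar>b\<bar>" by simp
  ultimately have "\<bar>a\<bar> * \<bar>b\<bar> \<le> a\<^sup>2 + b\<^sup>2" by (smt (verit))
  then show ?thesis by (simp add: abs_mult)
qed

lemma sq_int_mult: assumes "sq_int u" "sq_int v" shows "integrable lborel (\<lambda>x. u x * v x)"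
proof (rule Bochner_Integration.integrable_bound)
  show "integrable lborel (\<lambda>x. (u x)\<^sup>2 + (v x)\<^sup>2)" using assms by (simp add: sq_intD)
  show "AE x in lborel. norm (u x * v x) \<le> norm ((u x)\<^sup>2 + (v x)\<^sup>2)"
    using abs_mult_le_squares by (auto intro!: AE_I2 order_trans[OF abs_mult_le_squares])
qed (use assms in \<open>auto dest: sq_int_borel\<close>)

lemma sq_int_lin: assumes "sq_int u" "sq_int v" shows "sq_int (\<lambda>x. u x + c * v x)"
proof -
  have "(\<lambda>x. (u x + c * v x)\<^sup>2) = (\<lambda>x. (u x)\<^sup>2 + (2 * c * (u x * v x) + c\<^sup>2 * (v x)\<^sup>2))"
    by (auto simp: power2_eq_square algebra_simps)
  then show ?thesis unfolding sq_int_def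
    using assms sq_int_mult[OF assms] by (auto simp: sq_intD dest: sq_int_borel)
qed

lemma sq_int_0 [simp]: "sq_int (\<lambda>x. 0)"
  by (simp add: sq_int_def)

lemma sq_int_cmult: "sq_int v \<Longrightarrow> sq_int (\<lambda>x. c * v x)"
  using sq_int_lin[of "\<lambda>x. 0" v c] by simp

lemma sq_int_diff: "sq_int u \<Longrightarrow> sq_int v \<Longrightarrow> sq_int (\<lambda>x. u x - v x)"
  using sq_int_lin[of u v "-1"] by simp

lemma sq_int_sum: "(\<And>i. i \<in> I \<Longrightarrow> sq_int (u i)) \<Longrightarrow> sq_int (\<lambda>x. \<Sum>i\<in>I. u i x)"
proof (induction I rule: infinite_finite_induct)
  case (insert i I)
  then show ?case using sq_int_lin[of "u i" "\<lambda>x. \<Sum>i\<in>I. u i x" 1] by simp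
qed auto

lemma sq_int_mult_bnd: assumes "sq_int u" "bnd_borel h" shows "sq_int (\<lambda>x. u x * h x)"
proof -
  have "integrable lborel (\<lambda>x. (u x)\<^sup>2 * (h x * h x))"
    by (intro integrable_mult_bnd_borel sq_intD assms bnd_borel_mult)
  then show ?thesis unfolding sq_int_def using assms
    by (auto simp: power2_eq_square ac_simps dest: sq_int_borel bnd_borel_measurable)
qed

lemma Cauchy_Schwarz_integral:
  assumes u: "sq_int u" and v: "sq_int v"
  shows "\<bar>LINT x|lborel. u x * v x\<bar> \<le> sqrt (sqn u) * sqrt (sqn v)"
proof -
  define A B C where "A = sqn u" and "B = sqn v" and "C = (LINT x|lborel. u x * v x)"
  note i = sq_int_mult[OF u v] sq_intD[OF u] sq_intD[OF v]
  have "C\<^sup>2 \<le> A * B"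
  proof (cases "B = 0")
    case True
    then have "AE x in lborel. (v x)\<^sup>2 = 0"
      unfolding B_def sqn_def using integral_nonneg_eq_0_iff_AE[OF i(3)] by simp
    then have "AE x in lborel. u x * v x = 0" by eventually_elim auto
    then have "C = 0" unfolding C_def by (rule integral_eq_zero_AE)
    then show ?thesis using True by simp
  next
    case False
    then have B: "B > 0" unfolding B_def using sqn_nonneg by (simp add: less_le)
    \<comment> \<open>The integrand is the square of \<open>B\<close> times the component of
      \<open>u\<close> orthogonal to \<open>v\<close>.\<close>
    have "0 \<le> (LINT x|lborel. (B * u x - C * v x)\<^sup>2)" by simp
    also have "(\<lambda>x. (B * u x - C * v x)\<^sup>2) = (\<lambda>x. B\<^sup>2 * (u x)\<^sup>2 - (2 * B * C) * (u x * v x) + C\<^sup>2 * (v x)\<^sup>2)"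
      by (auto simp: power2_eq_square algebra_simps)
    also have "(LINT x|lborel. B\<^sup>2 * (u x)\<^sup>2 - (2 * B * C) * (u x * v x) + C\<^sup>2 * (v x)\<^sup>2) = B\<^sup>2 * A - (2 * B * C) * C + C\<^sup>2 * B"
      using i by (simp add: A_def B_def C_def sqn_def)
    also have "\<dots> = B * (A * B - C\<^sup>2)" by (simp add: power2_eq_square algebra_simps)
    finally show ?thesis using B by (simp add: zero_le_mult_iff)
  qed
  then have "sqrt (C\<^sup>2) \<le> sqrt (A * B)" by (rule real_sqrt_le_mono)
  then show ?thesis unfolding A_def B_def C_def by (simp add: real_sqrt_mult)
qed

lemma sq_int_compact_support:
  assumes "continuous_on UNIV \<phi>" "compact K" "\<And>x. x \<notin> K \<Longrightarrow> \<phi> x = 0"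
  shows "sq_int \<phi>"
proof -
  have m: "\<phi> \<in> borel_measurable borel" using assms by (intro borel_measurable_continuous_onI)
  have c: "continuous_on K (\<lambda>x. (\<phi> x)\<^sup>2)" using assms(1) by (intro continuous_intros continuous_on_subset[OF assms(1)]) auto
  have i: "integrable lborel (\<lambda>x. indicator K x *\<^sub>R (\<phi> x)\<^sup>2)" by (rule borel_integrable_compact[OF assms(2) c])
  have "indicator K x *\<^sub>R (\<phi> x)\<^sup>2 = (\<phi> x)\<^sup>2" for x using assms(3)[of x] by (cases "x \<in> K") auto
  then have "(\<lambda>x. indicator K x *\<^sub>R (\<phi> x)\<^sup>2) = (\<lambda>x. (\<phi> x)\<^sup>2)" by (intro ext)
  from i[unfolded this] m show ?thesis unfolding sq_int_def by blast
qed

lemma sq_int_test_function: "test_function \<Omega> \<phi> \<Longrightarrow> sq_int \<phi>"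
  by (rule test_functionD, assumption) (rule sq_int_compact_support[OF test_function_continuous])

lemma sq_int_tensor:
  fixes f :: "'a::euclidean_space \<Rightarrow> real" and e :: "'b::euclidean_space \<Rightarrow> real"
  assumes f: "sq_int f" and e: "sq_int e"
  shows "sq_int (\<lambda>p. f (fst p) * e (snd p))" "sqn (\<lambda>p. f (fst p) * e (snd p)) = sqn f * sqn e"
proof -
  have [measurable]: "f \<in> borel_measurable borel" "e \<in> borel_measurable borel"
    using f e by (auto dest: sq_int_borel)
  have i: "integrable lborel (\<lambda>p. (f (fst p))\<^sup>2 * (e (snd p))\<^sup>2)"
    using integrable_tensor[OF sq_intD[OF f] sq_intD[OF e]] by (simp add: lborel_prod)
  show "sq_int (\<lambda>p. f (fst p) * e (snd p))" unfolding sq_int_def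
    using i by (auto simp: power_mult_distrib borel_prod[symmetric])
  show "sqn (\<lambda>p. f (fst p) * e (snd p)) = sqn f * sqn e" unfolding sqn_def
    using lborel_Fubini(1)[OF i] by (simp add: power_mult_distrib)
qed

subsection \<open>Curves in \<open>L\<^sup>2\<close>\<close>

lemma sq_int_iff_nn_integral:
  "sq_int u \<longleftrightarrow> u \<in> borel_measurable borel \<and> (\<integral>\<^sup>+x. ennreal ((u x)\<^sup>2) \<partial>lborel) < \<infinity>"
  unfolding sq_int_def by (auto simp: integrable_iff_bounded)

lemma sq_int_nn_integral: "sq_int u \<Longrightarrow> (\<integral>\<^sup>+x. ennreal ((u x)\<^sup>2) \<partial>lborel) = ennreal (sqn u)"
  unfolding sqn_def by (intro nn_integral_eq_integral sq_intD) auto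

lemma eventually_in_Icc: "eventually (\<lambda>t. t \<in> {0..T}) (at (t\<^sub>0::real) within {0..T})"
  by (auto simp: eventually_at_filter)

lemma C_L2_iff:
  "C_L2 T UNIV u \<longleftrightarrow> (\<forall>t\<in>{0..T}. sq_int (u t)) \<and>
     (\<forall>t\<^sub>0\<in>{0..T}. ((\<lambda>t. sqn (\<lambda>x. u t x - u t\<^sub>0 x)) \<longlongrightarrow> 0) (at t\<^sub>0 within {0..T}))"
proof -
  have "((\<lambda>t. \<integral>\<^sup>+x. ennreal ((u t x - u t\<^sub>0 x)\<^sup>2) \<partial>lborel) \<longlongrightarrow> 0) (at t\<^sub>0 within {0..T})
    \<longleftrightarrow> ((\<lambda>t. sqn (\<lambda>x. u t x - u t\<^sub>0 x)) \<longlongrightarrow> 0) (at t\<^sub>0 within {0..T})"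
    if sq: "\<forall>t\<in>{0..T}. sq_int (u t)" and t0: "t\<^sub>0 \<in> {0..T}" for t\<^sub>0
  proof -
    have e: "eventually (\<lambda>t. (\<integral>\<^sup>+x. ennreal ((u t x - u t\<^sub>0 x)\<^sup>2) \<partial>lborel) = ennreal (sqn (\<lambda>x. u t x - u t\<^sub>0 x)))
        (at t\<^sub>0 within {0..T})"
      using eventually_in_Icc by eventually_elim (use sq t0 in \<open>intro sq_int_nn_integral sq_int_diff; blast\<close>)
    show ?thesis
      unfolding tendsto_cong[OF e] ennreal_0[symmetric]
      by (rule tendsto_ennreal_iff) (auto simp: sqn_nonneg)
  qed
  then show ?thesis
    unfolding C_L2_def set_borel_measurable_def by (auto simp: sq_int_iff_nn_integral)
qed

lemma C_L2_sq_int: "C_L2 T UNIV u \<Longrightarrow> t \<in> {0..T} \<Longrightarrow> sq_int (u t)"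
  by (simp add: C_L2_iff)

lemma C_L2_tendsto: "C_L2 T UNIV u \<Longrightarrow> t\<^sub>0 \<in> {0..T} \<Longrightarrow>
    ((\<lambda>t. sqn (\<lambda>x. u t x - u t\<^sub>0 x)) \<longlongrightarrow> 0) (at t\<^sub>0 within {0..T})"
  by (simp add: C_L2_iff)

lemma C_L2_zero_extension:
  assumes "C_L2 T \<Omega> u" "\<Omega> \<in> sets borel" shows "C_L2 T UNIV (\<lambda>t x. indicator \<Omega> x * u t x)"
proof -
  have "ennreal ((indicator \<Omega> x * a)\<^sup>2) = ennreal (a\<^sup>2) * indicator \<Omega> x"
    "ennreal ((indicator \<Omega> x * a - indicator \<Omega> x * b)\<^sup>2) = ennreal ((a - b)\<^sup>2) * indicator \<Omega> x" for x a b
    by (auto simp: indicator_def)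
  then show ?thesis using assms(1) unfolding C_L2_def set_borel_measurable_def by simp
qed

text \<open>This takes the place of joint measurability: the inner integrals in
  \<open>curve_distr\<close> are continuous functions of \<open>t\<close>, so the outer integral is
  well behaved. The difference of two pairings is expanded bilinearly and each term estimated by
  Cauchy-Schwarz.\<close>

lemma C_L2_pairing:
  assumes u: "C_L2 T UNIV u" and v: "C_L2 T UNIV v"
  shows "continuous_on {0..T} (\<lambda>t. LINT x|lborel. u t x * v t x)"
  unfolding continuous_on_def
proof
  fix s assume s: "s \<in> {0..T}"
  let ?F = "at s within {0..T}"
  let ?d = "\<lambda>t. sqrt (sqn (\<lambda>x. u t x - u s x))" and ?e = "\<lambda>t. sqrt (sqn (\<lambda>x. v t x - v s x))"
  have lim: "(?d \<longlongrightarrow> 0) ?F" "(?e \<longlongrightarrow> 0) ?F"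
    using tendsto_real_sqrt[OF C_L2_tendsto[OF u s]] tendsto_real_sqrt[OF C_L2_tendsto[OF v s]] by simp_all
  have "((\<lambda>t. (LINT x|lborel. u t x * v t x) - (LINT x|lborel. u s x * v s x)) \<longlongrightarrow> 0) ?F"
  proof (rule Lim_null_comparison)
    show "eventually (\<lambda>t. norm ((LINT x|lborel. u t x * v t x) - (LINT x|lborel. u s x * v s x))
        \<le> ?d t * ?e t + sqrt (sqn (u s)) * ?e t + ?d t * sqrt (sqn (v s))) ?F"
      using eventually_in_Icc
    proof eventually_elim
      case (elim t)
      note q = C_L2_sq_int[OF u elim] C_L2_sq_int[OF u s] C_L2_sq_int[OF v elim] C_L2_sq_int[OF v s]
      note d = sq_int_diff[OF q(1,2)] sq_int_diff[OF q(3,4)]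
      have "(LINT x|lborel. u t x * v t x) - (LINT x|lborel. u s x * v s x)
         = (LINT x|lborel. (u t x * v t x) - u s x * v s x)"
        using sq_int_mult q by (intro Bochner_Integration.integral_diff[symmetric]) auto
      also have "\<dots> = (LINT x|lborel. (u t x - u s x) * (v t x - v s x)
          + u s x * (v t x - v s x) + (u t x - u s x) * v s x)"
        by (rule Bochner_Integration.integral_cong) (auto simp: algebra_simps)
      also have "\<dots> = (LINT x|lborel. (u t x - u s x) * (v t x - v s x))
          + (LINT x|lborel. u s x * (v t x - v s x)) + (LINT x|lborel. (u t x - u s x) * v s x)"
        using sq_int_mult[OF d] sq_int_mult[OF q(2) d(2)] sq_int_mult[OF d(1) q(4)] by simp
      finally show ?case
        using Cauchy_Schwarz_integral[OF d] Cauchy_Schwarz_integral[OF q(2) d(2)] Cauchy_Schwarz_integral[OF d(1) q(4)]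
        by (simp add: abs_le_iff)
    qed
    have "((\<lambda>t. ?d t * ?e t + sqrt (sqn (u s)) * ?e t + ?d t * sqrt (sqn (v s))) \<longlongrightarrow>
        0 * 0 + sqrt (sqn (u s)) * 0 + 0 * sqrt (sqn (v s))) ?F"
      by (intro tendsto_intros lim)
    then show "((\<lambda>t. ?d t * ?e t + sqrt (sqn (u s)) * ?e t + ?d t * sqrt (sqn (v s))) \<longlongrightarrow> 0) ?F" by simp
  qed
  then show "((\<lambda>t. LINT x|lborel. u t x * v t x) \<longlongrightarrow> (LINT x|lborel. u s x * v s x)) ?F"
    by (simp add: LIM_zero_iff)
qed

lemma continuous_on_integrable_Ioo:
  fixes g :: "real \<Rightarrow> real"
  assumes "continuous_on {0..T} g" shows "integrable lborel (\<lambda>t. indicator {0<..<T} t * g t)"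
proof -
  have "integrable lborel (\<lambda>t. indicator {0..T} t * g t)"
    using borel_integrable_atLeastAtMost'[OF assms] unfolding set_integrable_def by simp
  from integrable_mult_indicator[OF _ this, of "{0<..<T}"]
  have "integrable lborel (\<lambda>t. indicator {0<..<T} t * (indicator {0..T} t * g t))" by simp
  moreover have "indicator {0<..<T} t * (indicator {0..T} t * g t) = indicator {0<..<T} t * g t" for t
    by (auto simp: indicator_def)
  ultimately show ?thesis by simp
qed

lemma C_L2_bounded:
  assumes "C_L2 T UNIV u" obtains M where "M \<ge> 0" "\<And>t. t \<in> {0..T} \<Longrightarrow> sqrt (sqn (u t)) \<le> M"
proof -
  have "continuous_on {0..T} (\<lambda>t. sqn (u t))"
    using C_L2_pairing[OF assms assms] unfolding sqn_def by (simp add: power2_eq_square)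
  then have "bounded ((\<lambda>t. sqn (u t)) ` {0..T})" by (intro compact_imp_bounded compact_continuous_image) auto
  then obtain M where M: "M > 0" "\<And>t. t \<in> {0..T} \<Longrightarrow> \<bar>sqn (u t)\<bar> \<le> M" unfolding bounded_pos by auto
  show ?thesis
    by (rule that[of "sqrt M"]) (use M in \<open>auto simp: abs_le_iff\<close>)
qed

lemma C_L2_test_function:
  fixes \<phi> :: "real \<times> 'a::euclidean_space \<Rightarrow> real"
  assumes "test_function (I \<times> UNIV) \<phi>" shows "C_L2 T UNIV (\<lambda>t x. \<phi> (t, x))"
  unfolding C_L2_iff
proof (intro conjI ballI)
  show "sq_int (\<lambda>x. \<phi> (t, x))" for t by (rule sq_int_test_function[OF test_function_section(1)[OF assms]])
  fix s assume "s \<in> {0..T}"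
  obtain K where K: "compact K" "\<And>x. x \<notin> K \<Longrightarrow> \<phi> x = 0" using test_functionD[OF assms] by metis
  obtain B where B: "B > 0" "\<And>x. \<bar>\<phi> x\<bar> \<le> B" using test_function_bounded[OF assms] by metis
  have cont: "isCont \<phi> x" for x
    using test_function_continuous[OF assms] continuous_on_eq_continuous_at open_UNIV by blast
  have [measurable]: "(\<lambda>x. \<phi> (t, x)) \<in> borel_measurable borel" for t
    by (rule test_function_borel[OF test_function_section(1)[OF assms]])
  have cS: "compact (snd ` K)" by (intro compact_continuous_image K continuous_intros)
  have Ki: "integrable lborel (indicat_real (snd ` K))"
    using borel_integrable_compact[OF cS continuous_on_const[of _ "1::real"]] by simp
  show "((\<lambda>t. sqn (\<lambda>x. \<phi> (t, x) - \<phi> (s, x))) \<longlongrightarrow> 0) (at s within {0..T})"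
    unfolding tendsto_at_iff_sequentially
  proof (intro allI impI)
    fix X assume X: "X \<longlonglongrightarrow> s"
    have "(\<lambda>n. LINT x|lborel. (\<phi> (X n, x) - \<phi> (s, x))\<^sup>2) \<longlonglongrightarrow> (LINT x|(lborel::'a measure). 0)"
    proof (rule integral_dominated_convergence[where w = "\<lambda>x. (2 * B)\<^sup>2 * indicator (snd ` K) x"])
      show "AE x in lborel. (\<lambda>n. (\<phi> (X n, x) - \<phi> (s, x))\<^sup>2) \<longlonglongrightarrow> 0"
      proof (rule AE_I2)
        fix x
        have "(\<lambda>n. \<phi> (X n, x)) \<longlonglongrightarrow> \<phi> (s, x)"
          by (rule isCont_tendsto_compose[OF cont]) (intro tendsto_intros X)
        then have "(\<lambda>n. (\<phi> (X n, x) - \<phi> (s, x))\<^sup>2) \<longlonglongrightarrow> (\<phi> (s, x) - \<phi> (s, x))\<^sup>2"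
          by (intro tendsto_intros)
        then show "(\<lambda>n. (\<phi> (X n, x) - \<phi> (s, x))\<^sup>2) \<longlonglongrightarrow> 0" by simp
      qed
      show "AE x in lborel. norm ((\<phi> (X n, x) - \<phi> (s, x))\<^sup>2) \<le> (2 * B)\<^sup>2 * indicator (snd ` K) x" for n
      proof (rule AE_I2)
        fix x
        show "norm ((\<phi> (X n, x) - \<phi> (s, x))\<^sup>2) \<le> (2 * B)\<^sup>2 * indicator (snd ` K) x"
        proof (cases "x \<in> snd ` K")
          case True
          have "\<bar>\<phi> (X n, x) - \<phi> (s, x)\<bar> \<le> 2 * B" using B(2)[of "(X n, x)"] B(2)[of "(s, x)"] by linarith
          then have "\<bar>\<phi> (X n, x) - \<phi> (s, x)\<bar>\<^sup>2 \<le> (2 * B)\<^sup>2" by (intro power_mono) auto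
          then show ?thesis using True by simp
        next
          case False
          then have "(t, x) \<notin> K" for t by force
          then show ?thesis using K(2) False by simp
        qed
      qed
    qed (use Ki in auto)
    then show "((\<lambda>t. sqn (\<lambda>x. \<phi> (t, x) - \<phi> (s, x))) \<circ> X) \<longlonglongrightarrow> 0" by (simp add: sqn_def o_def)
  qed
qed

lemma C_L2_tensor:
  assumes "C_L2 T UNIV v" "sq_int e" shows "C_L2 T UNIV (\<lambda>t p. v t (fst p) * e (snd p))"
  unfolding C_L2_iff
proof (intro conjI ballI)
  show "sq_int (\<lambda>p. v t (fst p) * e (snd p))" if "t \<in> {0..T}" for t
    by (rule sq_int_tensor(1)[OF C_L2_sq_int[OF assms(1) that] assms(2)])
  fix s assume s: "s \<in> {0..T}"
  have "((\<lambda>t. sqn (\<lambda>x. v t x - v s x) * sqn e) \<longlongrightarrow> 0 * sqn e) (at s within {0..T})"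
    by (intro tendsto_intros C_L2_tendsto[OF assms(1) s])
  moreover have "eventually (\<lambda>t. sqn (\<lambda>x. v t x - v s x) * sqn e =
      sqn (\<lambda>p. v t (fst p) * e (snd p) - v s (fst p) * e (snd p))) (at s within {0..T})"
    using eventually_in_Icc
  proof eventually_elim
    case (elim t)
    show ?case
      using sq_int_tensor(2)[OF sq_int_diff[OF C_L2_sq_int[OF assms(1) elim] C_L2_sq_int[OF assms(1) s]] assms(2)]
      by (simp add: left_diff_distrib)
  qed
  ultimately show "((\<lambda>t. sqn (\<lambda>p. v t (fst p) * e (snd p) - v s (fst p) * e (snd p))) \<longlongrightarrow> 0) (at s within {0..T})"
    using Lim_transform_eventually by fastforce
qed

subsection \<open>Pairing with tensor products\<close>

text \<open>With \<open>\<phi>\<close> fixed this is a functional of the vertical profile alone, and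
  it remains meaningful for every square integrable \<open>e\<close>, not only for test
  functions.\<close>

definition pair_strip ::
    "real \<Rightarrow> (real \<Rightarrow> 'a::euclidean_space \<times> real \<Rightarrow> real) \<Rightarrow> (real \<times> 'a \<Rightarrow> real) \<Rightarrow> (real \<Rightarrow> real) \<Rightarrow> real" where
  "pair_strip T u \<phi> e = curve_distr T UNIV u (\<lambda>p. \<phi> (fst p, fst (snd p)) * e (snd (snd p)))"

lemma pair_strip_alt:
  "pair_strip T u \<phi> e = (LINT t|lborel. indicator {0<..<T} t * (LINT p|lborel. u t p * (\<phi> (t, fst p) * e (snd p))))"
  by (simp add: pair_strip_def curve_distr_def set_lebesgue_integral_def)

lemma pair_strip_inner_continuous:
  assumes "C_L2 T UNIV u" "test_function (I \<times> UNIV) \<phi>" "sq_int e"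
  shows "continuous_on {0..T} (\<lambda>t. LINT p|lborel. u t p * (\<phi> (t, fst p) * e (snd p)))"
  by (rule C_L2_pairing[OF assms(1) C_L2_tensor[OF C_L2_test_function[OF assms(2)] assms(3)]])

lemma pair_strip_lin:
  assumes u: "C_L2 T UNIV u" and \<phi>: "test_function (I \<times> UNIV) \<phi>" and e: "sq_int e" "sq_int g"
  shows "pair_strip T u \<phi> (\<lambda>z. e z + c * g z) = pair_strip T u \<phi> e + c * pair_strip T u \<phi> g"
proof -
  let ?G = "\<lambda>e t. LINT p|lborel. u t p * (\<phi> (t, fst p) * e (snd p))"
  have eq: "?G (\<lambda>z. e z + c * g z) t = ?G e t + c * ?G g t" if t: "t \<in> {0..T}" for t
  proof -
    have i: "integrable lborel (\<lambda>p. u t p * (\<phi> (t, fst p) * e (snd p)))" if "sq_int e" for e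
      by (rule sq_int_mult[OF C_L2_sq_int[OF u t] sq_int_tensor(1)[OF sq_int_test_function[OF test_function_section(1)[OF \<phi>]] that]])
    have "(\<lambda>p. u t p * (\<phi> (t, fst p) * (e (snd p) + c * g (snd p)))) =
      (\<lambda>p. u t p * (\<phi> (t, fst p) * e (snd p)) + c * (u t p * (\<phi> (t, fst p) * g (snd p))))"
      by (auto simp: algebra_simps)
    then show ?thesis using i[OF e(1)] i[OF e(2)] by simp
  qed
  have "pair_strip T u \<phi> (\<lambda>z. e z + c * g z)
    = (LINT t|lborel. indicator {0<..<T} t * ?G e t + c * (indicator {0<..<T} t * ?G g t))"
    unfolding pair_strip_alt
    by (rule Bochner_Integration.integral_cong) (use eq in \<open>auto simp: indicator_def\<close>)
  also have "\<dots> = pair_strip T u \<phi> e + c * pair_strip T u \<phi> g"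
    unfolding pair_strip_alt
    using continuous_on_integrable_Ioo[OF pair_strip_inner_continuous[OF u \<phi> e(1)]]
      continuous_on_integrable_Ioo[OF pair_strip_inner_continuous[OF u \<phi> e(2)]] by simp
  finally show ?thesis .
qed

lemma pair_strip_bound:
  assumes T: "T > 0" and u: "C_L2 T UNIV u" and \<phi>: "test_function (I \<times> UNIV) \<phi>"
  obtains C where "C \<ge> 0" "\<And>e. sq_int e \<Longrightarrow> \<bar>pair_strip T u \<phi> e\<bar> \<le> C * sqrt (sqn e)"
proof -
  obtain M where M: "M \<ge> 0" "\<And>t. t \<in> {0..T} \<Longrightarrow> sqrt (sqn (u t)) \<le> M" using C_L2_bounded[OF u] by metis
  note c\<phi> = C_L2_test_function[OF \<phi>, of T]
  obtain N where N: "N \<ge> 0" "\<And>t. t \<in> {0..T} \<Longrightarrow> sqrt (sqn (\<lambda>x. \<phi> (t, x))) \<le> N" using C_L2_bounded[OF c\<phi>] by metis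
  have "\<bar>pair_strip T u \<phi> e\<bar> \<le> (T * M * N) * sqrt (sqn e)" if e: "sq_int e" for e
  proof -
    let ?G = "\<lambda>t. LINT p|lborel. u t p * (\<phi> (t, fst p) * e (snd p))"
    have G: "\<bar>?G t\<bar> \<le> M * N * sqrt (sqn e)" if t: "t \<in> {0..T}" for t
    proof -
      note te = sq_int_tensor[OF C_L2_sq_int[OF c\<phi> t] e]
      have "\<bar>?G t\<bar> \<le> sqrt (sqn (u t)) * sqrt (sqn (\<lambda>p. \<phi> (t, fst p) * e (snd p)))"
        by (rule Cauchy_Schwarz_integral[OF C_L2_sq_int[OF u t] te(1)])
      also have "\<dots> = sqrt (sqn (u t)) * (sqrt (sqn (\<lambda>x. \<phi> (t, x))) * sqrt (sqn e))"
        unfolding te(2) by (simp add: real_sqrt_mult)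
      also have "\<dots> \<le> M * (N * sqrt (sqn e))"
        using M N t by (intro mult_mono mult_nonneg_nonneg) (auto simp: sqn_nonneg)
      finally show ?thesis by (simp add: mult.assoc)
    qed
    have i: "integrable lborel (\<lambda>t. indicator {0<..<T} t * ?G t)"
      by (rule continuous_on_integrable_Ioo[OF pair_strip_inner_continuous[OF u \<phi> e]])
    have "\<bar>pair_strip T u \<phi> e\<bar> \<le> (LINT t|lborel. \<bar>indicator {0<..<T} t * ?G t\<bar>)"
      unfolding pair_strip_alt by (rule integral_abs_bound)
    also have "\<dots> \<le> (LINT t|lborel. (M * N * sqrt (sqn e)) * indicator {0<..<T} t)"
      by (intro integral_mono integrable_abs i integrable_mult_right integrable_Ioo)
         (use G in \<open>auto split: split_indicator\<close>)
    also have "\<dots> = T * M * N * sqrt (sqn e)" using T by simp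
    finally show ?thesis .
  qed
  moreover have "0 \<le> T * M * N" using T M(1) N(1) by simp
  ultimately show ?thesis by (intro that)
qed

text \<open>After multiplication by the square integrable cut-off \<open>I\<close>, bounded
  pointwise convergence implies convergence in mean square by domination, and the functional is
  continuous for the latter.\<close>

lemma bcl_of_L2_bounded:
  assumes lin: "\<And>e g c. sq_int e \<Longrightarrow> sq_int g \<Longrightarrow> F (\<lambda>z. e z + c * g z) = F e + c * F g"
    and bd: "\<And>e. sq_int e \<Longrightarrow> \<bar>F e\<bar> \<le> C * sqrt (sqn e)"
    and I: "sq_int I" "bnd_borel I"
  shows "bcl (\<lambda>h. F (\<lambda>z. h z * I z))"
proof (rule bclI)
  have sq: "sq_int (\<lambda>z. h z * I z)" if "bnd_borel h" for h
    using sq_int_mult_bnd[OF I(1) that] by (simp add: mult.commute)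
  {
    fix h g :: "'a \<Rightarrow> real" and a :: real assume "bnd_borel h" "bnd_borel g"
    then show "F (\<lambda>z. (h z + a * g z) * I z) = F (\<lambda>z. h z * I z) + a * F (\<lambda>z. g z * I z)"
      using lin[OF sq sq, of h g a] by (simp add: algebra_simps)
  }
  fix h :: "nat \<Rightarrow> 'a \<Rightarrow> real" and k :: "'a \<Rightarrow> real" and B :: real
  assume h: "\<And>n. bnd_borel (h n)" "\<And>n x. \<bar>h n x\<bar> \<le> B" "bnd_borel k" "\<And>x. (\<lambda>n. h n x) \<longlonglongrightarrow> k x"
  have [measurable]: "h n \<in> borel_measurable borel" "k \<in> borel_measurable borel" "I \<in> borel_measurable borel" for n
    using h I bnd_borel_measurable by auto
  have kB: "\<bar>k x\<bar> \<le> B" for x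
    by (rule LIMSEQ_le_const2[OF tendsto_rabs[OF h(4)]]) (use h(2) in blast)
  have "(\<lambda>n. LINT z|lborel. (h n z * I z - k z * I z)\<^sup>2) \<longlonglongrightarrow> (LINT z|(lborel::'a measure). 0)"
  proof (rule integral_dominated_convergence[where w = "\<lambda>z. (2 * B)\<^sup>2 * (I z)\<^sup>2"])
    show "AE z in lborel. norm ((h n z * I z - k z * I z)\<^sup>2) \<le> (2 * B)\<^sup>2 * (I z)\<^sup>2" for n
    proof (rule AE_I2)
      fix z
      have "\<bar>h n z - k z\<bar> \<le> 2 * B" using h(2)[of n z] kB[of z] by linarith
      then have "\<bar>h n z - k z\<bar>\<^sup>2 \<le> (2 * B)\<^sup>2" by (intro power_mono) auto
      then have "(h n z - k z)\<^sup>2 * (I z)\<^sup>2 \<le> (2 * B)\<^sup>2 * (I z)\<^sup>2" by (intro mult_right_mono) auto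
      then show "norm ((h n z * I z - k z * I z)\<^sup>2) \<le> (2 * B)\<^sup>2 * (I z)\<^sup>2"
        by (simp add: left_diff_distrib[symmetric] power_mult_distrib)
    qed
    show "AE z in lborel. (\<lambda>n. (h n z * I z - k z * I z)\<^sup>2) \<longlonglongrightarrow> 0"
    proof (rule AE_I2)
      fix z
      have "(\<lambda>n. (h n z * I z - k z * I z)\<^sup>2) \<longlonglongrightarrow> (k z * I z - k z * I z)\<^sup>2" by (intro tendsto_intros h)
      then show "(\<lambda>n. (h n z * I z - k z * I z)\<^sup>2) \<longlonglongrightarrow> 0" by simp
    qed
  qed (use sq_intD[OF I(1)] in auto)
  then have n0: "(\<lambda>n. sqn (\<lambda>z. h n z * I z - k z * I z)) \<longlonglongrightarrow> 0" unfolding sqn_def by simp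
  have "(\<lambda>n. F (\<lambda>z. h n z * I z) - F (\<lambda>z. k z * I z)) \<longlonglongrightarrow> 0"
  proof (rule Lim_null_comparison)
    have "F (\<lambda>z. h n z * I z) - F (\<lambda>z. k z * I z) = F (\<lambda>z. h n z * I z - k z * I z)" for n
      using lin[OF sq[OF h(1)] sq[OF h(3)], of n "-1"] by simp
    then show "eventually (\<lambda>n. norm (F (\<lambda>z. h n z * I z) - F (\<lambda>z. k z * I z)) \<le> C * sqrt (sqn (\<lambda>z. h n z * I z - k z * I z))) sequentially"
      using bd[OF sq_int_diff[OF sq[OF h(1)] sq[OF h(3)]]] by simp
    show "(\<lambda>n. C * sqrt (sqn (\<lambda>z. h n z * I z - k z * I z))) \<longlonglongrightarrow> 0"
      using tendsto_mult[OF tendsto_const tendsto_real_sqrt[OF n0], of C] by simp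
  qed
  then show "(\<lambda>n. F (\<lambda>z. h n z * I z)) \<longlonglongrightarrow> F (\<lambda>z. k z * I z)" by (simp add: LIM_zero_iff)
qed

lemma sq_int_Ioo: "sq_int (indicat_real {a<..<b::real})"
proof -
  have "(\<lambda>x. (indicat_real {a<..<b} x)\<^sup>2) = indicat_real {a<..<b}" by (auto simp: indicator_def)
  then show ?thesis using integrable_Ioo[of a b] unfolding sq_int_def by simp
qed

lemma bnd_borel_Ioo: "bnd_borel (indicat_real {a<..<b::real})"
  by (rule bnd_borel_indicator) simp

lemma bcl_pair_strip:
  assumes T: "T > 0" and u: "C_L2 T UNIV u" and \<phi>: "test_function (I \<times> UNIV) \<phi>"
  shows "bcl (\<lambda>h. pair_strip T u \<phi> (\<lambda>z. h z * indicator {a<..<b} z))"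
proof -
  obtain C where "C \<ge> 0" "\<And>e. sq_int e \<Longrightarrow> \<bar>pair_strip T u \<phi> e\<bar> \<le> C * sqrt (sqn e)"
    using pair_strip_bound[OF T u \<phi>] by metis
  then show ?thesis by (intro bcl_of_L2_bounded[OF pair_strip_lin[OF u \<phi>] _ sq_int_Ioo bnd_borel_Ioo])
qed

lemma pair_strip_L2_limit:
  assumes T: "T > 0" and u: "C_L2 T UNIV u" and \<phi>: "test_function (I \<times> UNIV) \<phi>"
    and e: "\<And>n. sq_int (e n)" "sq_int k" and lim: "(\<lambda>n. sqn (\<lambda>z. e n z - k z)) \<longlonglongrightarrow> 0"
  shows "(\<lambda>n. pair_strip T u \<phi> (e n)) \<longlonglongrightarrow> pair_strip T u \<phi> k"
proof -
  obtain C where C: "C \<ge> 0" "\<And>e. sq_int e \<Longrightarrow> \<bar>pair_strip T u \<phi> e\<bar> \<le> C * sqrt (sqn e)"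
    using pair_strip_bound[OF T u \<phi>] by metis
  have "(\<lambda>n. pair_strip T u \<phi> (e n) - pair_strip T u \<phi> k) \<longlonglongrightarrow> 0"
  proof (rule Lim_null_comparison)
    have "pair_strip T u \<phi> (e n) - pair_strip T u \<phi> k = pair_strip T u \<phi> (\<lambda>z. e n z - k z)" for n
      using pair_strip_lin[OF u \<phi> e(1) e(2), of n "-1"] by simp
    then show "eventually (\<lambda>n. norm (pair_strip T u \<phi> (e n) - pair_strip T u \<phi> k) \<le> C * sqrt (sqn (\<lambda>z. e n z - k z))) sequentially"
      using C(2)[OF sq_int_diff[OF e(1) e(2)]] by simp
    show "(\<lambda>n. C * sqrt (sqn (\<lambda>z. e n z - k z))) \<longlonglongrightarrow> 0"
      using tendsto_mult[OF tendsto_const tendsto_real_sqrt[OF lim], of C] by simp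
  qed
  then show ?thesis by (simp add: LIM_zero_iff)
qed

section \<open>Coefficients obtained by integrating in the vertical variable\<close>

lemma coefficient_sq_int:
  fixes u :: "'a::euclidean_space \<times> real \<Rightarrow> real"
  assumes u: "sq_int u" and k: "sq_int k" and a: "a \<in> borel_measurable borel"
    and eq: "AE X in lborel. a X = (LINT z|lborel. u (X, z) * k z)"
  shows "sq_int a" "sqn a \<le> sqn u * sqn k"
proof -
  note F = lborel_Fubini[OF sq_intD[OF u]]
  have um: "(\<lambda>z. u (X, z)) \<in> borel_measurable borel" for X
    using sq_int_borel[OF u] by (intro measurable_compose[OF _ sq_int_borel[OF u]]) (simp add: borel_prod[symmetric])
  have le: "AE X in lborel. (a X)\<^sup>2 \<le> (LINT z|lborel. (u (X, z))\<^sup>2) * sqn k"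
    using eq F(2)
  proof eventually_elim
    case (elim X)
    have s: "sq_int (\<lambda>z. u (X, z))" using um elim unfolding sq_int_def by simp
    have "\<bar>a X\<bar>\<^sup>2 \<le> (sqrt (sqn (\<lambda>z. u (X, z))) * sqrt (sqn k))\<^sup>2"
      using Cauchy_Schwarz_integral[OF s k] elim by (intro power_mono) auto
    then show ?case by (simp add: power_mult_distrib sqn_nonneg sqn_def)
  qed
  have i: "integrable lborel (\<lambda>X. (LINT z|lborel. (u (X, z))\<^sup>2) * sqn k)" using F(3) by simp
  show "sq_int a" unfolding sq_int_def
  proof
    show "integrable lborel (\<lambda>X. (a X)\<^sup>2)"
    proof (rule Bochner_Integration.integrable_bound[OF i])
      show "AE X in lborel. norm ((a X)\<^sup>2) \<le> norm ((LINT z|lborel. (u (X, z))\<^sup>2) * sqn k)"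
        using le by eventually_elim (auto simp: abs_mult sqn_nonneg)
    qed (use a in simp)
  qed (rule a)
  have "sqn a \<le> (LINT X|lborel. (LINT z|lborel. (u (X, z))\<^sup>2) * sqn k)" unfolding sqn_def[of a]
    by (rule integral_mono_AE[OF sq_intD[OF \<open>sq_int a\<close>] i le])
  then show "sqn a \<le> sqn u * sqn k" using F(1) by (simp add: sqn_def)
qed

lemma section_product_AE_integrable:
  fixes u :: "'a::euclidean_space \<times> real \<Rightarrow> real"
  assumes u: "sq_int u" and k: "sq_int k"
  shows "AE X in lborel. integrable lborel (\<lambda>z. u (X, z) * k z)"
proof -
  have um: "(\<lambda>z. u (X, z)) \<in> borel_measurable borel" for X
    using sq_int_borel[OF u] by (intro measurable_compose[OF _ sq_int_borel[OF u]]) (simp add: borel_prod[symmetric])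
  show ?thesis using lborel_Fubini(2)[OF sq_intD[OF u]]
    by eventually_elim (rule sq_int_mult[OF _ k], use um in \<open>simp add: sq_int_def\<close>)
qed

lemma coefficient_C_L2:
  fixes u :: "real \<Rightarrow> 'a::euclidean_space \<times> real \<Rightarrow> real"
  assumes u: "C_L2 T UNIV u" and k: "sq_int k" and a: "\<And>t. t \<in> {0..T} \<Longrightarrow> a t \<in> borel_measurable borel"
    and eq: "\<And>t. t \<in> {0..T} \<Longrightarrow> AE X in lborel. a t X = (LINT z|lborel. u t (X, z) * k z)"
  shows "C_L2 T UNIV a"
  unfolding C_L2_iff
proof (intro conjI ballI)
  show "sq_int (a t)" if "t \<in> {0..T}" for t
    by (rule coefficient_sq_int(1)[OF C_L2_sq_int[OF u that] k a[OF that] eq[OF that]])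
  fix s assume s: "s \<in> {0..T}"
  have le: "sqn (\<lambda>X. a t X - a s X) \<le> sqn (\<lambda>p. u t p - u s p) * sqn k" if t: "t \<in> {0..T}" for t
  proof (rule coefficient_sq_int(2)[OF sq_int_diff[OF C_L2_sq_int[OF u t] C_L2_sq_int[OF u s]] k])
    show "(\<lambda>X. a t X - a s X) \<in> borel_measurable borel" using a s t by auto
    show "AE X in lborel. a t X - a s X = (LINT z|lborel. (u t (X, z) - u s (X, z)) * k z)"
      using eq[OF t] eq[OF s] section_product_AE_integrable[OF C_L2_sq_int[OF u t] k]
        section_product_AE_integrable[OF C_L2_sq_int[OF u s] k]
      by eventually_elim (simp add: left_diff_distrib)
  qed
  have "((\<lambda>t. sqn (\<lambda>p. u t p - u s p) * sqn k) \<longlongrightarrow> 0) (at s within {0..T})"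
    using tendsto_mult[OF C_L2_tendsto[OF u s] tendsto_const, of "sqn k"] by simp
  then show "((\<lambda>t. sqn (\<lambda>x. a t x - a s x)) \<longlongrightarrow> 0) (at s within {0..T})"
    by (rule Lim_null_comparison[rotated])
       (use eventually_in_Icc in \<open>rule eventually_mono, simp add: le abs_of_nonneg[OF sqn_nonneg]\<close>)
qed

lemma coefficient_pairing:
  fixes u :: "'a::euclidean_space \<times> real \<Rightarrow> real"
  assumes u: "sq_int u" and \<eta>: "sq_int \<eta>" and k: "sq_int k" and a: "a \<in> borel_measurable borel"
    and eq: "AE X in lborel. a X = (LINT z|lborel. u (X, z) * k z)"
  shows "(LINT p|lborel. u p * (\<eta> (fst p) * k (snd p))) = (LINT X|lborel. a X * \<eta> X)"
proof -
  have i: "integrable lborel (\<lambda>p. u p * (\<eta> (fst p) * k (snd p)))"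
    by (rule sq_int_mult[OF u sq_int_tensor(1)[OF \<eta> k]])
  note F = lborel_Fubini[OF i]
  have "(LINT p|lborel. u p * (\<eta> (fst p) * k (snd p))) = (LINT X|lborel. LINT z|lborel. u (X, z) * (\<eta> X * k z))"
    using F(1) by simp
  also have "\<dots> = (LINT X|lborel. a X * \<eta> X)"
  proof (rule integral_cong_AE)
    show "(\<lambda>X. LINT z|lborel. u (X, z) * (\<eta> X * k z)) \<in> borel_measurable lborel"
      using borel_measurable_integrable[OF F(3)] by simp
    show "(\<lambda>X. a X * \<eta> X) \<in> borel_measurable lborel" using a sq_int_borel[OF \<eta>] by simp
    show "AE X in lborel. (LINT z|lborel. u (X, z) * (\<eta> X * k z)) = a X * \<eta> X"
      using eq
    proof eventually_elim
      case (elim X)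
      have "(\<lambda>z. u (X, z) * (\<eta> X * k z)) = (\<lambda>z. (u (X, z) * k z) * \<eta> X)" by (simp add: ac_simps)
      then show ?case using elim by simp
    qed
  qed
  finally show ?thesis .
qed

text \<open>The bridge between the two sides of the theorem: a distribution built from one modal
  coefficient is the strip pairing with the corresponding dual profile, so a modal equation is a
  strip equation tested with that profile.\<close>

lemma coefficient_curve_distr:
  fixes u :: "real \<Rightarrow> 'a::euclidean_space \<times> real \<Rightarrow> real"
  assumes u: "C_L2 T UNIV u" and \<phi>: "test_function (I \<times> UNIV) \<phi>" and k: "sq_int k"
    and a: "\<And>t. t \<in> {0..T} \<Longrightarrow> a t \<in> borel_measurable borel"
    and eq: "\<And>t. t \<in> {0..T} \<Longrightarrow> AE X in lborel. a t X = (LINT z|lborel. u t (X, z) * k z)"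
  shows "curve_distr T UNIV a \<phi> = pair_strip T u \<phi> k"
  unfolding pair_strip_alt curve_distr_def set_lebesgue_integral_def
proof (rule Bochner_Integration.integral_cong[OF refl])
  fix t :: real
  show "indicator {0<..<T} t *\<^sub>R (LINT x|lborel. indicator UNIV x *\<^sub>R (a t x * \<phi> (t, x)))
    = indicator {0<..<T} t * (LINT p|lborel. u t p * (\<phi> (t, fst p) * k (snd p)))"
  proof (cases "t \<in> {0<..<T}")
    case True
    then have t: "t \<in> {0..T}" by auto
    show ?thesis
      using coefficient_pairing[OF C_L2_sq_int[OF u t] sq_int_test_function[OF test_function_section(1)[OF \<phi>]] k a[OF t] eq[OF t], of t]
      by simp
  qed simp
qed

section \<open>Square integrable harmonic functions\<close>

lemma lborel_integral_affine:
  fixes f :: "'a::euclidean_space \<Rightarrow> real"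
  assumes f: "f \<in> borel_measurable borel" and c: "c \<noteq> 0"
  shows "(LINT x|lborel. f x) = \<bar>c\<bar> ^ DIM('a) * (LINT x|lborel. f (t + c *\<^sub>R x))"
proof -
  have m: "(\<lambda>x. t + c *\<^sub>R x) \<in> borel_measurable (lborel :: 'a measure)" by simp
  have "(LINT x|lborel. f x) = (LINT x|density (distr lborel borel (\<lambda>x. t + c *\<^sub>R x)) (\<lambda>_. ennreal (\<bar>c\<bar> ^ DIM('a))). f x)"
    using lborel_affine[OF c, of t] by simp
  also have "\<dots> = (LINT x|distr lborel borel (\<lambda>x. t + c *\<^sub>R x). (\<bar>c\<bar> ^ DIM('a)) *\<^sub>R f x)"
    by (rule integral_density) (use f in auto)
  also have "\<dots> = (LINT x|lborel. (\<bar>c\<bar> ^ DIM('a)) *\<^sub>R f (t + c *\<^sub>R x))"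
    by (rule integral_distr[OF m]) (use f in auto)
  finally show ?thesis by simp
qed

text \<open>The averaging kernel is \<open>bump 2\<close>, and \<open>bump 0\<close> is its
  potential: the derivative of \<open>flat 0\<close> is \<open>flat 2\<close>, so the gradient of
  \<open>bump 0\<close> at \<open>y\<close> is \<open>-2 y\<close> times \<open>bump 2 y\<close>.
  The index 2 has no other origin.\<close>

definition bump :: "nat \<Rightarrow> 'a::euclidean_space \<Rightarrow> real" where
  "bump n y = flat n (1 - y \<bullet> y)"

definition laplacian :: "('a::euclidean_space \<Rightarrow> real) \<Rightarrow> 'a \<Rightarrow> real" where
  "laplacian f y = (\<Sum>b\<in>Basis. dirderiv b (dirderiv b f) y)"

lemma bump_nonneg: "0 \<le> bump n y"
  by (simp add: bump_def flat_nonneg)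

lemma bump_outside: "norm y \<ge> 1 \<Longrightarrow> bump n y = 0"
  using power_mono[of 1 "norm y" 2] by (simp add: bump_def flat_def dot_square_norm)

lemma bump_test_function: "test_function UNIV (bump n :: 'a::euclidean_space \<Rightarrow> real)"
proof (rule test_functionI[of _ "cball 0 1"])
  have e: "(\<lambda>y::'a. 1 - y \<bullet> y) = (\<lambda>y. 1 - (\<Sum>b\<in>Basis. (y \<bullet> b) * (y \<bullet> b)))"
    by (rule ext, subst euclidean_inner, rule refl)
  have q: "C_k k (\<lambda>y::'a. 1 - y \<bullet> y)" for k
    unfolding e by (intro C_k_diff C_k_const C_k_sum C_k_mult C_k_inner)
  then show "C_k k (bump n :: 'a \<Rightarrow> real)" for k
    using C_k_flat[OF q] unfolding bump_def by simp
  show "x \<in> cball 0 1" if "bump n x \<noteq> 0" for x :: 'a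
    using bump_outside[of x n] that by (cases "norm x \<ge> 1") auto
qed auto

lemma bump_gradient: "dirderiv v (bump 0) y = - 2 * ((y \<bullet> v) * bump 2 y)"
proof -
  have "((\<lambda>y::'a. 1 - y \<bullet> y) has_derivative (\<lambda>v. - (y \<bullet> v + v \<bullet> y))) (at y)"
    by (auto intro!: derivative_eq_intros)
  from dirderiv_eqI[OF flat_compose_deriv[OF this, of 0], of v]
  show ?thesis unfolding bump_def by (simp add: inner_commute numeral_2_eq_2)
qed

text \<open>The divergence of the gradient field \<open>-2 y\<close> times \<open>bump 2 y\<close>.
  Its bracket is also the derivative at \<open>s = 1\<close> of the mass preserving dilation of
  \<open>bump 2\<close>, which is what links Laplacians to changes of scale.\<close>

lemma bump_laplacian:
  "laplacian (bump 0) y = - 2 * (real DIM('a) * bump 2 y + dirderiv y (bump 2) (y::'a::euclidean_space))"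
proof -
  have d: "bump 2 differentiable (at y)" for y :: 'a by (rule test_function_differentiable[OF bump_test_function])
  have "dirderiv b (dirderiv b (bump 0)) y = - 2 * (bump 2 y + (y \<bullet> b) * dirderiv b (bump 2) y)"
    if "b \<in> Basis" for b :: 'a
  proof -
    have 1: "dirderiv b (bump 0) = (\<lambda>y. - 2 * ((y \<bullet> b) * bump 2 y))" by (rule ext) (rule bump_gradient)
    have "((\<lambda>y. - 2 * ((y \<bullet> b) * bump 2 y)) has_derivative
        (\<lambda>v. - 2 * ((y \<bullet> b) * dirderiv v (bump 2) y + (v \<bullet> b) * bump 2 y))) (at y)"
      by (intro has_derivative_mult_right has_derivative_mult has_derivative_frechet[OF d])
         (auto intro!: derivative_eq_intros)
    from dirderiv_eqI[OF this, of b] show ?thesis unfolding 1 using that by (simp add: inner_Basis algebra_simps)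
  qed
  then have "laplacian (bump 0) y = (\<Sum>b\<in>Basis. - 2 * (bump 2 y + (y \<bullet> b) * dirderiv b (bump 2) y))"
    unfolding laplacian_def by (rule sum.cong[OF refl])
  also have "\<dots> = - 2 * (real DIM('a) * bump 2 y + (\<Sum>b\<in>Basis. (y \<bullet> b) * dirderiv b (bump 2) y))"
    by (simp only: distrib_left sum.distrib sum_distrib_left[symmetric] sum_constant)
  also have "(\<Sum>b\<in>Basis. (y \<bullet> b) * dirderiv b (bump 2) y) = dirderiv y (bump 2) y"
    by (rule dirderiv_expand[symmetric, OF d])
  finally show ?thesis .
qed

lemma test_function_laplacian: "test_function \<Omega> f \<Longrightarrow> test_function \<Omega> (laplacian f)"
proof -
  assume f: "test_function \<Omega> f"
  obtain K where K: "compact K" "K \<subseteq> \<Omega>" "\<And>x. x \<notin> K \<Longrightarrow> f x = 0" using test_functionD[OF f] by metis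
  have t: "test_function \<Omega> (dirderiv b (dirderiv b f))" for b
    by (intro test_function_dirderiv f)
  have "test_function \<Omega> (\<lambda>y. \<Sum>b\<in>B. dirderiv b (dirderiv b f) y)" if "finite B" for B
    using that
  proof induction
    case empty
    show ?case by (rule test_functionI[of _ "{}"]) auto
  next
    case (insert b B)
    then show ?case using test_function_add[OF t[of b] insert.IH] by simp
  qed
  from this[OF finite_Basis] show ?thesis unfolding laplacian_def .
qed

lemma test_function_affine:
  fixes f :: "'a::euclidean_space \<Rightarrow> real"
  assumes f: "test_function UNIV f" and s: "s \<noteq> 0"
  shows "test_function UNIV (\<lambda>y. f (s *\<^sub>R (y - x)))"
    and "dirderiv v (\<lambda>y. f (s *\<^sub>R (y - x))) = (\<lambda>y. s * dirderiv v f (s *\<^sub>R (y - x)))"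
proof -
  obtain K where K: "compact K" "\<And>x. x \<notin> K \<Longrightarrow> f x = 0" using test_functionD[OF f] by metis
  have bl: "bounded_linear (\<lambda>y::'a. s *\<^sub>R y)" by (rule bounded_linear_scaleR_right)
  have e: "s *\<^sub>R y + - (s *\<^sub>R x) = s *\<^sub>R (y - x)" for y by (simp add: algebra_simps)
  show "test_function UNIV (\<lambda>y. f (s *\<^sub>R (y - x)))"
  proof (rule test_functionI[of _ "(\<lambda>z. x + (1/s) *\<^sub>R z) ` K"])
    show "compact ((\<lambda>z. x + (1/s) *\<^sub>R z) ` K)" by (intro compact_continuous_image K continuous_intros)
    show "C_k k (\<lambda>y. f (s *\<^sub>R (y - x)))" for k
      using C_k_affine[OF bl test_function_C_k[OF f], of k "- (s *\<^sub>R x)"] unfolding e .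
    fix y assume "f (s *\<^sub>R (y - x)) \<noteq> 0"
    then have "s *\<^sub>R (y - x) \<in> K" using K(2) by blast
    then show "y \<in> (\<lambda>z. x + (1/s) *\<^sub>R z) ` K" using s by (intro image_eqI[of _ _ "s *\<^sub>R (y - x)"]) auto
  qed simp
  show "dirderiv v (\<lambda>y. f (s *\<^sub>R (y - x))) = (\<lambda>y. s * dirderiv v f (s *\<^sub>R (y - x)))"
  proof
    fix y
    have "dirderiv v (\<lambda>y. f (s *\<^sub>R y + - (s *\<^sub>R x))) y = dirderiv (s *\<^sub>R v) f (s *\<^sub>R y + - (s *\<^sub>R x))"
      by (rule dirderiv_compose_linear[OF bl test_function_differentiable[OF f]])
    moreover have "dirderiv (s *\<^sub>R v) f z = s * dirderiv v f z" for z
      using linear_cmul[OF has_derivative_linear[OF test_function_has_derivative[OF f]]] by simp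
    ultimately show "dirderiv v (\<lambda>y. f (s *\<^sub>R (y - x))) y = s * dirderiv v f (s *\<^sub>R (y - x))"
      unfolding e by simp
  qed
qed

lemma laplacian_affine:
  fixes f :: "'a::euclidean_space \<Rightarrow> real"
  assumes f: "test_function UNIV f" and s: "s \<noteq> 0"
  shows "laplacian (\<lambda>y. f (s *\<^sub>R (y - x))) y = s\<^sup>2 * laplacian f (s *\<^sub>R (y - x))"
proof -
  have "dirderiv b (dirderiv b (\<lambda>y. f (s *\<^sub>R (y - x)))) y = s\<^sup>2 * dirderiv b (dirderiv b f) (s *\<^sub>R (y - x))" for b
  proof -
    have t: "test_function UNIV (dirderiv b f)" by (rule test_function_dirderiv[OF f])
    note t' = test_function_affine[OF t s, where x = x]
    have "dirderiv b (\<lambda>y. s * dirderiv b f (s *\<^sub>R (y - x))) y = s * dirderiv b (\<lambda>y. dirderiv b f (s *\<^sub>R (y - x))) y"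
      by (rule dirderiv_eqI[where f' = "\<lambda>v. s * dirderiv v (\<lambda>y. dirderiv b f (s *\<^sub>R (y - x))) y"])
         (intro has_derivative_mult_right test_function_has_derivative[OF t'(1)])
    then show ?thesis unfolding test_function_affine(2)[OF f s] t'(2) by (simp add: power2_eq_square)
  qed
  then show ?thesis unfolding laplacian_def by (simp add: sum_distrib_left)
qed

text \<open>The \<open>s\<close>-derivative of \<open>s\<^sup>d bump(s(y - x))\<close> is a Laplacian in \<open>y\<close>, so that the averages of a
  harmonic function against these kernels do not depend on \<open>s\<close>.\<close>

lemma scaled_bump_deriv:
  fixes z :: "'a::euclidean_space"
  shows "((\<lambda>s. s ^ DIM('a) * bump 2 (s *\<^sub>R z)) has_real_derivative
    - (s ^ (DIM('a) - 1) * laplacian (bump 0) (s *\<^sub>R z) / 2)) (at s)"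
proof -
  have d: "(bump 2 has_derivative (\<lambda>v. dirderiv v (bump 2) y)) (at y)" for y :: 'a
    by (rule test_function_has_derivative[OF bump_test_function])
  have "((\<lambda>s. s *\<^sub>R z) has_derivative (\<lambda>h. h *\<^sub>R z)) (at s)" by (auto intro!: derivative_eq_intros)
  from has_derivative_compose[OF this d]
  have "((\<lambda>s. bump 2 (s *\<^sub>R z)) has_derivative (\<lambda>h. dirderiv (h *\<^sub>R z) (bump 2) (s *\<^sub>R z))) (at s)" .
  moreover have sc: "dirderiv (h *\<^sub>R z) (bump 2) y = h * dirderiv z (bump 2) y" for h y
    using linear_cmul[OF has_derivative_linear[OF d]] by simp
  ultimately have "((\<lambda>s. bump 2 (s *\<^sub>R z)) has_real_derivative dirderiv z (bump 2) (s *\<^sub>R z)) (at s)"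
    by (simp add: has_field_derivative_def mult_commute_abs)
  from DERIV_mult[OF DERIV_pow[of "DIM('a)" s] this]
  have D: "((\<lambda>s. s ^ DIM('a) * bump 2 (s *\<^sub>R z)) has_real_derivative
    real DIM('a) * s ^ (DIM('a) - 1) * bump 2 (s *\<^sub>R z) + dirderiv z (bump 2) (s *\<^sub>R z) * s ^ DIM('a)) (at s)"
    by simp
  have e: "s ^ DIM('a) = s ^ (DIM('a) - 1) * s"
    using DIM_positive[where 'a = 'a] by (metis Suc_diff_1 mult.commute power_Suc)
  show ?thesis by (rule DERIV_cong[OF D]) (simp add: bump_laplacian sc e field_simps)
qed

section \<open>Averages of square integrable harmonic functions at varying scales\<close>

lemma sq_int_integrable_on_compact:
  fixes u :: "'a::euclidean_space \<Rightarrow> real"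
  assumes "sq_int u" "compact K" shows "integrable lborel (\<lambda>x. u x * indicator K x)"
proof -
  have i: "integrable lborel (indicat_real K)"
    using borel_integrable_compact[OF assms(2) continuous_on_const[of _ "1::real"]] by simp
  have "(\<lambda>x. (indicat_real K x)\<^sup>2) = indicat_real K" by (auto simp: indicator_def)
  then have "sq_int (indicat_real K)" unfolding sq_int_def using i borel_measurable_integrable[OF i] by simp
  then show ?thesis by (rule sq_int_mult[OF assms(1)])
qed

lemma integrable_test_function:
  fixes \<psi> :: "'a::euclidean_space \<Rightarrow> real"
  assumes \<psi>: "test_function \<Omega> \<psi>" shows "integrable lborel \<psi>"
proof -
  obtain K where K: "compact K" "\<And>x. x \<notin> K \<Longrightarrow> \<psi> x = 0" using test_functionD[OF \<psi>] by metis
  have "\<psi> x * indicator K x = \<psi> x" for x using K(2)[of x] by (cases "x \<in> K") auto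
  then have "(\<lambda>x. \<psi> x * indicator K x) = \<psi>" by (intro ext)
  then show ?thesis using sq_int_integrable_on_compact[OF sq_int_test_function[OF \<psi>] K(1)] by argo
qed

text \<open>Differentiation under the integral, carried out on sequences of difference quotients so
  that dominated convergence applies; the limit integrand pairs \<open>u\<close> with a Laplacian of
  a test function.\<close>

lemma harmonic_average_deriv:
  fixes u :: "'a::euclidean_space \<Rightarrow> real"
  assumes u: "sq_int u" and h: "\<And>\<eta>. test_function UNIV \<eta> \<Longrightarrow> (LINT y|lborel. u y * laplacian \<eta> y) = 0"
    and s: "s > 0"
  shows "((\<lambda>s. LINT y|lborel. u y * (s ^ DIM('a) * bump 2 (s *\<^sub>R (y - x)))) has_real_derivative 0) (at s)"
proof -
  let ?K = "\<lambda>s y. s ^ DIM('a) * bump 2 (s *\<^sub>R (y - x))"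
  let ?D = "\<lambda>s y. - (s ^ (DIM('a) - 1) * laplacian (bump 0) (s *\<^sub>R (y - x)) / 2)"
  have tL: "test_function UNIV (laplacian (bump 0) :: 'a \<Rightarrow> real)" by (rule test_function_laplacian[OF bump_test_function])
  obtain B where B: "B > 0" "\<And>y::'a. \<bar>laplacian (bump 0) y\<bar> \<le> B" using test_function_bounded[OF tL] by metis
  \<comment> \<open>Harmonicity enters only here: up to a power of \<open>s\<close>, the kernel
    \<open>?D s\<close> is the Laplacian of the scaled and translated \<open>bump 0\<close>.\<close>
  have D0: "(LINT y|lborel. u y * ?D s y) = 0"
  proof -
    have "(LINT y|lborel. u y * laplacian (\<lambda>y. bump 0 (s *\<^sub>R (y - x))) y) = 0"
      by (rule h[OF test_function_affine(1)[OF bump_test_function]]) (use s in simp)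
    then have "(LINT y|lborel. s\<^sup>2 * (u y * laplacian (bump 0) (s *\<^sub>R (y - x)))) = 0"
      using s by (simp add: laplacian_affine[OF bump_test_function] ac_simps)
    then have "(LINT y|lborel. u y * laplacian (bump 0) (s *\<^sub>R (y - x))) = 0" using s by simp
    moreover have "(\<lambda>y. u y * ?D s y) = (\<lambda>y. (- (s ^ (DIM('a) - 1)) / 2) * (u y * laplacian (bump 0) (s *\<^sub>R (y - x))))"
      by (auto simp: algebra_simps)
    ultimately show ?thesis by simp
  qed
  have Ki: "integrable lborel (\<lambda>y. u y * ?K r y)" if "r > 0" for r
    by (intro sq_int_mult u sq_int_cmult sq_int_test_function[OF test_function_affine(1)[OF bump_test_function]])
       (use that in simp)
  \<comment> \<open>The kernel at scale \<open>r\<close> lives in the ball of radius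
    \<open>1/r\<close> around \<open>x\<close>, so one ball of radius \<open>2/s\<close> serves all
    \<open>r > s/2\<close>.\<close>
  have Kout: "?K r y = 0" if "r > s / 2" "norm (y - x) > 2 / s" for r y
  proof -
    have "1 = (s/2) * (2/s)" using s by simp
    also have "\<dots> \<le> r * norm (y - x)" using that s by (intro mult_mono) auto
    finally show ?thesis using that s bump_outside[of "r *\<^sub>R (y - x)" 2] by simp
  qed
  show ?thesis
    unfolding DERIV_def tendsto_at_iff_sequentially
  proof (intro allI impI)
    fix X :: "nat \<Rightarrow> real" assume X: "\<forall>i. X i \<in> UNIV - {0}" "X \<longlonglongrightarrow> 0"
    have "eventually (\<lambda>n. \<bar>X n\<bar> < s / 2) sequentially"
      using order_tendstoD[OF tendsto_rabs[OF X(2)], of "s/2"] s by simp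
    then obtain n0 where n0: "\<And>n. n \<ge> n0 \<Longrightarrow> \<bar>X n\<bar> < s / 2" unfolding eventually_sequentially by blast
    \<comment> \<open>Dropping finitely many terms keeps every scale \<open>s + Y n\<close> above
      \<open>s/2\<close> and below \<open>2 * s\<close>, as the uniform bounds require.\<close>
    define Y where "Y n = X (n + n0)" for n
    have "Y \<longlonglongrightarrow> 0"
      unfolding Y_def[abs_def] by (rule LIMSEQ_ignore_initial_segment[OF X(2)])
    moreover have "\<bar>Y n\<bar> < s / 2" "Y n \<noteq> 0" for n
      using X(1) n0[of "n + n0"] by (simp_all add: Y_def)
    ultimately have Y: "Y \<longlonglongrightarrow> 0" "\<And>n. \<bar>Y n\<bar> < s / 2" "\<And>n. Y n \<noteq> 0" by blast+
    let ?Q = "\<lambda>n y. (?K (s + Y n) y - ?K s y) / Y n"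
    let ?C = "cball x (2 / s)"
    \<comment> \<open>A bound for \<open>?D r\<close> at all scales up to \<open>2 * s\<close>; the
      mean value theorem turns it into a bound for the difference quotients.\<close>
    let ?M = "(2 * s) ^ (DIM('a) - 1) * B"
    have lim: "(\<lambda>n. LINT y|lborel. u y * ?Q n y) \<longlonglongrightarrow> (LINT y|lborel. u y * ?D s y)"
    proof (rule integral_dominated_convergence[where w = "\<lambda>y. \<bar>u y * indicator ?C y\<bar> * ?M"])
      show "integrable lborel (\<lambda>y. \<bar>u y * indicator ?C y\<bar> * ?M)"
        by (intro integrable_mult_left integrable_abs sq_int_integrable_on_compact u compact_cball)
      have [measurable]: "(\<lambda>y. bump 2 (r *\<^sub>R (y - x))) \<in> borel_measurable borel"
        "(\<lambda>y. laplacian (bump 0) (r *\<^sub>R (y - x))) \<in> borel_measurable borel" if "r > 0" for r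
        by (rule test_function_borel, rule test_function_affine(1), rule bump_test_function tL, use that in simp)+
      have sY: "s + Y n > s / 2" for n using Y(2)[of n] by linarith
      then have sY': "s + Y n > 0" for n using s by (smt (verit) half_gt_zero)
      show "(\<lambda>y. u y * ?Q n y) \<in> borel_measurable lborel" for n
        using sY'[of n] s sq_int_borel[OF u] by measurable
      show "(\<lambda>y. u y * ?D s y) \<in> borel_measurable lborel"
        using s sq_int_borel[OF u] by measurable
      show "AE y in lborel. (\<lambda>n. u y * ?Q n y) \<longlonglongrightarrow> u y * ?D s y"
      proof (rule AE_I2, intro tendsto_mult tendsto_const)
        fix y
        have "((\<lambda>h. (?K (s + h) y - ?K s y) / h) \<longlongrightarrow> ?D s y) (at 0)"
          using scaled_bump_deriv[of "y - x" s] unfolding DERIV_def .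
        then show "(\<lambda>n. ?Q n y) \<longlonglongrightarrow> ?D s y"
          unfolding tendsto_at_iff_sequentially using Y by (auto simp: o_def dest!: spec[of _ Y])
      qed
      show "AE y in lborel. norm (u y * ?Q n y) \<le> \<bar>u y * indicator ?C y\<bar> * ?M" for n
      proof (rule AE_I2)
        fix y
        show "norm (u y * ?Q n y) \<le> \<bar>u y * indicator ?C y\<bar> * ?M"
        proof (cases "y \<in> ?C")
          case False
          then have far: "norm (y - x) > 2 / s" by (simp add: dist_norm norm_minus_commute)
          then have "?Q n y = 0" using Kout[OF sY far] Kout[OF _ far, of s] s by simp
          then show ?thesis using False by simp
        next
          case True
          have der: "((\<lambda>s. ?K s y) has_real_derivative ?D r y) (at r)" for r by (rule scaled_bump_deriv)
          have Db: "\<bar>?D r y\<bar> \<le> ?M" if "0 \<le> r" "r \<le> 2 * s" for r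
          proof -
            have "\<bar>?D r y\<bar> = r ^ (DIM('a) - 1) * (\<bar>laplacian (bump 0) (r *\<^sub>R (y - x))\<bar> / 2)"
              using that by (simp add: abs_mult)
            also have "\<dots> \<le> (2 * s) ^ (DIM('a) - 1) * B"
              using B(2)[of "r *\<^sub>R (y - x)"] B(1) that by (intro mult_mono power_mono) auto
            finally show ?thesis .
          qed
          have "\<bar>?K (s + Y n) y - ?K s y\<bar> \<le> ?M * \<bar>Y n\<bar>"
          proof (cases "Y n > 0")
            case True
            then obtain r where "s < r" "r < s + Y n" "?K (s + Y n) y - ?K s y = (s + Y n - s) * ?D r y"
              using MVT2[of s "s + Y n" "\<lambda>s. ?K s y" "\<lambda>r. ?D r y"] der by force
            then show ?thesis using Db[of r] s Y(2)[of n] True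
              by (simp add: abs_mult mult.commute[of _ "Y n"] mult_left_mono)
          next
            case False
            then have "Y n < 0" using Y(3)[of n] by simp
            then obtain r where r: "s + Y n < r" "r < s" "?K s y - ?K (s + Y n) y = (s - (s + Y n)) * ?D r y"
              using MVT2[of "s + Y n" s "\<lambda>s. ?K s y" "\<lambda>r. ?D r y"] der by force
            have "\<bar>?K (s + Y n) y - ?K s y\<bar> = \<bar>?K s y - ?K (s + Y n) y\<bar>" by (rule abs_minus_commute)
            also have "\<dots> = \<bar>Y n\<bar> * \<bar>?D r y\<bar>" unfolding r(3) by (simp add: abs_mult)
            also have "\<dots> \<le> \<bar>Y n\<bar> * ?M" using r sY'[of n] s by (intro mult_left_mono Db) auto
            finally show ?thesis by (simp add: mult.commute)
          qed
          then have Q: "\<bar>?Q n y\<bar> \<le> ?M" using Y(3)[of n] by (simp add: field_simps)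
          have "norm (u y * ?Q n y) = \<bar>u y\<bar> * \<bar>?Q n y\<bar>" by (simp only: real_norm_def abs_mult)
          also have "\<dots> \<le> \<bar>u y\<bar> * ?M" by (rule mult_left_mono[OF Q abs_ge_zero])
          also have "\<dots> = \<bar>u y * indicator ?C y\<bar> * ?M" using True by simp
          finally show ?thesis .
        qed
      qed
    qed
    have Qeq: "(LINT y|lborel. u y * ?Q n y)
        = ((LINT y|lborel. u y * ?K (s + Y n) y) - (LINT y|lborel. u y * ?K s y)) / Y n" for n
    proof -
      have "s + Y n > 0" using Y(2)[of n] s by linarith
      have "(\<lambda>y. u y * ?Q n y) = (\<lambda>y. (u y * ?K (s + Y n) y - u y * ?K s y) / Y n)"
        by (auto simp: algebra_simps diff_divide_distrib)
      then show ?thesis using Ki[OF \<open>s + Y n > 0\<close>] Ki[OF s] by simp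
    qed
    have "(\<lambda>n. ((LINT y|lborel. u y * ?K (s + Y n) y) - (LINT y|lborel. u y * ?K s y)) / Y n) \<longlonglongrightarrow> 0"
      using lim by (simp only: Qeq D0)
    then have "(\<lambda>n. ((\<lambda>h. ((LINT y|lborel. u y * ?K (s + h) y) - (LINT y|lborel. u y * ?K s y)) / h) \<circ> X) (n + n0)) \<longlonglongrightarrow> 0"
      by (simp add: o_def Y_def)
    then show "((\<lambda>h. ((LINT y|lborel. u y * ?K (s + h) y) - (LINT y|lborel. u y * ?K s y)) / h) \<circ> X) \<longlonglongrightarrow> 0"
      by (rule LIMSEQ_offset)
  qed
qed

lemma harmonic_average_zero:
  fixes u :: "'a::euclidean_space \<Rightarrow> real"
  assumes u: "sq_int u" and h: "\<And>\<eta>. test_function UNIV \<eta> \<Longrightarrow> (LINT y|lborel. u y * laplacian \<eta> y) = 0"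
    and s: "s > 0"
  shows "(LINT y|lborel. u y * bump 2 (s *\<^sub>R (y - x))) = 0"
proof -
  let ?d = "DIM('a)"
  define \<Psi> where "\<Psi> s = (LINT y|lborel. u y * (s ^ ?d * bump 2 (s *\<^sub>R (y - x))))" for s
  have "(\<Psi> has_real_derivative 0) (at r within {0<..})" if "r \<in> {0<..}" for r
    unfolding \<Psi>_def using harmonic_average_deriv[OF u h, of r x] that by (auto intro: has_field_derivative_at_within)
  then obtain c where c: "\<And>r. r > 0 \<Longrightarrow> \<Psi> r = c"
    using has_field_derivative_zero_constant[of "{0<..}" \<Psi>] by auto
  \<comment> \<open>The squared norm of the kernel is \<open>r ^ d\<close> times that of
    \<open>bump 2\<close>: the prefactor contributes \<open>r ^ (2 d)\<close> and the change of
    variables takes away \<open>r ^ d\<close>. The dimension is positive, so this tends to zero with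
    \<open>r\<close>.\<close>
  have bound: "\<bar>c\<bar> \<le> sqrt (sqn u) * sqrt (r ^ ?d * sqn (bump 2 :: 'a \<Rightarrow> real))" if r: "r > 0" for r
  proof -
    have t: "test_function UNIV (\<lambda>y. bump 2 (r *\<^sub>R (y - x)))"
      by (rule test_function_affine(1)[OF bump_test_function]) (use r in simp)
    have "sqn (bump 2 :: 'a \<Rightarrow> real) = r ^ ?d * (LINT y|lborel. (bump 2 (- (r *\<^sub>R x) + r *\<^sub>R y))\<^sup>2)"
      unfolding sqn_def using r
      by (subst lborel_integral_affine[OF borel_measurable_power[OF test_function_borel[OF bump_test_function]],
            where c = r and t = "- (r *\<^sub>R x)"]) auto
    then have "r ^ ?d * sqn (\<lambda>y. bump 2 (r *\<^sub>R (y - x))) = sqn (bump 2 :: 'a \<Rightarrow> real)"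
      by (simp add: sqn_def algebra_simps)
    moreover have "sqn (\<lambda>y. r ^ ?d * bump 2 (r *\<^sub>R (y - x))) = (r ^ ?d)\<^sup>2 * sqn (\<lambda>y. bump 2 (r *\<^sub>R (y - x)))"
      by (simp add: sqn_def power_mult_distrib)
    ultimately have "sqn (\<lambda>y. r ^ ?d * bump 2 (r *\<^sub>R (y - x))) = r ^ ?d * sqn (bump 2 :: 'a \<Rightarrow> real)"
      by (simp add: power2_eq_square)
    then show ?thesis
      using Cauchy_Schwarz_integral[OF u sq_int_cmult[OF sq_int_test_function[OF t], of "r ^ ?d"]] c[OF r]
      unfolding \<Psi>_def by simp
  qed
  have "((\<lambda>r. sqrt (sqn u) * sqrt (r ^ ?d * sqn (bump 2 :: 'a \<Rightarrow> real))) \<longlongrightarrow>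
      sqrt (sqn u) * sqrt (0 ^ ?d * sqn (bump 2 :: 'a \<Rightarrow> real))) (at_right 0)"
    by (intro tendsto_intros)
  then have "\<bar>c\<bar> \<le> sqrt (sqn u) * sqrt (0 ^ ?d * sqn (bump 2 :: 'a \<Rightarrow> real))"
    by (rule tendsto_lowerbound) (use bound in \<open>auto simp: eventually_at_right_field intro!: exI[of _ 1]\<close>)
  then have "c = 0" by (simp add: zero_power)
  then have "\<Psi> s = 0" using c[OF s] by simp
  moreover have "\<Psi> s = s ^ ?d * (LINT y|lborel. u y * bump 2 (s *\<^sub>R (y - x)))"
    unfolding \<Psi>_def by (subst integral_mult_right_zero[symmetric]) (simp add: ac_simps)
  ultimately show ?thesis using s by simp
qed

lemma bump_mass: "(LINT y|lborel. bump 2 (y::'a::euclidean_space)) > 0"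
proof -
  have i: "integrable lborel (bump 2 :: 'a \<Rightarrow> real)" by (rule integrable_test_function[OF bump_test_function])
  have "(LINT y|lborel. bump 2 (y::'a)) \<noteq> 0"
  proof
    assume "(LINT y|lborel. bump 2 (y::'a)) = 0"
    then have "AE y in lborel. bump 2 (y::'a) = 0"
      using integral_nonneg_eq_0_iff_AE[OF i] bump_nonneg by auto
    moreover have "bump 2 y > 0" if "y \<in> ball (0::'a) 1" for y
    proof -
      have "(norm y)\<^sup>2 < 1" using that by (simp add: abs_square_less_1)
      then show ?thesis by (simp add: bump_def flat_pos dot_square_norm)
    qed
    ultimately have "AE y in lborel. y \<notin> ball (0::'a) 1" by (metis (mono_tags, lifting) eventually_mono less_irrefl)
    then have "ball (0::'a) 1 \<in> null_sets lborel" using AE_iff_null_sets[of "ball (0::'a) 1" lborel] by simp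
    then have "negligible (ball (0::'a) 1)" by (metis negligible_iff_null_sets null_sets_completionI)
    then show False using open_not_negligible[of "ball (0::'a) 1"] by simp
  qed
  then show ?thesis by (simp add: less_le bump_nonneg)
qed

text \<open>All averages of \<open>u\<close> vanish, so by Fubini \<open>u\<close> is orthogonal to
  every mollification of \<open>\<psi>\<close>. These mollifications \<open>W n\<close> converge
  boundedly, with supports in one ball, to \<open>\<psi>\<close> times the mass of the kernel.
  Smoothing \<open>\<psi>\<close> rather than \<open>u\<close> keeps the limit elementary.\<close>

lemma harmonic_test_zero:
  fixes u :: "'a::euclidean_space \<Rightarrow> real"
  assumes u: "sq_int u" and h: "\<And>\<eta>. test_function UNIV \<eta> \<Longrightarrow> (LINT y|lborel. u y * laplacian \<eta> y) = 0"
    and \<psi>: "test_function UNIV \<psi>"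
  shows "(LINT y|lborel. u y * \<psi> y) = 0"
proof -
  obtain K where K: "compact K" "\<And>x. x \<notin> K \<Longrightarrow> \<psi> x = 0" using test_functionD[OF \<psi>] by metis
  obtain R where R: "R > 0" "\<And>x. x \<in> K \<Longrightarrow> norm x \<le> R"
    using compact_imp_bounded[OF K(1)] unfolding bounded_pos by blast
  obtain B where B: "B > 0" "\<And>x. \<bar>\<psi> x\<bar> \<le> B" using test_function_bounded[OF \<psi>] by metis
  let ?k = "bump 2 :: 'a \<Rightarrow> real"
  obtain C where C: "C > 0" "\<And>x. \<bar>?k x\<bar> \<le> C" using test_function_bounded[OF bump_test_function] by metis
  have [measurable]: "u \<in> borel_measurable borel" "\<psi> \<in> borel_measurable borel" "?k \<in> borel_measurable borel"
    using sq_int_borel[OF u] test_function_borel[OF \<psi>] test_function_borel[OF bump_test_function] by auto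
  have i\<psi>: "integrable lborel \<psi>" and ik: "integrable lborel ?k"
    by (rule integrable_test_function, rule \<psi> bump_test_function)+
  define W where "W n y = (LINT \<xi>|lborel. \<psi> (y + (- (1 / real (Suc n))) *\<^sub>R \<xi>) * ?k \<xi>)" for n y
  let ?C = "cball (0::'a) (R + 1)"
  have iu: "integrable lborel (\<lambda>y. u y * indicator ?C y)" by (rule sq_int_integrable_on_compact[OF u compact_cball])
  have W0: "(LINT y|lborel. u y * W n y) = 0" for n
  proof -
    define s where "s = real (Suc n)"
    have s: "s \<ge> 1" by (simp add: s_def)
    \<comment> \<open>The substitution \<open>x = y - \<xi> / s\<close> rewrites the mollification
      as an integral against the kernel centred at \<open>x\<close>, the form in which the averages
      are known.\<close>
    have Weq: "(1 / s) ^ DIM('a) * W n y = (LINT x|lborel. \<psi> x * ?k (s *\<^sub>R (y - x)))" for y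
    proof -
      have "(LINT x|lborel. \<psi> x * ?k (s *\<^sub>R (y - x))) =
        \<bar>- (1 / s)\<bar> ^ DIM('a) * (LINT \<xi>|lborel. \<psi> (y + (- (1 / s)) *\<^sub>R \<xi>) * ?k (s *\<^sub>R (y - (y + (- (1 / s)) *\<^sub>R \<xi>))))"
        by (rule lborel_integral_affine) (use s in \<open>auto\<close>)
      then show ?thesis using s by (simp add: W_def s_def)
    qed
    let ?h = "\<lambda>p::'a \<times> 'a. (\<psi> (fst p) * (u (snd p) * indicator ?C (snd p))) * ?k (s *\<^sub>R (snd p - fst p))"
    have ih: "integrable lborel ?h"
    proof (rule integrable_mult_bnd_borel)
      show "integrable lborel (\<lambda>p::'a \<times> 'a. \<psi> (fst p) * (u (snd p) * indicator ?C (snd p)))"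
        using integrable_tensor[OF i\<psi> iu] by (simp add: lborel_prod)
      show "bnd_borel (\<lambda>p::'a \<times> 'a. ?k (s *\<^sub>R (snd p - fst p)))"
        using C(2) by (intro bnd_borelI[of _ C]) (auto simp: borel_prod[symmetric])
    qed
    have ih': "integrable (lborel \<Otimes>\<^sub>M lborel) (\<lambda>(x, y). ?h (x, y))" using ih by (simp add: lborel_prod case_prod_beta')
    \<comment> \<open>The cut-off to the ball of radius \<open>R + 1\<close> was inserted only to
      have an integrable factor for Fubini. It changes nothing, because \<open>\<psi>\<close> lives
      in the ball of radius \<open>R\<close> and the kernel in distance at most 1.\<close>
    have kill: "\<psi> x * (u y * indicator ?C y) * ?k (s *\<^sub>R (y - x)) = \<psi> x * (u y * ?k (s *\<^sub>R (y - x)))" for x y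
    proof (cases "x \<in> K \<and> y \<notin> ?C")
      case True
      then have "1 \<le> norm (y - x)" using R(2)[of x] norm_triangle_ineq2[of y x] by simp
      then have "1 \<le> norm (s *\<^sub>R (y - x))" using s mult_mono[of 1 s 1 "norm (y - x)"] by simp
      then show ?thesis by (simp add: bump_outside)
    qed (use K(2)[of x] in auto)
    have "(LINT y|lborel. LINT x|lborel. ?h (x, y)) = (LINT x|lborel. LINT y|lborel. ?h (x, y))"
      using lborel_pair.Fubini_integral[OF ih'] .
    also have "\<dots> = (LINT x|lborel. \<psi> x * (LINT y|lborel. u y * ?k (s *\<^sub>R (y - x))))"
      by (simp only: kill fst_conv snd_conv integral_mult_right_zero)
    also have "\<dots> = 0" using harmonic_average_zero[OF u h, of s] s by simp
    finally have "(LINT y|lborel. LINT x|lborel. \<psi> x * (u y * ?k (s *\<^sub>R (y - x)))) = 0"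
      by (simp only: kill fst_conv snd_conv)
    moreover have "(LINT x|lborel. \<psi> x * (u y * ?k (s *\<^sub>R (y - x)))) = (1 / s) ^ DIM('a) * (u y * W n y)" for y
    proof -
      have "(LINT x|lborel. \<psi> x * (u y * ?k (s *\<^sub>R (y - x)))) = (LINT x|lborel. u y * (\<psi> x * ?k (s *\<^sub>R (y - x))))"
        by (simp add: ac_simps)
      then show ?thesis using Weq[of y] by simp
    qed
    ultimately show ?thesis using s by simp
  qed
  have cont: "isCont \<psi> x" for x
    using test_function_continuous[OF \<psi>] continuous_on_eq_continuous_at open_UNIV by blast
  have Wlim: "(\<lambda>n. W n y) \<longlonglongrightarrow> \<psi> y * (LINT \<xi>|lborel. ?k \<xi>)" for y
  proof -
    have "(\<lambda>n. W n y) \<longlonglongrightarrow> (LINT \<xi>|lborel. \<psi> y * ?k \<xi>)" unfolding W_def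
    proof (rule integral_dominated_convergence[where w = "\<lambda>\<xi>. B * ?k \<xi>"])
      show "AE \<xi> in lborel. (\<lambda>n. \<psi> (y + - (1 / real (Suc n)) *\<^sub>R \<xi>) * ?k \<xi>) \<longlonglongrightarrow> \<psi> y * ?k \<xi>"
      proof (rule AE_I2, intro tendsto_intros isCont_tendsto_compose[OF cont])
        fix \<xi> :: 'a
        have "(\<lambda>n. y + - (1 / real (Suc n)) *\<^sub>R \<xi>) \<longlonglongrightarrow> y + - 0 *\<^sub>R \<xi>"
          by (intro tendsto_intros LIMSEQ_Suc[OF lim_1_over_n])
        then show "(\<lambda>n. y + - (1 / real (Suc n)) *\<^sub>R \<xi>) \<longlonglongrightarrow> y" by simp
      qed
      show "AE \<xi> in lborel. norm (\<psi> (y + - (1 / real (Suc n)) *\<^sub>R \<xi>) * ?k \<xi>) \<le> B * ?k \<xi>" for n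
        using B(2) by (auto simp: abs_mult bump_nonneg intro!: mult_right_mono)
    qed (use ik in auto)
    then show ?thesis by simp
  qed
  have Wb: "\<bar>W n y\<bar> \<le> B * (LINT \<xi>|lborel. ?k \<xi>) * indicator ?C y" for n y
  proof (cases "y \<in> ?C")
    case True
    have "\<bar>W n y\<bar> \<le> (LINT \<xi>|lborel. \<bar>\<psi> (y + (- (1 / real (Suc n))) *\<^sub>R \<xi>) * ?k \<xi>\<bar>)"
      unfolding W_def by (rule integral_abs_bound)
    also have "\<dots> \<le> (LINT \<xi>|lborel. B * ?k \<xi>)"
      by (rule integral_mono') (use ik B in \<open>auto simp: abs_mult bump_nonneg intro!: mult_right_mono\<close>)
    finally show ?thesis using True by simp
  next
    case False
    have "\<psi> (y + (- (1 / real (Suc n))) *\<^sub>R \<xi>) * ?k \<xi> = 0" for \<xi>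
    proof (cases "norm \<xi> \<ge> 1")
      case True then show ?thesis by (simp add: bump_outside)
    next
      case F: False
      have "norm ((1 / real (Suc n)) *\<^sub>R \<xi>) \<le> norm \<xi>" 
        using mult_left_mono[of 1 "1 + real n" "norm \<xi>"] by (simp add: divide_le_eq)
      then have "norm (y + (- (1 / real (Suc n))) *\<^sub>R \<xi>) > R"
        using False F norm_triangle_ineq2[of y "(1 / real (Suc n)) *\<^sub>R \<xi>"] by simp
      then show ?thesis using R(2) K(2) by fastforce
    qed
    then have e: "(\<lambda>\<xi>. \<psi> (y + (- (1 / real (Suc n))) *\<^sub>R \<xi>) * ?k \<xi>) = (\<lambda>\<xi>. 0)" by (intro ext)
    show ?thesis unfolding W_def e using False by simp
  qed
  have Wm: "W n \<in> borel_measurable borel" for n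
  proof -
    have "(\<lambda>(y, \<xi>). \<psi> (y + (- (1 / real (Suc n))) *\<^sub>R \<xi>) * ?k \<xi>) \<in> borel_measurable (borel \<Otimes>\<^sub>M lborel)" by measurable
    then show ?thesis unfolding W_def by (rule lborel.borel_measurable_lebesgue_integral)
  qed
  have "(\<lambda>n. LINT y|lborel. u y * W n y) \<longlonglongrightarrow> (LINT y|lborel. u y * (\<psi> y * (LINT \<xi>|lborel. ?k \<xi>)))"
  proof (rule integral_dominated_convergence[where w = "\<lambda>y. \<bar>u y * indicator ?C y\<bar> * (B * (LINT \<xi>|lborel. ?k \<xi>))"])
    show "AE y in lborel. norm (u y * W n y) \<le> \<bar>u y * indicator ?C y\<bar> * (B * (LINT \<xi>|lborel. ?k \<xi>))" for n
    proof (rule AE_I2)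
      fix y
      have "\<bar>u y\<bar> * \<bar>W n y\<bar> \<le> \<bar>u y\<bar> * (B * (LINT \<xi>|lborel. ?k \<xi>) * indicator ?C y)" by (intro mult_left_mono Wb) simp
      then show "norm (u y * W n y) \<le> \<bar>u y * indicator ?C y\<bar> * (B * (LINT \<xi>|lborel. ?k \<xi>))"
        by (simp add: abs_mult ac_simps)
    qed
    show "AE y in lborel. (\<lambda>n. u y * W n y) \<longlonglongrightarrow> u y * (\<psi> y * (LINT \<xi>|lborel. ?k \<xi>))"
      by (intro AE_I2 tendsto_intros Wlim)
  qed (use Wm iu in auto)
  then have "(LINT y|lborel. u y * (\<psi> y * (LINT \<xi>|lborel. ?k \<xi>))) = 0" unfolding W0 by (simp add: LIMSEQ_const_iff)
  moreover have "(LINT y|lborel. u y * (\<psi> y * (LINT \<xi>|lborel. ?k \<xi>))) = (LINT y|lborel. u y * \<psi> y) * (LINT \<xi>|lborel. ?k \<xi>)"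
    by (subst integral_mult_left_zero[symmetric]) (simp add: ac_simps)
  ultimately show ?thesis using bump_mass[where 'a = 'a] by simp
qed

lemma sq_int_vanishes:
  fixes u :: "'a::euclidean_space \<Rightarrow> real"
  assumes u: "sq_int u" and 0: "\<And>\<psi>. test_function UNIV \<psi> \<Longrightarrow> (LINT y|lborel. u y * \<psi> y) = 0"
  shows "AE x in lborel. u x = 0"
proof -
  have "AE x in lborel. x \<in> box (- real n *\<^sub>R One) (real n *\<^sub>R One) \<longrightarrow> u x = 0" for n
  proof (rule integrable_vanishes_on_box)
    let ?B = "box (- real n *\<^sub>R One) (real n *\<^sub>R One) :: 'a set"
    have "integrable lborel (\<lambda>x. u x * indicator (cbox (- real n *\<^sub>R One) (real n *\<^sub>R One)) x)"
      by (rule sq_int_integrable_on_compact[OF u compact_cbox])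
    from integrable_mult_indicator_real[OF this, of ?B]
    have "integrable lborel (\<lambda>x. u x * indicator (cbox (- real n *\<^sub>R One) (real n *\<^sub>R One)) x * indicator ?B x)" by simp
    moreover have "(\<lambda>x. u x * indicator (cbox (- real n *\<^sub>R One) (real n *\<^sub>R One)) x * indicator ?B x) = (\<lambda>x. u x * indicator ?B x)"
      using box_subset_cbox[of "- real n *\<^sub>R One :: 'a" "real n *\<^sub>R One"] by (auto simp: indicator_def fun_eq_iff)
    ultimately show "integrable lborel (\<lambda>x. u x * indicator ?B x)" by argo
  qed (use 0 test_function_mono in blast)
  then have "AE x in lborel. \<forall>n. x \<in> box (- real n *\<^sub>R One) (real n *\<^sub>R One) \<longrightarrow> u x = 0"
    by (subst AE_all_countable) blast
  then show ?thesis
  proof eventually_elim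
    case (elim x)
    obtain n where n: "norm x < real n" using reals_Archimedean2 by blast
    have "x \<in> box (- real n *\<^sub>R One) (real n *\<^sub>R One)"
      unfolding mem_box
    proof
      fix i :: 'a assume i: "i \<in> Basis"
      have "One \<bullet> i = 1" using i by (simp add: inner_sum_left inner_Basis)
      then show "(- real n *\<^sub>R One) \<bullet> i < x \<bullet> i \<and> x \<bullet> i < (real n *\<^sub>R One) \<bullet> i"
        using Basis_le_norm[OF i, of x] n by (simp add: abs_le_iff)
    qed
    then show ?case using elim by blast
  qed
qed

theorem Liouville_L2:
  assumes "sq_int u" "\<And>\<eta>. test_function UNIV \<eta> \<Longrightarrow> (LINT y|lborel. u y * laplacian \<eta> y) = 0"
  shows "AE x in lborel. u x = 0"
  by (rule sq_int_vanishes[OF assms(1) harmonic_test_zero[OF assms]])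

section \<open>The normal modes\<close>

lemma prim_cmult: "prim (\<lambda>z. a * q z) z = a * prim q z"
  unfolding prim_def by (simp add: mult.assoc)

lemma AE_lborel_negligible:
  fixes Q :: "'a::euclidean_space \<Rightarrow> bool"
  assumes "AE x in lborel. Q x" obtains N where "negligible N" "\<And>x. x \<notin> N \<Longrightarrow> Q x"
proof -
  obtain N where N: "{x \<in> space lborel. \<not> Q x} \<subseteq> N" "emeasure lborel N = 0" "N \<in> sets lborel"
    using AE_E[OF assms] by metis
  then have "N \<in> null_sets lborel" by auto
  then have "negligible N" by (metis negligible_iff_null_sets null_sets_completionI)
  then show ?thesis using that N by auto
qed

text \<open>A normalisation of the data of the Sturm-Liouville problem: \<open>R\<close> and \<open>Rp\<close> are bounded Borel
  versions of the density and its derivative, \<open>F n\<close> is the extension of the \<open>n\<close>-th mode by zero and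
  \<open>G n\<close> is the continuous version of \<open>\<rho>eq \<cdot> g_mode n\<close>.\<close>

locale mode_profile =
  fixes H grav :: real and c :: "nat \<Rightarrow> real" and R Rp :: "real \<Rightarrow> real"
    and A :: "nat \<Rightarrow> real" and F G :: "nat \<Rightarrow> real \<Rightarrow> real" and R0 m :: real
  assumes H_pos: "H > 0" and grav_pos: "grav > 0" and c_pos: "\<And>n. n \<ge> 1 \<Longrightarrow> c n > 0"
    and Rp_bb: "bnd_borel Rp" and Rp_outside: "\<And>z. z \<notin> {-H<..<0} \<Longrightarrow> Rp z = 0"
    and R_prim: "R = (\<lambda>z. R0 + prim Rp z)" and m_pos: "m > 0" and R_lower: "\<And>z. m \<le> R z"
    and F_bb: "\<And>n. n \<ge> 1 \<Longrightarrow> bnd_borel (F n)"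
    and F_prim: "\<And>n. n \<ge> 1 \<Longrightarrow> F n = prim (\<lambda>z. indicator {-H<..<0} z * (G n z / (c n * R z)))"
    and F_total: "\<And>n. n \<ge> 1 \<Longrightarrow> (LINT z|lborel. indicator {-H<..<0} z * (G n z / (c n * R z))) = 0"
    and G_prim: "\<And>n. n \<ge> 1 \<Longrightarrow> G n = (\<lambda>z. A n + prim (\<lambda>z. grav * Rp z * F n z / c n) z)"
    and G_0: "G 0 = (\<lambda>z. A 0)" and A_0: "A 0 \<noteq> 0"
    and F_orthonormal: "\<And>k n. k \<ge> 1 \<Longrightarrow> n \<ge> 1 \<Longrightarrow>
      (LINT z|lborel. F k z * F n z * (- grav * Rp z)) = (if k = n then 1 else 0)"
    and G_0_norm: "(A 0)\<^sup>2 * (LINT z|lborel. indicator {-H<..<0} z / R z) = 1"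
    and F_complete: "\<And>n. n \<ge> 1 \<Longrightarrow>
      (\<lambda>K. sqn (\<lambda>z. R z * F n z - (\<Sum>k=1..K. (LINT y|lborel. F k y * F n y * R y) * (- grav * Rp z * F k z)))) \<longlonglongrightarrow> 0"
begin

abbreviation I :: "real \<Rightarrow> real" where "I \<equiv> indicat_real {-H<..<0}"

lemma integrable_supported: "bnd_borel q \<Longrightarrow> (\<And>z. z \<notin> {-H<..<0} \<Longrightarrow> q z = 0) \<Longrightarrow> integrable lborel q"
proof -
  assume q: "bnd_borel q" "\<And>z. z \<notin> {-H<..<0} \<Longrightarrow> q z = 0"
  have "q z * I z = q z" for z using q(2)[of z] by (cases "z \<in> {-H<..<0}") auto
  then have "(\<lambda>z. q z * I z) = q" by (intro ext)
  then show ?thesis using integrable_bnd_borel_Ioo[OF q(1), of "-H" 0] by argo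
qed

lemma sq_int_supported: "bnd_borel q \<Longrightarrow> (\<And>z. z \<notin> {-H<..<0} \<Longrightarrow> q z = 0) \<Longrightarrow> sq_int q"
  unfolding sq_int_def power2_eq_square
  by (intro conjI bnd_borel_measurable integrable_supported bnd_borel_mult) auto

lemma Rp_integrable: "integrable lborel Rp"
  by (rule integrable_supported[OF Rp_bb Rp_outside])

lemma R_pos: "R z > 0"
  using R_lower[of z] m_pos by linarith

lemma R_bb: "bnd_borel R"
  unfolding R_prim by (intro bnd_borel_add bnd_borel_const bnd_borel_prim Rp_integrable)

lemma inverse_R_bb: "bnd_borel (\<lambda>z. 1 / R z)"
proof (rule bnd_borelI)
  show "(\<lambda>z. 1 / R z) \<in> borel_measurable borel" using bnd_borel_measurable[OF R_bb] by simp
  show "\<bar>1 / R z\<bar> \<le> 1 / m" for z using R_lower[of z] R_pos[of z] m_pos by (simp add: frac_le)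
qed

lemma divide_R_bb: "bnd_borel q \<Longrightarrow> bnd_borel (\<lambda>z. q z / R z)"
  using bnd_borel_mult[OF _ inverse_R_bb, of q] by simp

lemma F_outside: "n \<ge> 1 \<Longrightarrow> z \<notin> {-H<..<0} \<Longrightarrow> F n z = 0"
  using prim_left[of "-H" 0 "\<lambda>z. I z * (G n z / (c n * R z))" z] prim_right[of "-H" 0 "\<lambda>z. I z * (G n z / (c n * R z))" z]
    F_prim[of n] F_total[of n] by (cases "z \<le> -H") auto

lemma G'_bb: "n \<ge> 1 \<Longrightarrow> bnd_borel (\<lambda>z. grav * Rp z * F n z / c n)"
  using bnd_borel_cmult[OF bnd_borel_mult[OF Rp_bb F_bb], of n "grav / c n"] by (simp add: mult.assoc)

lemma G'_outside: "z \<notin> {-H<..<0} \<Longrightarrow> grav * Rp z * F n z / c n = 0"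
  using Rp_outside by simp

lemma G_bb: "bnd_borel (G n)"
proof (cases "n = 0")
  case True then show ?thesis by (simp add: G_0)
next
  case False
  then have "n \<ge> 1" by simp
  then show ?thesis unfolding G_prim[OF \<open>n \<ge> 1\<close>]
    by (intro bnd_borel_add bnd_borel_const bnd_borel_prim integrable_supported[OF G'_bb G'_outside])
qed

lemma I_bb: "bnd_borel I" by (rule bnd_borel_Ioo)

lemma F'_bb: "bnd_borel (\<lambda>z. I z * (G n z / (c n * R z)))"
  using bnd_borel_cmult[OF bnd_borel_mult[OF I_bb divide_R_bb[OF G_bb]], of "1 / c n"] by (simp add: mult.commute)

lemma F'_integrable: "integrable lborel (\<lambda>z. I z * (G n z / (c n * R z)))"
  by (rule integrable_supported[OF F'_bb]) simp

text \<open>The two families of profiles are dual to each other through \<open>G n = \<rho>eq c\<^sub>n f\<^sub>n'\<close>: integrating by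
  parts turns their inner products into those of the modes.\<close>

lemma G_orthonormal: "(LINT z|lborel. I z * G k z * G n z / R z) = (if k = n then 1 else 0)"
proof -
  have main: "(LINT z|lborel. I z * G k z * G n z / R z) = (if k = n then 1 else 0)" if n: "n \<ge> 1" for k n
  proof -
    \<comment> \<open>The derivative of \<open>G k\<close>; the zeroth profile is constant, which
      explains the separate case.\<close>
    define p where "p z = (if k = 0 then 0 else grav * Rp z * F k z / c k)" for z
    have p: "integrable lborel p" "\<And>z. z \<notin> {-H<..<0} \<Longrightarrow> p z = 0" "G k = (\<lambda>z. A k + prim p z)"
    proof -
      show "integrable lborel p"
      proof (cases "k = 0")
        case False
        then show ?thesis unfolding p_def using integrable_supported[OF G'_bb G'_outside, of k] by simp
      next
        case True
        then have "p = (\<lambda>z. 0)" by (simp add: p_def[abs_def])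
        then show ?thesis by simp
      qed
      show "\<And>z. z \<notin> {-H<..<0} \<Longrightarrow> p z = 0" using Rp_outside by (simp add: p_def)
      show "G k = (\<lambda>z. A k + prim p z)"
      proof (cases "k = 0")
        case True then show ?thesis by (simp add: G_0 p_def prim_def)
      next
        case False
        then show ?thesis unfolding p_def using G_prim[of k] by simp
      qed
    qed
    let ?s = "\<lambda>z. I z * (G n z / (c n * R z))"
    \<comment> \<open>This integrates the derivative of \<open>G k * F n\<close>; the factor
      \<open>F n\<close> vanishes at both ends, so there is no boundary term.\<close>
    have "(LINT z|lborel. p z * prim ?s z + (A k + prim p z) * ?s z) = 0"
      by (rule prim_product_zero_ends(2)[OF p(1) F'_integrable p(2) _ F_total[OF n]]) auto
    then have e: "(LINT z|lborel. p z * F n z + G k z * ?s z) = 0"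
      using F_prim[OF n] p(3) by simp
    have i: "integrable lborel (\<lambda>z. p z * F n z)" "integrable lborel (\<lambda>z. G k z * ?s z)"
      using integrable_mult_bnd_borel[OF p(1) F_bb[OF n]] integrable_mult_bnd_borel[OF F'_integrable G_bb]
      by (simp_all add: mult.commute)
    have cn: "c n > 0" using c_pos n by simp
    have "(LINT z|lborel. I z * G k z * G n z / R z) = c n * (LINT z|lborel. G k z * ?s z)"
      using cn by (subst integral_mult_right_zero[symmetric]) (simp add: field_simps)
    also have "(LINT z|lborel. G k z * ?s z) = - (LINT z|lborel. p z * F n z)"
      using e i by simp
    also have "(LINT z|lborel. p z * F n z) = - (if k = n then 1 else 0) / c n"
    proof (cases "k = 0")
      case True then show ?thesis using n by (simp add: p_def)
    next
      case False
      then have "c k > 0" "k \<ge> 1" using c_pos[of k] by auto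
      have e': "(\<lambda>z. p z * F n z) = (\<lambda>z. (- 1 / c k) * (F k z * F n z * (- grav * Rp z)))"
        using False by (auto simp: p_def)
      have "(LINT z|lborel. p z * F n z) = (- 1 / c k) * (if k = n then 1 else 0)"
        unfolding e' integral_mult_right_zero F_orthonormal[OF \<open>k \<ge> 1\<close> n] ..
      then show ?thesis by auto
    qed
    finally show ?thesis using cn by simp
  qed
  show ?thesis
  proof (cases "n = 0")
    case False
    then show ?thesis using main[of n k] by simp
  next
    case n0: True
    show ?thesis
    proof (cases "k = 0")
      case False
      have "(\<lambda>z. I z * G k z * G n z / R z) = (\<lambda>z. I z * G n z * G k z / R z)" by (auto simp: ac_simps)
      then show ?thesis using main[of k n] False n0 by auto
    next
      case True
      have e: "(\<lambda>z. I z * G k z * G n z / R z) = (\<lambda>z. (A 0)\<^sup>2 * (I z / R z))"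
        using True n0 by (auto simp: G_0 power2_eq_square)
      show ?thesis unfolding e integral_mult_right_zero G_0_norm using True n0 by simp
    qed
  qed
qed

end

text \<open>Pairing with the dual profile \<open>d\<close> reads off the coefficient exactly from
  every partial sum that contains the index \<open>n\<close>, and the remainder is small by
  Cauchy-Schwarz. The pairs \<open>u\<close>, \<open>v\<close> and \<open>e\<close>,
  \<open>E\<close> are the given functions and their zero extensions, which agree almost everywhere
  inside.\<close>

lemma modal_coefficient:
  fixes u v :: "(real^'d::finite) \<times> real \<Rightarrow> real"
  assumes dec: "modal_decomposition H k e u a" and v: "sq_int v" and n: "n \<ge> k"
    and vu: "AE p in lborel. p \<in> strip H \<longrightarrow> u p = v p" and v0: "\<And>p. p \<notin> strip H \<Longrightarrow> v p = 0"
    and eE: "\<And>j. j \<ge> k \<Longrightarrow> AE z in lborel. z \<in> {-H<..<0} \<longrightarrow> e j z = E j z"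
    and E: "\<And>j. j \<ge> k \<Longrightarrow> sq_int (E j)" "\<And>j z. j \<ge> k \<Longrightarrow> z \<notin> {-H<..<0} \<Longrightarrow> E j z = 0"
    and d: "sq_int d" and dual: "\<And>j. j \<ge> k \<Longrightarrow> (LINT z|lborel. E j z * d z) = (if j = n then 1 else 0)"
  shows "AE X in lborel. a n X = (LINT z|lborel. v (X, z) * d z)"
proof -
  have "AE z in lborel. \<forall>j. j \<ge> k \<longrightarrow> z \<in> {-H<..<0} \<longrightarrow> e j z = E j z"
    using eE by (subst AE_all_countable) (auto intro: AE_mp)
  then have eE': "AE z in lborel. \<forall>j\<ge>k. z \<in> {-H<..<0} \<longrightarrow> e j z = E j z" by eventually_elim auto
  have vm: "(\<lambda>z. v (X, z)) \<in> borel_measurable borel" for X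
    using sq_int_borel[OF v] by (intro measurable_compose[OF _ sq_int_borel[OF v]]) (simp add: borel_prod[symmetric])
  have "AE X in lborel. (\<lambda>K. \<integral>\<^sup>+z\<in>{-H<..<0}. ennreal ((u (X, z) - (\<Sum>n=k..K. a n X * e n z))\<^sup>2) \<partial>lborel) \<longlonglongrightarrow> 0"
    using dec unfolding modal_decomposition_def by blast
  then show ?thesis
    using lborel_Fubini(2)[OF sq_intD[OF v]] lborel_AE_pair[OF vu]
  proof eventually_elim
    case (elim X)
    have U: "sq_int (\<lambda>z. v (X, z))" using vm elim(2) unfolding sq_int_def by simp
    define D where "D K z = v (X, z) - (\<Sum>j=k..K. a j X * E j z)" for K z
    have DS: "sq_int (D K)" for K
      unfolding D_def[abs_def] by (intro sq_int_diff U sq_int_sum sq_int_cmult E(1)) auto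
    have "(\<integral>\<^sup>+z\<in>{-H<..<0}. ennreal ((u (X, z) - (\<Sum>n=k..K. a n X * e n z))\<^sup>2) \<partial>lborel) = ennreal (sqn (D K))" for K
    proof -
      have "(\<integral>\<^sup>+z\<in>{-H<..<0}. ennreal ((u (X, z) - (\<Sum>n=k..K. a n X * e n z))\<^sup>2) \<partial>lborel)
          = (\<integral>\<^sup>+z. ennreal ((D K z)\<^sup>2) \<partial>lborel)"
      proof (rule nn_integral_cong_AE)
        show "AE z in lborel. ennreal ((u (X, z) - (\<Sum>n=k..K. a n X * e n z))\<^sup>2) * indicator {-H<..<0} z = ennreal ((D K z)\<^sup>2)"
          using elim(3) eE'
        proof eventually_elim
          case (elim z)
          show ?case
          proof (cases "z \<in> {-H<..<0}")
            case True
            then have "u (X, z) = v (X, z)" using elim(1) by (auto simp: strip_def)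
            moreover have "(\<Sum>n=k..K. a n X * e n z) = (\<Sum>j=k..K. a j X * E j z)"
              using elim(2) True by (intro sum.cong) auto
            ultimately show ?thesis using True by (simp add: D_def)
          next
            case False
            have "(\<Sum>j=k..K. a j X * E j z) = 0" using E(2) False by (intro sum.neutral) auto
            then show ?thesis using False v0[of "(X, z)"] by (simp add: D_def strip_def)
          qed
        qed
      qed
      then show ?thesis using sq_int_nn_integral[OF DS] by simp
    qed
    then have "(\<lambda>K. ennreal (sqn (D K))) \<longlonglongrightarrow> ennreal 0" using elim(1) by simp
    then have lim: "(\<lambda>K. sqn (D K)) \<longlonglongrightarrow> 0"
      by (subst (asm) tendsto_ennreal_iff) (auto simp: sqn_nonneg)
    \<comment> \<open>For \<open>K\<close> at least \<open>n\<close> the right-hand side no longer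
      depends on \<open>K\<close>, while the left-hand side tends to zero.\<close>
    have pair: "(LINT z|lborel. D K z * d z) = (LINT z|lborel. v (X, z) * d z) - a n X" if K: "K \<ge> n" for K
    proof -
      have e: "(\<lambda>z. D K z * d z) = (\<lambda>z. v (X, z) * d z - (\<Sum>j=k..K. a j X * (E j z * d z)))"
        unfolding D_def by (auto simp: left_diff_distrib sum_distrib_right mult.assoc)
      have i: "integrable lborel (\<lambda>z. a j X * (E j z * d z))" if "j \<in> {k..K}" for j
        using sq_int_mult[OF E(1) d, of j] that by simp
      have "(LINT z|lborel. D K z * d z) = (LINT z|lborel. v (X, z) * d z) - (LINT z|lborel. (\<Sum>j=k..K. a j X * (E j z * d z)))"
        unfolding e by (rule Bochner_Integration.integral_diff[OF sq_int_mult[OF U d] Bochner_Integration.integrable_sum[OF i]])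
      also have "(LINT z|lborel. (\<Sum>j=k..K. a j X * (E j z * d z))) = (\<Sum>j=k..K. LINT z|lborel. a j X * (E j z * d z))"
        by (rule Bochner_Integration.integral_sum[OF i])
      finally have "(LINT z|lborel. D K z * d z) = (LINT z|lborel. v (X, z) * d z) - (\<Sum>j=k..K. a j X * (LINT z|lborel. E j z * d z))"
        by simp
      also have "(\<Sum>j=k..K. a j X * (LINT z|lborel. E j z * d z)) = (\<Sum>j=k..K. if j = n then a j X else 0)"
        by (intro sum.cong) (auto simp: dual)
      also have "\<dots> = a n X" using n K by simp
      finally show ?thesis .
    qed
    have "(\<lambda>K. (LINT z|lborel. D K z * d z)) \<longlonglongrightarrow> 0"
    proof (rule Lim_null_comparison)
      show "eventually (\<lambda>K. norm (LINT z|lborel. D K z * d z) \<le> sqrt (sqn (D K)) * sqrt (sqn d)) sequentially"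
        using Cauchy_Schwarz_integral[OF DS d] by simp
      show "(\<lambda>K. sqrt (sqn (D K)) * sqrt (sqn d)) \<longlonglongrightarrow> 0"
        using tendsto_mult[OF tendsto_real_sqrt[OF lim] tendsto_const, of "sqrt (sqn d)"] by simp
    qed
    moreover have "eventually (\<lambda>K. (LINT z|lborel. D K z * d z) = (LINT z|lborel. v (X, z) * d z) - a n X) sequentially"
      using pair unfolding eventually_sequentially by blast
    ultimately have "(\<lambda>K. (LINT z|lborel. v (X, z) * d z) - a n X) \<longlonglongrightarrow> 0"
      by (rule Lim_transform_eventually)
    then show ?case by (simp add: LIMSEQ_const_iff)
  qed
qed

text \<open>The data are meaningful only almost everywhere in the interval and are arbitrary
  outside. Here they are replaced by bounded Borel functions on the whole line, and the weak
  equations by primitives, so that no later argument about the profiles meets exceptional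
  sets.\<close>

theorem mode_profile_exists:
  fixes H grav :: real
  assumes H: "H > 0" and grav: "grav > 0"
    and rho: "W_1_infty (-H) 0 \<rho>eq \<rho>eq'"
    and rho_pos: "\<exists>m>0. AE z in lborel. z \<in> {-H<..<0} \<longrightarrow> m \<le> \<rho>eq z"
    and N_pos: "\<exists>m>0. AE z in lborel. z \<in> {-H<..<0} \<longrightarrow> m \<le> N_sq grav \<rho>eq \<rho>eq' z"
    and modes: "SL_modes H grav \<rho>eq \<rho>eq' f c"
  obtains R Rp A F G R0 m where "mode_profile H grav c R Rp A F G R0 m"
    "(\<lambda>z. indicator {-H<..<0} z * \<rho>eq z) \<in> borel_measurable borel"
    "(\<lambda>z. indicator {-H<..<0} z * \<rho>eq' z) \<in> borel_measurable borel"
    "AE z in lborel. z \<in> {-H<..<0} \<longrightarrow> \<rho>eq z = R z \<and> \<rho>eq' z = Rp z \<and> \<rho>eq z * N_sq grav \<rho>eq \<rho>eq' z = - grav * Rp z"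
    "\<And>n z. n \<ge> 1 \<Longrightarrow> z \<in> {-H<..<0} \<Longrightarrow> f n z = F n z"
    "\<And>n. AE z in lborel. z \<in> {-H<..<0} \<longrightarrow> g_mode H \<rho>eq f c n z = G n z / R z"
    "\<And>k n. k \<ge> 1 \<Longrightarrow> n \<ge> 1 \<Longrightarrow> alpha H \<rho>eq f k n = (LINT z|lborel. F k z * F n z * R z)"
proof -
  let ?J = "{-H<..<0::real}"
  let ?I = "indicat_real ?J"
  obtain m1 where m1: "m1 > 0" "AE z in lborel. z \<in> ?J \<longrightarrow> m1 \<le> \<rho>eq z" using rho_pos by blast
  obtain m2 where m2: "m2 > 0" "AE z in lborel. z \<in> ?J \<longrightarrow> m2 \<le> N_sq grav \<rho>eq \<rho>eq' z" using N_pos by blast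
  have weak: "has_weak_deriv (-H) 0 \<rho>eq \<rho>eq'" using rho unfolding W_1_infty_def by blast
  obtain B where B: "AE z in lborel. z \<in> ?J \<longrightarrow> \<bar>\<rho>eq z\<bar> \<le> B \<and> \<bar>\<rho>eq' z\<bar> \<le> B" using rho unfolding W_1_infty_def by blast
  have wd: "integrable lborel (\<lambda>z. ?I z * u z)" "integrable lborel (\<lambda>z. ?I z * u' z)"
    "\<And>e. test_function ?J e \<Longrightarrow> (LINT y|lborel. (?I y * u y) * deriv e y) = - (LINT y|lborel. (?I y * u' y) * e y)"
    if "has_weak_deriv (-H) 0 u u'" for u u'
    using that unfolding has_weak_deriv_def set_integrable_def set_lebesgue_integral_def by (simp_all add: mult.assoc)
  \<comment> \<open>The du Bois-Reymond lemma, with the weak derivative exchanged for a convenient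
    version \<open>q\<close>. It is used for the density and again for
    \<open>\<rho>eq * f n'\<close>.\<close>
  have wp: "\<exists>C. AE z in lborel. z \<in> ?J \<longrightarrow> u z = C + prim q z"
    if h: "has_weak_deriv (-H) 0 u u'" and q: "AE z in lborel. ?I z * u' z = q z" "q \<in> borel_measurable borel" for u u' q
  proof -
    obtain C where C: "AE z in lborel. z \<in> ?J \<longrightarrow> ?I z * u z = C + prim (\<lambda>z. ?I z * u' z) z"
      using weak_derivative_prim[of "-H" 0, OF _ wd(1,2)[OF h] _ _ wd(3)[OF h]] H by auto
    have e: "prim (\<lambda>z. ?I z * u' z) z = prim q z" for z
      using borel_measurable_integrable[OF wd(2)[OF h]] by (intro prim_cong_AE q) simp
    have "AE z in lborel. z \<in> ?J \<longrightarrow> u z = C + prim q z" using C unfolding e by eventually_elim auto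
    then show ?thesis by blast
  qed
  have rm: "(\<lambda>z. ?I z * \<rho>eq z) \<in> borel_measurable borel" "(\<lambda>z. ?I z * \<rho>eq' z) \<in> borel_measurable borel"
    using borel_measurable_integrable[OF wd(1)[OF weak]] borel_measurable_integrable[OF wd(2)[OF weak]] by simp_all
  \<comment> \<open>Truncation at the essential bound: bounded everywhere, unchanged almost
    everywhere in the interval, and zero outside.\<close>
  define Rp where "Rp z = max (- \<bar>B\<bar>) (min \<bar>B\<bar> (?I z * \<rho>eq' z))" for z
  have Rp_bb: "bnd_borel Rp" unfolding Rp_def[abs_def] using rm by (intro bnd_borelI[of _ "\<bar>B\<bar>"]) auto
  have Rp0: "Rp z = 0" if "z \<notin> ?J" for z using that by (simp add: Rp_def)
  have Rp_AE: "AE z in lborel. ?I z * \<rho>eq' z = Rp z" using B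
    by eventually_elim (auto simp: Rp_def indicator_def)
  obtain R0 where R0: "AE z in lborel. z \<in> ?J \<longrightarrow> \<rho>eq z = R0 + prim Rp z"
    using wp[OF weak Rp_AE bnd_borel_measurable[OF Rp_bb]] by blast
  define R where "R = (\<lambda>z. R0 + prim Rp z)"
  have supp: "integrable lborel q" if q: "bnd_borel q" "\<And>z. z \<notin> ?J \<Longrightarrow> q z = 0" for q
  proof -
    have "q z * ?I z = q z" for z using q(2)[of z] by (cases "z \<in> ?J") auto
    then have "(\<lambda>z. q z * ?I z) = q" by (intro ext)
    then show ?thesis using integrable_bnd_borel_Ioo[OF q(1), of "-H" 0] by argo
  qed
  have Rp_i: "integrable lborel Rp" by (rule supp[OF Rp_bb Rp0])
  have R_cont: "continuous_on S R" for S unfolding R_def by (intro continuous_intros prim_continuous Rp_i)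
  have R_bb: "bnd_borel R" unfolding R_def by (intro bnd_borel_add bnd_borel_const bnd_borel_prim Rp_i)
  have R_low: "m1 \<le> R z" for z
  proof -
    have in_J: "m1 \<le> R z" if "z \<in> {-H..0}" for z
    proof -
      \<comment> \<open>The positive part turns an inequality valid almost everywhere into the
        vanishing of a continuous function, so it holds at every point of the closed interval.
        Outside, \<open>R\<close> keeps its end values.\<close>
      have "max 0 (m1 - R z) = 0"
      proof (rule continuous_AE_zero[of "-H" 0 _ z])
        show "continuous_on {-H..0} (\<lambda>z. max 0 (m1 - R z))" by (intro continuous_intros R_cont)
        show "AE z in lborel. z \<in> ?J \<longrightarrow> max 0 (m1 - R z) = 0"
          using m1(2) R0 by eventually_elim (auto simp: R_def)
      qed (use H that in auto)
      then show ?thesis by simp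
    qed
    consider "z \<le> -H" | "z \<in> {-H..0}" | "z \<ge> 0" by fastforce
    then show ?thesis
    proof cases
      case 1
      then have "R z = R (-H)" unfolding R_def using prim_left[of "-H" 0 Rp] Rp0 by simp
      then show ?thesis using in_J[of "-H"] H by simp
    next
      case 3
      then have "R z = R 0" unfolding R_def using prim_right[of "-H" 0 Rp] Rp0 by simp
      then show ?thesis using in_J[of 0] H by simp
    qed (rule in_J)
  qed
  have R_pos: "R z > 0" for z using R_low[of z] m1(1) by linarith
  have W_AE: "AE z in lborel. z \<in> ?J \<longrightarrow> \<rho>eq z = R z \<and> \<rho>eq' z = Rp z \<and> \<rho>eq z * N_sq grav \<rho>eq \<rho>eq' z = - grav * Rp z
      \<and> m1 * m2 \<le> - grav * Rp z"
    using R0 Rp_AE m1(2) m2(2)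
  proof eventually_elim
    case (elim z)
    show ?case
    proof
      assume z: "z \<in> ?J"
      then have e: "\<rho>eq z = R z" "\<rho>eq' z = Rp z" "m1 \<le> \<rho>eq z" "m2 \<le> N_sq grav \<rho>eq \<rho>eq' z"
        using elim by (auto simp: R_def)
      have n: "\<rho>eq z * N_sq grav \<rho>eq \<rho>eq' z = - grav * Rp z"
        using e(2) e(3) m1(1) by (simp add: N_sq_def)
      have "m1 * m2 \<le> \<rho>eq z * N_sq grav \<rho>eq \<rho>eq' z"
        using e m1(1) m2(1) by (intro mult_mono) auto
      then show "\<rho>eq z = R z \<and> \<rho>eq' z = Rp z \<and> \<rho>eq z * N_sq grav \<rho>eq \<rho>eq' z = - grav * Rp z \<and> m1 * m2 \<le> - grav * Rp z"
        using e n by simp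
    qed
  qed
  have cpos: "c n > 0" if "n \<ge> 1" for n using modes that unfolding SL_modes_def by blast
  have fn: "continuous_on {-H..0} (f n)" "\<And>z. z \<in> ?J \<Longrightarrow> f n differentiable (at z)" "f n (-H) = 0" "f n 0 = 0"
    "has_weak_deriv (-H) 0 (\<lambda>z. \<rho>eq z * deriv (f n) z) (\<lambda>z. - (\<rho>eq z * N_sq grav \<rho>eq \<rho>eq' z / (c n)\<^sup>2 * f n z))"
    if "n \<ge> 1" for n
    using modes that unfolding SL_modes_def by blast+
  define F where "F n z = ?I z * f n z" for n z
  have F_bb: "bnd_borel (F n)" if n: "n \<ge> 1" for n
  proof -
    have "bounded (f n ` {-H..0})" by (intro compact_imp_bounded compact_continuous_image fn(1) n) auto
    then obtain D where D: "D > 0" "\<forall>z\<in>{-H..0}. \<bar>f n z\<bar> \<le> D" unfolding bounded_pos by auto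
    have "(\<lambda>z. ?I z *\<^sub>R f n z) \<in> borel_measurable borel"
      by (rule borel_measurable_continuous_on_indicator) (auto intro: continuous_on_subset[OF fn(1)[OF n]])
    then show ?thesis unfolding F_def[abs_def] using D
      by (intro bnd_borelI[of _ D]) (auto simp: indicator_def)
  qed
  have F0: "F n z = 0" if "z \<notin> ?J" for n z using that by (simp add: F_def)
  define q where "q n z = grav * Rp z * F n z / c n" for n z
  have q_bb: "bnd_borel (q n)" if "n \<ge> 1" for n
    unfolding q_def[abs_def] using bnd_borel_cmult[OF bnd_borel_mult[OF Rp_bb F_bb[OF that]], of "grav / c n"]
    by (simp add: mult.assoc)
  have q_i: "integrable lborel (q n)" if "n \<ge> 1" for n
    by (rule supp[OF q_bb[OF that]]) (simp add: q_def Rp0)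
  have "\<forall>n. \<exists>C. n \<ge> 1 \<longrightarrow> (AE z in lborel. z \<in> ?J \<longrightarrow> \<rho>eq z * deriv (f n) z = C + prim (\<lambda>z. (1 / c n) * q n z) z)"
  proof (intro allI)
    fix n
    show "\<exists>C. n \<ge> 1 \<longrightarrow> (AE z in lborel. z \<in> ?J \<longrightarrow> \<rho>eq z * deriv (f n) z = C + prim (\<lambda>z. (1 / c n) * q n z) z)"
    proof (cases "n \<ge> 1")
      case n: True
      have "AE z in lborel. ?I z * (- (\<rho>eq z * N_sq grav \<rho>eq \<rho>eq' z / (c n)\<^sup>2 * f n z)) = (1 / c n) * q n z"
        using W_AE by eventually_elim (auto simp: q_def F_def indicator_def power2_eq_square)
      from wp[OF fn(5)[OF n] this] show ?thesis using bnd_borel_measurable[OF q_bb[OF n]] by auto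
    qed simp
  qed
  then obtain C where C: "\<And>n. n \<ge> 1 \<Longrightarrow> AE z in lborel. z \<in> ?J \<longrightarrow> \<rho>eq z * deriv (f n) z = C n + prim (\<lambda>z. (1 / c n) * q n z) z"
    by metis
  \<comment> \<open>\<open>A 0\<close> is the normalising constant \<alpha> of the zeroth mode; for
    other \<open>n\<close> it is \<open>c n\<close> times the constant of integration of
    \<open>\<rho>eq * f n'\<close>, as \<open>G n\<close> carries the factor
    \<open>c n\<close>.\<close>
  define A where "A n = (if n = 0 then (LBINT y:?J. 1 / \<rho>eq y) powr (-1/2) else c n * C n)" for n
  define G where "G n z = (if n = 0 then A 0 else A n + prim (q n) z)" for n z
  have G_cont: "continuous_on S (G n)" for S n
  proof (cases "n = 0")
    case False
    then have "G n = (\<lambda>z. A n + prim (q n) z)" "n \<ge> 1" by (auto simp: G_def)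
    then show ?thesis using prim_continuous[OF q_i] by (simp add: continuous_on_add)
  qed (simp add: G_def[abs_def])
  have f'_AE: "AE z in lborel. z \<in> ?J \<longrightarrow> deriv (f n) z = G n z / (c n * R z)" if n: "n \<ge> 1" for n
    using C[OF n] W_AE
  proof eventually_elim
    case (elim z)
    show ?case
    proof
      assume z: "z \<in> ?J"
      have "R z * deriv (f n) z = C n + prim (q n) z / c n"
        using elim z prim_cmult[of "1 / c n" "q n" z] by simp
      then show "deriv (f n) z = G n z / (c n * R z)"
        using n cpos[OF n] R_pos[of z] by (simp add: G_def A_def field_simps)
    qed
  qed
  have F_prim: "f n z = prim (\<lambda>z. ?I z * (G n z / (c n * R z))) z" if n: "n \<ge> 1" and z: "z \<in> {-H..0}" for n z
  proof -
    let ?h = "\<lambda>z. G n z / (c n * R z)"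
    have hc: "continuous_on S ?h" for S
      using cpos[OF n] R_pos by (intro continuous_intros G_cont R_cont) (metis less_irrefl mult_eq_0_iff)
    \<comment> \<open>The gauge integral recovers \<open>f n\<close> from its pointwise derivative
      without integrability being known beforehand; only afterwards is the derivative exchanged for
      its continuous version.\<close>
    have "(deriv (f n) has_integral (f n z - f n (-H))) {-H..z}"
    proof (rule fundamental_theorem_of_calculus_interior)
      show "continuous_on {-H..z} (f n)" using z by (intro continuous_on_subset[OF fn(1)[OF n]]) auto
      show "(f n has_vector_derivative deriv (f n) x) (at x)" if "x \<in> {-H<..<z}" for x
        using fn(2)[OF n, of x] that z
        by (simp add: DERIV_deriv_iff_real_differentiable has_real_derivative_iff_has_vector_derivative[symmetric])
    qed (use z in auto)
    moreover obtain N where N: "negligible N" "\<And>x. x \<notin> N \<Longrightarrow> x \<in> ?J \<longrightarrow> deriv (f n) x = ?h x"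
      using AE_lborel_negligible[OF f'_AE[OF n]] by metis
    have "negligible (N \<union> {-H, 0})" using N(1) by simp
    ultimately have "(?h has_integral (f n z - f n (-H))) {-H..z}"
    proof (rule has_integral_spike[rotated 2])
      show "?h x = deriv (f n) x" if "x \<in> {-H..z} - (N \<union> {-H, 0})" for x
        using N(2)[of x] that z by auto
    qed
    then have "integral {-H..z} ?h = f n z" using fn(3)[OF n] by (simp add: integral_unique)
    moreover have "set_integrable lborel {-H..z} ?h" by (rule borel_integrable_atLeastAtMost'[OF hc])
    ultimately have e: "f n z = (LINT y|lborel. indicator {-H..z} y * ?h y)"
      using set_borel_integral_eq_integral(2)[of "{-H..z}" ?h] by (simp add: set_lebesgue_integral_def)
    have hm: "?h \<in> borel_measurable borel" by (rule borel_measurable_continuous_onI[OF hc])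
    have "(LINT y|lborel. indicator {-H..z} y * ?h y) = (LINT y|lborel. ?I y * ?h y * indicator {..z} y)"
    proof (rule integral_cong_AE)
      show "AE y in lborel. indicator {-H..z} y * ?h y = ?I y * ?h y * indicator {..z} y"
        using AE_neq[of "-H"] AE_neq[of 0] by eventually_elim (use z in \<open>auto simp: indicator_def\<close>)
      show "(\<lambda>y. indicator {-H..z} y * ?h y) \<in> borel_measurable lborel"
        "(\<lambda>y. ?I y * ?h y * indicator {..z} y) \<in> borel_measurable lborel"
        by (intro borel_measurable_times; use hm in \<open>simp add: measurable_lborel1\<close>)+
    qed
    then show ?thesis unfolding prim_def using e by simp
  qed
  have F_eq: "F n = prim (\<lambda>z. ?I z * (G n z / (c n * R z)))" if n: "n \<ge> 1" for n
  proof
    fix z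
    consider "z \<le> -H" | "z \<in> ?J" | "z \<ge> 0" by fastforce
    then show "F n z = prim (\<lambda>z. ?I z * (G n z / (c n * R z))) z"
    proof cases
      case 1
      then show ?thesis using prim_left[of "-H" 0 "\<lambda>z. ?I z * (G n z / (c n * R z))" z] by (simp add: F_def)
    next
      case 2
      then show ?thesis using F_prim[OF n, of z] by (simp add: F_def)
    next
      case 3
      have "prim (\<lambda>z. ?I z * (G n z / (c n * R z))) z = prim (\<lambda>z. ?I z * (G n z / (c n * R z))) 0"
        using prim_right[of "-H" 0 "\<lambda>z. ?I z * (G n z / (c n * R z))"] 3 by simp
      also have "\<dots> = 0" using F_prim[OF n, of 0] fn(4)[OF n] H by simp
      finally show ?thesis using 3 by (simp add: F_def)
    qed
  qed
  have F_total: "(LINT z|lborel. ?I z * (G n z / (c n * R z))) = 0" if n: "n \<ge> 1" for n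
  proof -
    have "(LINT z|lborel. ?I z * (G n z / (c n * R z))) = F n 0"
      unfolding F_eq[OF n] by (rule prim_right[symmetric, of "-H" 0]) auto
    then show ?thesis by (simp add: F_def)
  qed
  define W where "W z = - grav * Rp z" for z
  have basis: "orthonormal_basis H (\<lambda>z. \<rho>eq z * N_sq grav \<rho>eq \<rho>eq' z) 1 f" using modes unfolding SL_modes_def by blast
  have W_bb: "bnd_borel W" unfolding W_def[abs_def] by (rule bnd_borel_cmult[OF Rp_bb])
  have sqi: "sq_int q" if "bnd_borel q" "\<And>z. z \<notin> ?J \<Longrightarrow> q z = 0" for q
    unfolding sq_int_def power2_eq_square using that by (intro conjI bnd_borel_measurable supp bnd_borel_mult) auto
  have Forth: "(LINT z|lborel. F k z * F n z * W z) = (if k = n then 1 else 0)" if kn: "k \<ge> 1" "n \<ge> 1" for k n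
  proof -
    have o: "set_integrable lborel ?J (\<lambda>z. f k z * f n z * (\<rho>eq z * N_sq grav \<rho>eq \<rho>eq' z))"
      "(LBINT z:?J. f k z * f n z * (\<rho>eq z * N_sq grav \<rho>eq \<rho>eq' z)) = (if k = n then 1 else 0)"
      using basis kn unfolding orthonormal_basis_def by blast+
    have "(LINT z|lborel. F k z * F n z * W z) = (LBINT z:?J. f k z * f n z * (\<rho>eq z * N_sq grav \<rho>eq \<rho>eq' z))"
      unfolding set_lebesgue_integral_def
    proof (rule integral_cong_AE)
      show "(\<lambda>z. F k z * F n z * W z) \<in> borel_measurable lborel"
        using bnd_borel_measurable[OF F_bb[OF kn(1)]] bnd_borel_measurable[OF F_bb[OF kn(2)]] bnd_borel_measurable[OF W_bb] by simp
      show "(\<lambda>z. ?I z *\<^sub>R (f k z * f n z * (\<rho>eq z * N_sq grav \<rho>eq \<rho>eq' z))) \<in> borel_measurable lborel"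
        using borel_measurable_integrable[OF o(1)[unfolded set_integrable_def]] .
      show "AE z in lborel. F k z * F n z * W z = ?I z *\<^sub>R (f k z * f n z * (\<rho>eq z * N_sq grav \<rho>eq \<rho>eq' z))"
        using W_AE by eventually_elim (auto simp: F_def W_def indicator_def)
    qed
    then show ?thesis using o(2) by simp
  qed
  have alpha: "alpha H \<rho>eq f k n = (LINT z|lborel. F k z * F n z * R z)" if kn: "k \<ge> 1" "n \<ge> 1" for k n
    unfolding alpha_def set_lebesgue_integral_def
  proof (rule integral_cong_AE)
    have e: "?I z *\<^sub>R (f k z * f n z * \<rho>eq z) = F k z * F n z * (?I z * \<rho>eq z)" for z by (simp add: F_def indicator_def)
    show "(\<lambda>z. ?I z *\<^sub>R (f k z * f n z * \<rho>eq z)) \<in> borel_measurable lborel" unfolding e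
      using bnd_borel_measurable[OF F_bb[OF kn(1)]] bnd_borel_measurable[OF F_bb[OF kn(2)]] rm(1) by simp
    show "(\<lambda>z. F k z * F n z * R z) \<in> borel_measurable lborel"
      using bnd_borel_measurable[OF F_bb[OF kn(1)]] bnd_borel_measurable[OF F_bb[OF kn(2)]] bnd_borel_measurable[OF R_bb] by simp
    show "AE z in lborel. ?I z *\<^sub>R (f k z * f n z * \<rho>eq z) = F k z * F n z * R z"
      using W_AE by eventually_elim (auto simp: F_def indicator_def)
  qed
  have norm_int: "(LBINT y:?J. 1 / \<rho>eq y) = (LINT z|lborel. ?I z / R z)"
    unfolding set_lebesgue_integral_def
  proof (rule integral_cong_AE)
    \<comment> \<open>Measurability of \<open>\<rho>eq\<close> is known only after restriction to
      the interval. The quotient of restricted functions is the right one, as division by zero gives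
      zero outside.\<close>
    have e: "?I z *\<^sub>R (1 / \<rho>eq z) = ?I z / (?I z * \<rho>eq z)" for z by (simp add: indicator_def)
    show "(\<lambda>z. ?I z *\<^sub>R (1 / \<rho>eq z)) \<in> borel_measurable lborel"
      unfolding e by (intro borel_measurable_divide; use rm(1) in simp)
    show "(\<lambda>z. ?I z / R z) \<in> borel_measurable lborel" using bnd_borel_measurable[OF R_bb] by simp
    show "AE z in lborel. ?I z *\<^sub>R (1 / \<rho>eq z) = ?I z / R z"
      using W_AE by eventually_elim (auto simp: indicator_def)
  qed
  have norm_pos: "(LINT z|lborel. ?I z / R z) > 0"
  proof -
    obtain D where D: "D > 0" "\<And>z. \<bar>R z\<bar> \<le> D" using bnd_borelE[OF R_bb] by metis
    have "integrable lborel (\<lambda>z. ?I z / R z)"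
    proof (rule Bochner_Integration.integrable_bound[OF integrable_mult_right[OF integrable_Ioo[of "-H" 0], of "1 / m1"]])
      show "AE z in lborel. norm (?I z / R z) \<le> norm (1 / m1 * ?I z)"
        using R_low m1(1) R_pos by (auto simp: indicator_def frac_le abs_of_pos less_imp_le)
    qed (use bnd_borel_measurable[OF R_bb] in simp)
    then have "(LINT z|lborel. (1 / D) * ?I z) \<le> (LINT z|lborel. ?I z / R z)"
    proof (intro integral_mono)
      show "1 / D * ?I z \<le> ?I z / R z" for z
        using D(1) D(2)[of z] R_pos[of z] by (auto simp: indicator_def frac_le)
    qed (use integrable_Ioo[of "-H" 0] in simp_all)
    moreover have "(LINT z|lborel. (1 / D) * ?I z) = H / D" using H by simp
    moreover have "H / D > 0" using H D(1) by simp
    ultimately show ?thesis by linarith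
  qed
  have A0: "A 0 = (LINT z|lborel. ?I z / R z) powr (-1/2)" by (simp add: A_def norm_int)
  have A0_norm: "(A 0)\<^sup>2 * (LINT z|lborel. ?I z / R z) = 1"
  proof -
    have "(A 0)\<^sup>2 = (LINT z|lborel. ?I z / R z) powr (-1)"
      unfolding A0 power2_eq_square by (simp add: powr_add[symmetric])
    then show ?thesis using norm_pos by (simp add: powr_minus)
  qed
  have complete: "(\<lambda>K. sqn (\<lambda>z. R z * F n z - (\<Sum>k=1..K. (LINT y|lborel. F k y * F n y * R y) * (- grav * Rp z * F k z)))) \<longlonglongrightarrow> 0"
    if n: "n \<ge> 1" for n
  proof -
    define a where "a k = (LINT y|lborel. F k y * F n y * R y)" for k
    define u where "u z = F n z * R z / W z" for z
    have um: "u \<in> borel_measurable borel" unfolding u_def[abs_def]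
      using bnd_borel_measurable[OF F_bb[OF n]] bnd_borel_measurable[OF W_bb] bnd_borel_measurable[OF R_bb] by simp
    have mm: "m1 * m2 > 0" using m1(1) m2(1) by simp
    have W_AE': "AE z in lborel. z \<in> ?J \<longrightarrow> \<rho>eq z * N_sq grav \<rho>eq \<rho>eq' z = W z \<and> W z \<ge> m1 * m2 \<and> W z > 0"
      using W_AE by eventually_elim (use mm in \<open>auto simp: W_def\<close>)
    have rNm: "(\<lambda>z. ?I z * (\<rho>eq z * N_sq grav \<rho>eq \<rho>eq' z)) \<in> borel_measurable borel"
    proof -
      have e: "?I z * (\<rho>eq z * N_sq grav \<rho>eq \<rho>eq' z) = (?I z * \<rho>eq z) * (- grav * (?I z * \<rho>eq' z) / (?I z * \<rho>eq z))" for z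
        by (simp add: indicator_def N_sq_def)
      show ?thesis unfolding e
        by (intro borel_measurable_times borel_measurable_divide borel_measurable_const rm)
    qed
    obtain Wb where Wb: "Wb > 0" "\<And>z. \<bar>W z\<bar> \<le> Wb" using bnd_borelE[OF W_bb] by metis
    obtain Fb where Fb: "Fb > 0" "\<And>z. \<bar>F n z * R z * (F n z * R z)\<bar> \<le> Fb"
      using bnd_borelE[OF bnd_borel_mult[OF bnd_borel_mult[OF F_bb[OF n] R_bb] bnd_borel_mult[OF F_bb[OF n] R_bb]]] by metis
    \<comment> \<open>Here \<open>u\<^sup>2 W\<close> equals \<open>(F n * R)\<^sup>2 / W\<close>,
      which is bounded because \<open>W\<close> stays above \<open>m1 * m2\<close>.\<close>
    have si: "set_integrable lborel ?J (\<lambda>z. (u z)\<^sup>2 * (\<rho>eq z * N_sq grav \<rho>eq \<rho>eq' z))"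
      unfolding set_integrable_def
    proof (rule Bochner_Integration.integrable_bound[OF integrable_mult_right[OF integrable_Ioo[of "-H" 0], of "Fb / (m1 * m2)"]])
      have e: "?I z *\<^sub>R ((u z)\<^sup>2 * (\<rho>eq z * N_sq grav \<rho>eq \<rho>eq' z)) = (u z)\<^sup>2 * (?I z * (\<rho>eq z * N_sq grav \<rho>eq \<rho>eq' z))" for z by simp
      show "(\<lambda>z. ?I z *\<^sub>R ((u z)\<^sup>2 * (\<rho>eq z * N_sq grav \<rho>eq \<rho>eq' z))) \<in> borel_measurable lborel"
        unfolding e using um rNm by simp
      show "AE z in lborel. norm (?I z *\<^sub>R ((u z)\<^sup>2 * (\<rho>eq z * N_sq grav \<rho>eq \<rho>eq' z))) \<le> norm (Fb / (m1 * m2) * ?I z)"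
        using W_AE'
      proof eventually_elim
        case (elim z)
        show ?case
        proof (cases "z \<in> ?J")
          case True
          then have w: "\<rho>eq z * N_sq grav \<rho>eq \<rho>eq' z = W z" "W z \<ge> m1 * m2" "W z > 0" using elim by auto
          have "(u z)\<^sup>2 * W z = F n z * R z * (F n z * R z) / W z"
            using w(3) by (simp add: u_def power2_eq_square)
          also have "\<dots> \<le> Fb / (m1 * m2)"
            using Fb(2)[of z] w mm Fb(1) by (intro frac_le) auto
          finally show ?thesis using True w Fb(1) m1(1) m2(1) by (simp add: abs_mult)
        qed simp
      qed
    qed
    have coef: "(LBINT y:?J. u y * f k y * (\<rho>eq y * N_sq grav \<rho>eq \<rho>eq' y)) = a k" if k: "k \<ge> 1" for k
      unfolding a_def set_lebesgue_integral_def
    proof (rule integral_cong_AE)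
      have e: "?I z *\<^sub>R (u z * f k z * (\<rho>eq z * N_sq grav \<rho>eq \<rho>eq' z)) = u z * F k z * (?I z * (\<rho>eq z * N_sq grav \<rho>eq \<rho>eq' z))" for z
        by (simp add: F_def indicator_def)
      show "(\<lambda>z. ?I z *\<^sub>R (u z * f k z * (\<rho>eq z * N_sq grav \<rho>eq \<rho>eq' z))) \<in> borel_measurable lborel"
        unfolding e using um rNm bnd_borel_measurable[OF F_bb[OF k]] by simp
      show "(\<lambda>y. F k y * F n y * R y) \<in> borel_measurable lborel"
        using bnd_borel_measurable[OF F_bb[OF k]] bnd_borel_measurable[OF F_bb[OF n]] bnd_borel_measurable[OF R_bb] by simp
      show "AE y in lborel. ?I y *\<^sub>R (u y * f k y * (\<rho>eq y * N_sq grav \<rho>eq \<rho>eq' y)) = F k y * F n y * R y"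
        using W_AE' by eventually_elim (auto simp: F_def u_def indicator_def)
    qed
    define D where "D K z = R z * F n z - (\<Sum>k=1..K. a k * (W z * F k z))" for K z
    have D_bb: "bnd_borel (D K)" for K unfolding D_def[abs_def]
      by (intro bnd_borel_diff bnd_borel_mult R_bb F_bb n bnd_borel_sum bnd_borel_const W_bb) auto
    have D0: "D K z = 0" if "z \<notin> ?J" for K z using that by (simp add: D_def F0)
    define b where "b K = (\<integral>\<^sup>+z. ennreal ((u z - (\<Sum>k=1..K. a k * F k z))\<^sup>2 * (W z * ?I z)) \<partial>lborel)" for K
    have bm: "(\<lambda>z. ennreal ((u z - (\<Sum>k=1..K. a k * F k z))\<^sup>2 * (W z * ?I z))) \<in> borel_measurable lborel" for K
    proof -
      have "(\<lambda>z. \<Sum>k=1..K. a k * F k z) \<in> borel_measurable borel"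
        by (intro bnd_borel_measurable bnd_borel_sum bnd_borel_cmult F_bb) auto
      then show ?thesis using um bnd_borel_measurable[OF W_bb] by simp
    qed
    have "(\<integral>\<^sup>+z\<in>?J. ennreal ((u z - (\<Sum>k=1..K. (LBINT y:?J. u y * f k y * (\<rho>eq y * N_sq grav \<rho>eq \<rho>eq' y)) * f k z))\<^sup>2 * (\<rho>eq z * N_sq grav \<rho>eq \<rho>eq' z)) \<partial>lborel) = b K" for K
      unfolding b_def
    proof (rule nn_integral_cong_AE)
      show "AE z in lborel. ennreal ((u z - (\<Sum>k=1..K. (LBINT y:?J. u y * f k y * (\<rho>eq y * N_sq grav \<rho>eq \<rho>eq' y)) * f k z))\<^sup>2 * (\<rho>eq z * N_sq grav \<rho>eq \<rho>eq' z)) * indicator ?J z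
        = ennreal ((u z - (\<Sum>k=1..K. a k * F k z))\<^sup>2 * (W z * ?I z))"
        using W_AE'
      proof eventually_elim
        case (elim z)
        show ?case
        proof (cases "z \<in> ?J")
          case True
          have "(\<Sum>k=1..K. (LBINT y:?J. u y * f k y * (\<rho>eq y * N_sq grav \<rho>eq \<rho>eq' y)) * f k z) = (\<Sum>k=1..K. a k * F k z)"
            using coef True by (intro sum.cong) (auto simp: F_def)
          then show ?thesis using True elim by simp
        qed simp
      qed
    qed
    moreover have "set_borel_measurable lborel ?J u" unfolding set_borel_measurable_def using um by simp
    ultimately have b0: "b \<longlonglongrightarrow> 0" using basis si unfolding orthonormal_basis_def by auto
    \<comment> \<open>The remainder \<open>D K\<close> is \<open>W\<close> times the remainder for
      \<open>u\<close>; one factor \<open>W\<close> is bounded by \<open>Wb\<close> and the other is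
      kept as the weight of the known convergence.\<close>
    have le: "ennreal (sqn (D K)) \<le> ennreal Wb * b K" for K
    proof -
      have "ennreal (sqn (D K)) = (\<integral>\<^sup>+z. ennreal ((D K z)\<^sup>2) \<partial>lborel)"
        by (rule sq_int_nn_integral[symmetric]) (rule sqi[OF D_bb D0])
      also have "\<dots> \<le> (\<integral>\<^sup>+z. ennreal Wb * ennreal ((u z - (\<Sum>k=1..K. a k * F k z))\<^sup>2 * (W z * ?I z)) \<partial>lborel)"
      proof (rule nn_integral_mono_AE)
        show "AE z in lborel. ennreal ((D K z)\<^sup>2) \<le> ennreal Wb * ennreal ((u z - (\<Sum>k=1..K. a k * F k z))\<^sup>2 * (W z * ?I z))"
          using W_AE'
        proof eventually_elim
          case (elim z)
          show ?case
          proof (cases "z \<in> ?J")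
            case True
            then have w: "W z > 0" using elim by simp
            have "D K z = W z * (u z - (\<Sum>k=1..K. a k * F k z))"
              using w by (simp add: D_def u_def right_diff_distrib sum_distrib_left ac_simps)
            then have "(D K z)\<^sup>2 = W z * ((u z - (\<Sum>k=1..K. a k * F k z))\<^sup>2 * W z)"
              by (simp add: power2_eq_square ac_simps)
            also have "\<dots> \<le> Wb * ((u z - (\<Sum>k=1..K. a k * F k z))\<^sup>2 * W z)"
              using w Wb(2)[of z] by (intro mult_right_mono) auto
            finally show ?thesis using True w Wb(1) by (simp add: ennreal_mult'[symmetric] ennreal_leI)
          next
            case False then show ?thesis by (simp add: D0)
          qed
        qed
      qed
      also have "\<dots> = ennreal Wb * b K" unfolding b_def by (rule nn_integral_cmult[OF bm])
      finally show ?thesis .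
    qed
    have "(\<lambda>K. ennreal Wb * b K) \<longlonglongrightarrow> ennreal Wb * 0" by (rule ennreal_tendsto_cmult[OF _ b0]) simp
    then have lim0: "(\<lambda>K. ennreal Wb * b K) \<longlonglongrightarrow> 0" by simp
    have "(\<lambda>K. ennreal (sqn (D K))) \<longlonglongrightarrow> 0"
      by (rule tendsto_sandwich[where f = "\<lambda>_. 0" and h = "\<lambda>K. ennreal Wb * b K", OF _ _ tendsto_const lim0])
         (intro always_eventually allI zero_le le)+
    then have "(\<lambda>K. ennreal (sqn (D K))) \<longlonglongrightarrow> ennreal 0" by simp
    then have "(\<lambda>K. sqn (D K)) \<longlonglongrightarrow> 0" by (subst (asm) tendsto_ennreal_iff) (auto simp: sqn_nonneg)
    then show ?thesis unfolding D_def a_def W_def .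
  qed
  have mp: "mode_profile H grav c R Rp A F G R0 m1"
  proof
    show "F n = prim (\<lambda>z. ?I z * (G n z / (c n * R z)))" if "n \<ge> 1" for n by (rule F_eq[OF that])
    show "G n = (\<lambda>z. A n + prim (\<lambda>z. grav * Rp z * F n z / c n) z)" if "n \<ge> 1" for n
      using that by (auto simp: G_def q_def[abs_def] fun_eq_iff)
    show "(LINT z|lborel. F k z * F n z * (- grav * Rp z)) = (if k = n then 1 else 0)" if "k \<ge> 1" "n \<ge> 1" for k n
      using Forth[OF that] unfolding W_def .
    show "A 0 \<noteq> 0" using norm_pos by (simp add: A0)
  qed (use H grav cpos Rp_bb Rp0 R_def m1(1) R_low F_bb F_total A0_norm complete in \<open>auto simp: G_def\<close>)
  have g: "AE z in lborel. z \<in> ?J \<longrightarrow> g_mode H \<rho>eq f c n z = G n z / R z" for n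
  proof (cases "n = 0")
    case True
    show ?thesis using W_AE by eventually_elim (auto simp: g_mode_def True G_def A_def)
  next
    case False
    then have n: "n \<ge> 1" by simp
    show ?thesis using f'_AE[OF n]
      by eventually_elim (use False cpos[OF n] in \<open>auto simp: g_mode_def\<close>)
  qed
  have w: "AE z in lborel. z \<in> ?J \<longrightarrow> \<rho>eq z = R z \<and> \<rho>eq' z = Rp z \<and> \<rho>eq z * N_sq grav \<rho>eq \<rho>eq' z = - grav * Rp z"
    using W_AE by eventually_elim auto
  have fF: "f n z = F n z" if "n \<ge> 1" "z \<in> ?J" for n z using that by (simp add: F_def)
  show ?thesis by (rule that[OF mp rm w fF g alpha])
qed

section \<open>The modal equations\<close>

lemma C_L2_const: "sq_int \<eta> \<Longrightarrow> C_L2 T UNIV (\<lambda>t. \<eta>)"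
  unfolding C_L2_iff by (simp add: sqn_def)

text \<open>The way back from equations tested in time to every fixed time, end points
  included.\<close>

lemma continuous_weak_zero:
  fixes T t :: real
  assumes T: "T > 0" and g: "continuous_on {0..T} g"
    and 0: "\<And>\<theta>. test_function {0<..<T} \<theta> \<Longrightarrow> (LINT t|lborel. indicator {0<..<T} t * (\<theta> t * g t)) = 0"
    and t: "t \<in> {0..T}"
  shows "g t = (0::real)"
proof (rule continuous_AE_zero[OF T g _ t])
  have "AE t in lborel. t \<in> box 0 T \<longrightarrow> g t = 0"
  proof (rule integrable_vanishes_on_box)
    show "integrable lborel (\<lambda>t. g t * indicator (box 0 T) t)"
      using continuous_on_integrable_Ioo[OF g] by (simp add: box_real mult.commute)
    fix \<theta> assume "test_function (box 0 T) \<theta>"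
    then have th: "test_function {0<..<T} \<theta>" by (simp add: box_real)
    obtain K where K: "K \<subseteq> {0<..<T}" "\<And>x. x \<notin> K \<Longrightarrow> \<theta> x = 0" using test_functionD[OF th] by metis
    have "indicator {0<..<T} t * (\<theta> t * g t) = g t * \<theta> t" for t
      using K(1) K(2)[of t] by (cases "t \<in> K") auto
    then have "(\<lambda>t. indicator {0<..<T} t * (\<theta> t * g t)) = (\<lambda>t. g t * \<theta> t)" by (intro ext)
    then show "(LINT t|lborel. g t * \<theta> t) = 0" using 0[OF th] by presburger
  qed
  then show "AE t in lborel. t \<in> {0<..<T} \<longrightarrow> g t = 0" by (simp add: box_real)
qed

lemma curve_distr_UNIV:
  "curve_distr T UNIV u \<phi> = (LINT t|lborel. indicator {0<..<T} t * (LINT x|lborel. u t x * \<phi> (t, x)))"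
  by (simp add: curve_distr_def set_lebesgue_integral_def)

lemma sum_Basis_axis: "(\<Sum>b\<in>(Basis::(real^'d::finite) set). f b) = (\<Sum>i\<in>UNIV. f (axis i 1))"
proof -
  have B: "(Basis::(real^'d) set) = (\<lambda>i. axis i 1) ` UNIV" by (auto simp: Basis_vec_def)
  have "inj (\<lambda>i::'d. axis i (1::real))" by (auto simp: inj_def axis_eq_axis)
  then show ?thesis unfolding B by (subst sum.reindex) auto
qed

text \<open>The interface between the strip problem and the modal calculus: all functions are
  extended by zero, the equations are already tested with products of a function of
  \<open>(t, X)\<close> and a vertical profile, and each coefficient is given as an integral against
  its dual profile.\<close>

locale modal_system = mode_profile H grav c R Rp A F G R0 m
  for H grav :: real and c :: "nat \<Rightarrow> real" and R Rp :: "real \<Rightarrow> real"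
    and A :: "nat \<Rightarrow> real" and F G :: "nat \<Rightarrow> real \<Rightarrow> real" and R0 m :: real +
  fixes T :: real and v :: "'d::finite \<Rightarrow> real \<Rightarrow> (real^'d) \<times> real \<Rightarrow> real"
    and w r P :: "real \<Rightarrow> (real^'d) \<times> real \<Rightarrow> real"
    and vn :: "'d \<Rightarrow> nat \<Rightarrow> real \<Rightarrow> real^'d \<Rightarrow> real" and wn rn Pn :: "nat \<Rightarrow> real \<Rightarrow> real^'d \<Rightarrow> real"
  assumes T_pos: "T > 0"
    and curves: "\<And>i. C_L2 T UNIV (v i)" "C_L2 T UNIV w" "C_L2 T UNIV r" "C_L2 T UNIV P"
    and outside: "\<And>i t p. p \<notin> strip H \<Longrightarrow> v i t p = 0" "\<And>t p. p \<notin> strip H \<Longrightarrow> w t p = 0"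
      "\<And>t p. p \<notin> strip H \<Longrightarrow> r t p = 0" "\<And>t p. p \<notin> strip H \<Longrightarrow> P t p = 0"
    and eq_V: "\<And>\<phi> e i. test_function ({0<..<T} \<times> UNIV) \<phi> \<Longrightarrow> test_function {-H<..<0} e \<Longrightarrow>
      pair_strip T (v i) (dirderiv (1, 0) \<phi>) e + pair_strip T P (dirderiv (0, axis i 1) \<phi>) (\<lambda>z. e z / R z) = 0"
    and eq_w: "\<And>\<phi> e. test_function ({0<..<T} \<times> UNIV) \<phi> \<Longrightarrow> test_function {-H<..<0} e \<Longrightarrow>
      - pair_strip T w (dirderiv (1, 0) \<phi>) e - pair_strip T P \<phi> (\<lambda>z. deriv e z / R z)
        + pair_strip T P \<phi> (\<lambda>z. e z * (Rp z / (R z)\<^sup>2)) + pair_strip T r \<phi> (\<lambda>z. e z * (grav / R z)) = 0"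
    and eq_r: "\<And>\<phi> e. test_function ({0<..<T} \<times> UNIV) \<phi> \<Longrightarrow> test_function {-H<..<0} e \<Longrightarrow>
      pair_strip T r (dirderiv (1, 0) \<phi>) e - pair_strip T w \<phi> (\<lambda>z. e z * Rp z) = 0"
    and eq_div: "\<And>\<phi> e. test_function ({0<..<T} \<times> UNIV) \<phi> \<Longrightarrow> test_function {-H<..<0} e \<Longrightarrow>
      (\<Sum>i\<in>UNIV. pair_strip T (v i) (dirderiv (0, axis i 1) \<phi>) e) + pair_strip T w \<phi> (deriv e) = 0"
    and eq_curl: "\<And>\<phi> e i j. test_function ({0<..<T} \<times> UNIV) \<phi> \<Longrightarrow> test_function {-H<..<0} e \<Longrightarrow>
      pair_strip T (v j) (dirderiv (0, axis i 1) \<phi>) e - pair_strip T (v i) (dirderiv (0, axis j 1) \<phi>) e = 0"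
    and traces: "\<And>t. t \<in> {0..T} \<Longrightarrow> zero_traces H (w t)"
    and coef_borel: "\<And>t i n. t \<in> {0..T} \<Longrightarrow> vn i n t \<in> borel_measurable borel"
      "\<And>t n. t \<in> {0..T} \<Longrightarrow> n \<ge> 1 \<Longrightarrow> wn n t \<in> borel_measurable borel"
      "\<And>t n. t \<in> {0..T} \<Longrightarrow> n \<ge> 1 \<Longrightarrow> rn n t \<in> borel_measurable borel"
      "\<And>t n. t \<in> {0..T} \<Longrightarrow> Pn n t \<in> borel_measurable borel"
    and coef: "\<And>t i n. t \<in> {0..T} \<Longrightarrow>
        AE X in lborel. vn i n t X = (LINT z|lborel. v i t (X, z) * (indicator {-H<..<0} z * G n z))"
      "\<And>t n. t \<in> {0..T} \<Longrightarrow> n \<ge> 1 \<Longrightarrow> AE X in lborel. wn n t X = (LINT z|lborel. w t (X, z) * (- grav * Rp z * F n z))"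
      "\<And>t n. t \<in> {0..T} \<Longrightarrow> n \<ge> 1 \<Longrightarrow> AE X in lborel. rn n t X = (LINT z|lborel. r t (X, z) * (grav * F n z))"
      "\<And>t n. t \<in> {0..T} \<Longrightarrow> AE X in lborel. Pn n t X = (LINT z|lborel. P t (X, z) * (indicator {-H<..<0} z * G n z / R z))"
begin

abbreviation Dt :: "(real \<times> (real^'d) \<Rightarrow> real) \<Rightarrow> real \<times> (real^'d) \<Rightarrow> real" where
  "Dt \<equiv> dirderiv (1, 0)"

abbreviation Dx :: "'d \<Rightarrow> (real \<times> (real^'d) \<Rightarrow> real) \<Rightarrow> real \<times> (real^'d) \<Rightarrow> real" where
  "Dx i \<equiv> dirderiv (0, axis i 1)"

abbreviation test :: "(real \<times> (real^'d) \<Rightarrow> real) \<Rightarrow> bool" where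
  "test \<phi> \<equiv> test_function ({0<..<T} \<times> UNIV) \<phi>"

lemma test_D: "test \<phi> \<Longrightarrow> test (dirderiv x \<phi>)"
  by (rule test_function_dirderiv)

section \<open>Testing the strip equations with nonsmooth profiles\<close>

lemma pair_strip_I:
  assumes "\<And>t p. p \<notin> strip H \<Longrightarrow> u t p = 0"
  shows "pair_strip T u \<phi> (\<lambda>z. e z * I z) = pair_strip T u \<phi> e"
proof -
  have eq: "u t p * (\<phi> (t, fst p) * (e (snd p) * I (snd p))) = u t p * (\<phi> (t, fst p) * e (snd p))" for t p
    using assms[of p t] by (cases "p \<in> strip H") (auto simp: strip_def)
  show ?thesis unfolding pair_strip_alt eq ..
qed

lemma strip_I:
  "pair_strip T (v i) \<phi> (\<lambda>z. e z * I z) = pair_strip T (v i) \<phi> e"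
  "pair_strip T w \<phi> (\<lambda>z. e z * I z) = pair_strip T w \<phi> e"
  "pair_strip T r \<phi> (\<lambda>z. e z * I z) = pair_strip T r \<phi> e"
  "pair_strip T P \<phi> (\<lambda>z. e z * I z) = pair_strip T P \<phi> e"
  by (rule pair_strip_I, erule outside)+

lemma outside_all:
  "\<forall>p. p \<notin> strip H \<longrightarrow> v i t p = 0" "\<forall>p. p \<notin> strip H \<longrightarrow> w t p = 0"
  using outside by auto

lemma bcl_pair: "C_L2 T UNIV u \<Longrightarrow> test \<phi> \<Longrightarrow> bcl (\<lambda>h. pair_strip T u \<phi> (\<lambda>z. h z * I z))"
  by (rule bcl_pair_strip[OF T_pos])

lemma bcl_pair_mult:
  assumes "C_L2 T UNIV u" "test \<phi>" "bnd_borel k" shows "bcl (\<lambda>h. pair_strip T u \<phi> (\<lambda>z. h z * k z * I z))"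
  by (rule bcl_compose_mult[OF bcl_pair[OF assms(1,2)] assms(3)])

lemma bcl_vanishes_I:
  assumes "bcl S" "\<And>e. test_function {-H<..<0} e \<Longrightarrow> S e = 0" "bnd_borel h"
  shows "S (\<lambda>z. h z * I z) = 0"
  using bcl_vanishes[OF assms(1), of "-H" 0 h] assms(2,3) by (simp add: box_real)

lemma II: "x * I z * I z = x * I z" "x * I z * y * I z = x * y * I z"
  by (auto simp: indicator_def)

text \<open>No vertical derivative falls on the profile, so \<open>bcl_vanishes\<close> alone
  extends the equation from smooth profiles to bounded Borel ones; the equations for the density and
  the curl are treated in the same way.\<close>

lemma eq_V_ext:
  assumes \<phi>: "test \<phi>" and e: "bnd_borel e"
  shows "pair_strip T (v i) (Dt \<phi>) e + pair_strip T P (Dx i \<phi>) (\<lambda>z. e z / R z) = 0"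
proof -
  let ?S = "\<lambda>h. pair_strip T (v i) (Dt \<phi>) (\<lambda>z. h z * I z) + 1 * pair_strip T P (Dx i \<phi>) (\<lambda>z. h z * (1 / R z) * I z)"
  have "?S (\<lambda>z. e z * I z) = 0"
  proof (rule bcl_vanishes_I[where S = ?S, OF _ _ e])
    show "bcl ?S" by (intro bcl_plus bcl_pair bcl_pair_mult curves test_D \<phi> inverse_R_bb)
    show "?S e = 0" if "test_function {-H<..<0} e" for e
      using eq_V[OF \<phi> that, of i] unfolding strip_I by simp
  qed
  then show ?thesis
    unfolding II strip_I by simp
qed

lemma eq_r_ext:
  assumes \<phi>: "test \<phi>" and e: "bnd_borel e"
  shows "pair_strip T r (Dt \<phi>) e = pair_strip T w \<phi> (\<lambda>z. e z * Rp z)"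
proof -
  let ?S = "\<lambda>h. pair_strip T r (Dt \<phi>) (\<lambda>z. h z * I z) + (-1) * pair_strip T w \<phi> (\<lambda>z. h z * Rp z * I z)"
  have "?S (\<lambda>z. e z * I z) = 0"
  proof (rule bcl_vanishes_I[where S = ?S, OF _ _ e])
    show "bcl ?S" by (intro bcl_plus bcl_pair bcl_pair_mult curves test_D \<phi> Rp_bb)
    show "?S e = 0" if "test_function {-H<..<0} e" for e
      using eq_r[OF \<phi> that] unfolding strip_I by simp
  qed
  then show ?thesis
    unfolding II strip_I by simp
qed

lemma eq_curl_ext:
  assumes \<phi>: "test \<phi>" and e: "bnd_borel e"
  shows "pair_strip T (v j) (Dx i \<phi>) e = pair_strip T (v i) (Dx j \<phi>) e"
proof -
  let ?S = "\<lambda>h. pair_strip T (v j) (Dx i \<phi>) (\<lambda>z. h z * I z) + (-1) * pair_strip T (v i) (Dx j \<phi>) (\<lambda>z. h z * I z)"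
  have "?S (\<lambda>z. e z * I z) = 0"
  proof (rule bcl_vanishes_I[where S = ?S, OF _ _ e])
    show "bcl ?S" by (intro bcl_plus bcl_pair curves test_D \<phi>)
    show "?S e = 0" if "test_function {-H<..<0} e" for e
      using eq_curl[OF \<phi> that, of j i] unfolding strip_I by simp
  qed
  then show ?thesis unfolding II strip_I by simp
qed

text \<open>The primitive \<open>R F\<^sub>n\<close> vanishes at both ends, so the weak equation for \<open>w\<close> needs no boundary condition.\<close>

lemma eq_w_ext:
  assumes \<phi>: "test \<phi>" and n: "n \<ge> 1"
  shows "- pair_strip T w (Dt \<phi>) (\<lambda>z. R z * F n z) - pair_strip T P \<phi> (\<lambda>z. I z * G n z / R z) / c n
    + pair_strip T r \<phi> (\<lambda>z. grav * F n z) = 0"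
proof -
  let ?F1 = "\<lambda>h. (0 + (-1) * pair_strip T w (Dt \<phi>) (\<lambda>z. h z * I z)
    + 1 * pair_strip T P \<phi> (\<lambda>z. h z * (Rp z / (R z)\<^sup>2) * I z)) + 1 * pair_strip T r \<phi> (\<lambda>z. h z * (grav / R z) * I z)"
  let ?F2 = "\<lambda>h. 0 + (-1) * pair_strip T P \<phi> (\<lambda>z. h z * (1 / R z) * I z)"
  let ?s = "\<lambda>z. I z * (G n z / (c n * R z))"
  \<comment> \<open>The product rule for \<open>R * F n\<close>; \<open>R\<close> has derivative
    \<open>Rp\<close> and \<open>F n\<close> has derivative \<open>?s\<close>.\<close>
  let ?q = "\<lambda>z. Rp z * prim ?s z + (R0 + prim Rp z) * ?s z"
  have z0: "bcl (\<lambda>h::real \<Rightarrow> real. 0)" by (rule bclI) auto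
  have k1: "bnd_borel (\<lambda>z. Rp z / (R z)\<^sup>2)"
    using divide_R_bb[OF divide_R_bb[OF Rp_bb]] by (simp add: power2_eq_square)
  have k2: "bnd_borel (\<lambda>z. grav / R z)" using divide_R_bb[OF bnd_borel_const[of grav]] .
  have F1: "bcl ?F1"
    by (intro bcl_plus z0 bcl_pair bcl_pair_mult curves test_D \<phi> k1 k2)
  have F2: "bcl ?F2" by (intro bcl_plus z0 bcl_pair_mult curves \<phi> inverse_R_bb)
  have Rz: "R y = R0 + prim Rp y" for y using R_prim by (rule fun_cong)
  have prim_s: "prim ?s = F n" by (rule F_prim[OF n, symmetric])
  have pq: "prim ?q z = R z * F n z" for z
  proof -
    have "(R0 + prim Rp z) * prim ?s z = prim ?q z"
      by (rule prim_product_zero_ends(1)[OF Rp_integrable F'_integrable Rp_outside _ F_total[OF n]]) auto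
    then show ?thesis unfolding prim_s Rz[symmetric] by (rule sym)
  qed
  have "?F1 (prim ?q) + ?F2 ?q = 0"
  proof (rule weak_equation_extend[where a = "-H" and b = 0 and ?F1.0 = ?F1 and ?F2.0 = ?F2, OF _ F1 F2])
    show "?F2 (\<lambda>x. h x * I x) = ?F2 h" for h unfolding II ..
    show "?F1 e + ?F2 (deriv e) = 0" if "test_function {-H<..<0} e" for e
      using eq_w[OF \<phi> that] unfolding strip_I by simp
    show "(LINT y|lborel. ?q y) = 0"
      by (rule prim_product_zero_ends(2)[OF Rp_integrable F'_integrable Rp_outside _ F_total[OF n]]) auto
    show "bnd_borel ?q"
      by (intro bnd_borel_add bnd_borel_mult Rp_bb F'_bb bnd_borel_const bnd_borel_prim F'_integrable Rp_integrable)
    show "?q y = 0" if "y \<notin> {-H<..<0}" for y using that Rp_outside by simp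
  qed (use H_pos in simp)
  then have "- pair_strip T w (Dt \<phi>) (\<lambda>z. R z * F n z) + pair_strip T P \<phi> (\<lambda>z. R z * F n z * (Rp z / (R z)\<^sup>2))
    + pair_strip T r \<phi> (\<lambda>z. R z * F n z * (grav / R z)) - pair_strip T P \<phi> (\<lambda>z. ?q z * (1 / R z)) = 0"
    unfolding pq strip_I by simp
  \<comment> \<open>The factor \<open>R\<close> in the test profile is chosen so that the buoyancy
    term meets \<open>grav * F n\<close>, the profile that extracts the modal coefficient of the
    density.\<close>
  moreover have "(\<lambda>z. R z * F n z * (grav / R z)) = (\<lambda>z. grav * F n z)" using R_pos by (auto simp: less_imp_neq[symmetric])
  \<comment> \<open>The part of \<open>?q\<close> coming from the derivative of \<open>R\<close>
    reproduces the correction term hidden in the product of \<open>1 / \<rho>eq\<close> and the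
    vertical pressure derivative. The two cancel and only the profile of the pressure coefficient
    survives.\<close>
  moreover have "pair_strip T P \<phi> (\<lambda>z. ?q z * (1 / R z)) =
    pair_strip T P \<phi> (\<lambda>z. R z * F n z * (Rp z / (R z)\<^sup>2)) + (1 / c n) * pair_strip T P \<phi> (\<lambda>z. I z * G n z / R z)"
  proof -
    have e: "(\<lambda>z. ?q z * (1 / R z)) = (\<lambda>z. R z * F n z * (Rp z / (R z)\<^sup>2) + (1 / c n) * (I z * G n z / R z))"
    proof
      fix z
      have "R z \<noteq> 0" "c n \<noteq> 0" using R_pos[of z] c_pos[OF n] by auto
      then show "?q z * (1 / R z) = R z * F n z * (Rp z / (R z)\<^sup>2) + (1 / c n) * (I z * G n z / R z)"
        unfolding prim_s Rz[symmetric] by (simp add: field_simps power2_eq_square)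
    qed
    show ?thesis unfolding e
    proof (rule pair_strip_lin[OF curves(4) \<phi>])
      show "sq_int (\<lambda>z. R z * F n z * (Rp z / (R z)\<^sup>2))"
        by (intro sq_int_supported bnd_borel_mult R_bb F_bb n k1) (use Rp_outside in simp)
      show "sq_int (\<lambda>z. I z * G n z / R z)"
        by (intro sq_int_supported divide_R_bb bnd_borel_mult I_bb G_bb) simp
    qed
  qed
  ultimately show ?thesis by simp
qed

section \<open>Equations for the modal coefficients\<close>

lemma sq_int_G: "sq_int (\<lambda>z. I z * G n z)" "sq_int (\<lambda>z. I z * G n z / R z)"
  by (intro sq_int_supported divide_R_bb bnd_borel_mult I_bb G_bb; simp)+

lemma sq_int_F: "n \<ge> 1 \<Longrightarrow> sq_int (\<lambda>z. - grav * Rp z * F n z)" "n \<ge> 1 \<Longrightarrow> sq_int (\<lambda>z. grav * F n z)"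
  by (intro sq_int_supported bnd_borel_mult bnd_borel_cmult Rp_bb F_bb; simp add: Rp_outside F_outside)+

lemma coef_distr:
  "test \<phi> \<Longrightarrow> curve_distr T UNIV (vn i n) \<phi> = pair_strip T (v i) \<phi> (\<lambda>z. I z * G n z)"
  "test \<phi> \<Longrightarrow> k \<ge> 1 \<Longrightarrow> curve_distr T UNIV (wn k) \<phi> = pair_strip T w \<phi> (\<lambda>z. - grav * Rp z * F k z)"
  "test \<phi> \<Longrightarrow> k \<ge> 1 \<Longrightarrow> curve_distr T UNIV (rn k) \<phi> = pair_strip T r \<phi> (\<lambda>z. grav * F k z)"
  "test \<phi> \<Longrightarrow> curve_distr T UNIV (Pn n) \<phi> = pair_strip T P \<phi> (\<lambda>z. I z * G n z / R z)"
  by (rule coefficient_curve_distr[OF curves(1) _ sq_int_G(1) coef_borel(1) coef(1)], assumption+)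
     (rule coefficient_curve_distr[OF curves(2) _ sq_int_F(1) coef_borel(2) coef(2)], assumption+,
      rule coefficient_curve_distr[OF curves(3) _ sq_int_F(2) coef_borel(3) coef(3)], assumption+,
      rule coefficient_curve_distr[OF curves(4) _ sq_int_G(2) coef_borel(4) coef(4)], assumption+)

text \<open>The equation is diagonal because one profile serves both terms: \<open>G n\<close>
  extracts the velocity coefficient, and the factor \<open>1 / R\<close> of the pressure term turns
  it into the profile that extracts the pressure coefficient.\<close>

lemma mode_V:
  assumes "test \<phi>" shows "curve_distr T UNIV (vn i n) (Dt \<phi>) + curve_distr T UNIV (Pn n) (Dx i \<phi>) = 0"
proof -
  have "(\<lambda>z. I z * G n z) = (\<lambda>z. G n z * I z)" "(\<lambda>z. I z * G n z / R z) = (\<lambda>z. (G n z / R z) * I z)"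
    by (auto simp: ac_simps)
  then show ?thesis using eq_V_ext[OF assms G_bb, of i n]
    unfolding coef_distr(1)[OF test_D[OF assms]] coef_distr(4)[OF test_D[OF assms]] by (simp only: strip_I)
qed

text \<open>The profile \<open>grav * F n\<close> extracts the density coefficient; multiplied by
  \<open>Rp\<close> it is minus the profile extracting the coefficient of \<open>w\<close>, hence
  the sign.\<close>

lemma mode_r:
  assumes "test \<phi>" "n \<ge> 1" shows "curve_distr T UNIV (rn n) (Dt \<phi>) = - curve_distr T UNIV (wn n) \<phi>"
proof -
  have "pair_strip T w \<phi> (\<lambda>z. 0 + (-1) * (- grav * Rp z * F n z)) = pair_strip T w \<phi> (\<lambda>z. 0) + (-1) * pair_strip T w \<phi> (\<lambda>z. - grav * Rp z * F n z)"
    by (rule pair_strip_lin[OF curves(2) assms(1) sq_int_0 sq_int_F(1)[OF assms(2)]])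
  moreover have "pair_strip T w \<phi> (\<lambda>z. 0) = 0" by (simp add: pair_strip_alt)
  moreover have "(\<lambda>z. 0 + (-1) * (- grav * Rp z * F n z)) = (\<lambda>z. grav * F n z * Rp z)" by auto
  moreover have "pair_strip T r (Dt \<phi>) (\<lambda>z. grav * F n z) = pair_strip T w \<phi> (\<lambda>z. grav * F n z * Rp z)"
    by (rule eq_r_ext[OF assms(1) bnd_borel_cmult[OF F_bb[OF assms(2)]]])
  ultimately show ?thesis
    unfolding coef_distr(2)[OF assms] coef_distr(3)[OF test_D[OF assms(1)] assms(2)] by simp
qed

lemma mode_curl:
  assumes "test \<phi>" shows "curve_distr T UNIV (vn j n) (Dx i \<phi>) = curve_distr T UNIV (vn i n) (Dx j \<phi>)"
  using eq_curl_ext[OF assms bnd_borel_mult[OF I_bb G_bb]] by (simp add: coef_distr test_D assms)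

text \<open>The term with \<open>w\<close> is not yet modal, since \<open>R * F n\<close> is not one
  of the profiles that extract coefficients of \<open>w\<close>. This mismatch of weights couples
  the modes.\<close>

lemma mode_P:
  assumes "test \<phi>" "n \<ge> 1"
  shows "- pair_strip T w (Dt \<phi>) (\<lambda>z. R z * F n z) = curve_distr T UNIV (Pn n) \<phi> / c n - curve_distr T UNIV (rn n) \<phi>"
  using eq_w_ext[OF assms] unfolding coef_distr(3)[OF assms] coef_distr(4)[OF assms(1)] by simp

text \<open>The expansion of \<open>R * F n\<close> in the extracting profiles of \<open>w\<close>
  converges in mean square, and pairings are continuous for that convergence.\<close>

lemma mode_w_expansion:
  assumes \<phi>: "test \<phi>" and n: "n \<ge> 1"
  shows "(\<lambda>k. (LINT y|lborel. F (Suc k) y * F n y * R y) * curve_distr T UNIV (wn (Suc k)) \<phi>)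
    sums pair_strip T w \<phi> (\<lambda>z. R z * F n z)"
proof -
  define a where "a k = (LINT y|lborel. F k y * F n y * R y)" for k
  define e where "e K z = (\<Sum>k=1..K. a k * (- grav * Rp z * F k z))" for K :: nat and z
  have se: "sq_int (e K)" for K unfolding e_def[abs_def]
    by (intro sq_int_sum sq_int_cmult sq_int_F) auto
  have "(\<lambda>K. pair_strip T w \<phi> (e K)) \<longlonglongrightarrow> pair_strip T w \<phi> (\<lambda>z. R z * F n z)"
  proof (rule pair_strip_L2_limit[OF T_pos curves(2) \<phi> se])
    show "sq_int (\<lambda>z. R z * F n z)"
      by (intro sq_int_supported bnd_borel_mult R_bb F_bb n) (use F_outside n in simp)
    have "sqn (\<lambda>z. e K z - R z * F n z) = sqn (\<lambda>z. R z * F n z - e K z)" for K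
      unfolding sqn_def by (simp add: power2_commute)
    then show "(\<lambda>K. sqn (\<lambda>z. e K z - R z * F n z)) \<longlonglongrightarrow> 0"
      using F_complete[OF n] unfolding e_def a_def by simp
  qed
  \<comment> \<open>The modes start at 1, whereas series start at 0; the shift by \<open>Suc\<close>
    matches partial sums up to \<open>K\<close> with sums over \<open>k < K\<close>.\<close>
  moreover have "pair_strip T w \<phi> (e K) = (\<Sum>k<K. a (Suc k) * curve_distr T UNIV (wn (Suc k)) \<phi>)" for K
  proof (induction K)
    case 0
    show ?case by (simp add: e_def pair_strip_alt)
  next
    case (Suc K)
    have "e (Suc K) = (\<lambda>z. e K z + a (Suc K) * (- grav * Rp z * F (Suc K) z))" by (auto simp: e_def)
    then have "pair_strip T w \<phi> (e (Suc K)) = pair_strip T w \<phi> (e K) + a (Suc K) * pair_strip T w \<phi> (\<lambda>z. - grav * Rp z * F (Suc K) z)"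
      using pair_strip_lin[OF curves(2) \<phi> se sq_int_F(1), of "Suc K" K "a (Suc K)"] by simp
    then show ?case using Suc coef_distr(2)[OF \<phi>, of "Suc K"] by simp
  qed
  ultimately show ?thesis unfolding sums_def a_def by simp
qed

subsection \<open>The divergence equation at fixed times\<close>

abbreviation slice :: "((real^'d) \<times> real \<Rightarrow> real) \<Rightarrow> ((real^'d) \<Rightarrow> real) \<Rightarrow> real \<Rightarrow> real" where
  "slice u \<eta> z \<equiv> (LINT X|lborel. u (X, z) * \<eta> X)"

text \<open>The trace condition concerns horizontal averages of \<open>w\<close> as functions of
  \<open>z\<close>, so the integration in \<open>X\<close> has to be carried out first.\<close>

lemma slice_pairing:
  assumes u: "sq_int u" "\<forall>p. p \<notin> strip H \<longrightarrow> u p = 0" and \<eta>: "sq_int \<eta>"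
  shows "integrable lborel (slice u \<eta>)" "\<And>z. z \<notin> {-H<..<0} \<Longrightarrow> slice u \<eta> z = 0"
    "bnd_borel e \<Longrightarrow> (LINT p|lborel. u p * (\<eta> (fst p) * (e (snd p) * I (snd p)))) = (LINT z|lborel. slice u \<eta> z * e z)"
proof -
  show s0: "slice u \<eta> z = 0" if "z \<notin> {-H<..<0}" for z
  proof -
    have "u (X, z) = 0" for X using u(2) that by (auto simp: strip_def)
    then show ?thesis by simp
  qed
  have main: "integrable lborel (\<lambda>z. slice u \<eta> z * e z)"
    "(LINT p|lborel. u p * (\<eta> (fst p) * (e (snd p) * I (snd p)))) = (LINT z|lborel. slice u \<eta> z * e z)" if e: "bnd_borel e" for e
  proof -
    have k: "sq_int (\<lambda>z. e z * I z)" by (intro sq_int_supported bnd_borel_mult I_bb e) simp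
    have i: "integrable lborel (\<lambda>p. u p * (\<eta> (fst p) * (e (snd p) * I (snd p))))"
      by (rule sq_int_mult[OF u(1) sq_int_tensor(1)[OF \<eta> k]])
    then have i': "integrable (lborel \<Otimes>\<^sub>M lborel) (\<lambda>(X, z). u (X, z) * (\<eta> X * (e z * I z)))"
      by (simp add: lborel_prod case_prod_beta')
    have in1: "(LINT X|lborel. u (X, z) * (\<eta> X * (e z * I z))) = slice u \<eta> z * e z" for z
    proof -
      have "(\<lambda>X. u (X, z) * (\<eta> X * (e z * I z))) = (\<lambda>X. (u (X, z) * \<eta> X) * (e z * I z))" by (simp add: ac_simps)
      then have "(LINT X|lborel. u (X, z) * (\<eta> X * (e z * I z))) = slice u \<eta> z * (e z * I z)" by simp
      then show ?thesis using s0[of z] by (cases "z \<in> {-H<..<0}") auto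
    qed
    show "integrable lborel (\<lambda>z. slice u \<eta> z * e z)"
      using lborel_pair.integrable_snd[OF i'] unfolding in1 .
    have "(LINT z|lborel. LINT X|lborel. u (X, z) * (\<eta> X * (e z * I z))) = (LINT p|(lborel \<Otimes>\<^sub>M lborel). (\<lambda>(X, z). u (X, z) * (\<eta> X * (e z * I z))) p)"
      by (rule lborel_pair.integral_snd[OF i'])
    then show "(LINT p|lborel. u p * (\<eta> (fst p) * (e (snd p) * I (snd p)))) = (LINT z|lborel. slice u \<eta> z * e z)"
      unfolding in1 by (simp add: lborel_prod case_prod_beta')
  qed
  show "integrable lborel (slice u \<eta>)" using main(1)[OF bnd_borel_const[of 1]] by simp
  show "bnd_borel e \<Longrightarrow> (LINT p|lborel. u p * (\<eta> (fst p) * (e (snd p) * I (snd p)))) = (LINT z|lborel. slice u \<eta> z * e z)"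
    by (rule main(2))
qed

lemma pair_strip_tensor:
  "pair_strip T u (\<lambda>p. \<theta> (fst p) * \<eta> (snd p)) e
    = (LINT t|lborel. indicator {0<..<T} t * (\<theta> t * (LINT p|lborel. u t p * (\<eta> (fst p) * e (snd p)))))"
proof -
  have "(\<lambda>p. u t p * (\<theta> t * \<eta> (fst p) * e (snd p))) = (\<lambda>p. \<theta> t * (u t p * (\<eta> (fst p) * e (snd p))))" for t
    by (simp add: ac_simps)
  then show ?thesis unfolding pair_strip_alt by simp
qed

text \<open>Traces vanish at each single time, so the divergence equation is needed there too. Test
  functions of the form \<open>\<theta>\<close> of \<open>t\<close> times \<open>\<eta>\<close> of
  \<open>X\<close> isolate the time integral, and \<open>continuous_weak_zero\<close> removes
  it.\<close>

lemma eq_div_slice: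
  assumes \<eta>: "test_function UNIV \<eta>" and e: "test_function {-H<..<0} e" and t: "t \<in> {0..T}"
  shows "(\<Sum>i\<in>UNIV. LINT z|lborel. slice (v i t) (dirderiv (axis i 1) \<eta>) z * e z)
    + (LINT z|lborel. slice (w t) \<eta> z * deriv e z) = 0"
proof -
  have se: "sq_int e" and sd: "sq_int (deriv e)" using sq_int_test_function e test_function_deriv[OF e] by blast+
  have sD: "sq_int (dirderiv (axis i 1) \<eta>)" for i by (rule sq_int_test_function[OF test_function_dirderiv[OF \<eta>]])
  let ?L = "\<lambda>u \<eta> e t. LINT p|lborel. u t p * (\<eta> (fst p) * e (snd p))"
  let ?g = "\<lambda>t. (\<Sum>i\<in>UNIV. ?L (v i) (dirderiv (axis i 1) \<eta>) e t) + ?L w \<eta> (deriv e) t"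
  have cont: "continuous_on {0..T} (?L u \<eta> e)" if "C_L2 T UNIV u" "sq_int \<eta>" "sq_int e"
    for u :: "real \<Rightarrow> (real^'d) \<times> real \<Rightarrow> real" and \<eta> e
    by (rule C_L2_pairing[OF that(1) C_L2_const[OF sq_int_tensor(1)[OF that(2,3)]]])
  have "?g t = 0"
  proof (rule continuous_weak_zero[OF T_pos _ _ t])
    show "continuous_on {0..T} ?g"
      by (intro continuous_intros cont curves sD se sd sq_int_test_function[OF \<eta>])
    fix \<theta> assume th: "test_function {0<..<T} \<theta>"
    have tt: "test (\<lambda>p. \<theta> (fst p) * \<eta> (snd p))" by (rule test_function_tensor[OF th \<eta>])
    have D: "Dx i (\<lambda>p. \<theta> (fst p) * \<eta> (snd p)) = (\<lambda>p. \<theta> (fst p) * dirderiv (axis i 1) \<eta> (snd p))" for i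
      by (rule ext) (use dirderiv_tensor[OF th \<eta>] in \<open>auto split: prod.split\<close>)
    have int: "integrable lborel (\<lambda>t. indicator {0<..<T} t * (\<theta> t * ?L u \<eta> e t))"
      if "C_L2 T UNIV u" "sq_int \<eta>" "sq_int e" for u :: "real \<Rightarrow> (real^'d) \<times> real \<Rightarrow> real" and \<eta> e
      by (rule continuous_on_integrable_Ioo)
         (intro continuous_intros cont that continuous_on_subset[OF test_function_continuous[OF th]], simp)
    have "(LINT t|lborel. indicator {0<..<T} t * (\<theta> t * ?g t))
      = (LINT t|lborel. (\<Sum>i\<in>UNIV. indicator {0<..<T} t * (\<theta> t * ?L (v i) (dirderiv (axis i 1) \<eta>) e t))
          + indicator {0<..<T} t * (\<theta> t * ?L w \<eta> (deriv e) t))"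
      by (rule Bochner_Integration.integral_cong) (simp_all add: distrib_left sum_distrib_left)
    also have "\<dots> = (LINT t|lborel. (\<Sum>i\<in>UNIV. indicator {0<..<T} t * (\<theta> t * ?L (v i) (dirderiv (axis i 1) \<eta>) e t)))
          + (LINT t|lborel. indicator {0<..<T} t * (\<theta> t * ?L w \<eta> (deriv e) t))"
      by (rule Bochner_Integration.integral_add[OF Bochner_Integration.integrable_sum[OF int[OF curves(1) sD se]]
            int[OF curves(2) sq_int_test_function[OF \<eta>] sd]])
    also have "(LINT t|lborel. (\<Sum>i\<in>UNIV. indicator {0<..<T} t * (\<theta> t * ?L (v i) (dirderiv (axis i 1) \<eta>) e t)))
        = (\<Sum>i\<in>UNIV. LINT t|lborel. indicator {0<..<T} t * (\<theta> t * ?L (v i) (dirderiv (axis i 1) \<eta>) e t))"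
      by (rule Bochner_Integration.integral_sum[OF int[OF curves(1) sD se]])
    also have "(\<Sum>i\<in>UNIV. LINT t|lborel. indicator {0<..<T} t * (\<theta> t * ?L (v i) (dirderiv (axis i 1) \<eta>) e t))
          + (LINT t|lborel. indicator {0<..<T} t * (\<theta> t * ?L w \<eta> (deriv e) t)) = 0"
      using eq_div[OF tt e] unfolding D pair_strip_tensor .
    finally show "(LINT t|lborel. indicator {0<..<T} t * (\<theta> t * ?g t)) = 0" .
  qed
  moreover have "?L u \<eta> e t = (LINT z|lborel. slice (u t) \<eta> z * e z)"
    if "sq_int (u t)" "\<forall>p. p \<notin> strip H \<longrightarrow> u t p = 0" "sq_int \<eta>" "bnd_borel e"
    for u :: "real \<Rightarrow> (real^'d) \<times> real \<Rightarrow> real" and \<eta> e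
  proof -
    have eq: "u t p * (\<eta> (fst p) * (e (snd p) * I (snd p))) = u t p * (\<eta> (fst p) * e (snd p))" for p
      using that(2)[rule_format, of p] by (cases "p \<in> strip H") (auto simp: strip_def)
    show ?thesis using slice_pairing(3)[OF that(1,2,3,4)] unfolding eq .
  qed
  ultimately show ?thesis
    using C_L2_sq_int[OF curves(1) t] C_L2_sq_int[OF curves(2) t] outside_all sD sq_int_test_function[OF \<eta>]
      bnd_borel_test_function[OF e] bnd_borel_test_function[OF test_function_deriv[OF e]] by simp
qed

text \<open>The vanishing traces of \<open>w\<close> allow for profiles that do not vanish at the ends.\<close>

lemma eq_div_ends:
  assumes \<eta>: "test_function UNIV \<eta>" and q: "bnd_borel q" "\<And>y. y \<notin> {-H<..<0} \<Longrightarrow> q y = 0" and t: "t \<in> {0..T}"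
  shows "(\<Sum>i\<in>UNIV. LINT p|lborel. v i t p * (dirderiv (axis i 1) \<eta> (fst p) * ((a + prim q (snd p)) * I (snd p))))
    + (LINT p|lborel. w t p * (\<eta> (fst p) * (q (snd p) * I (snd p)))) = 0"
proof -
  have sD: "sq_int (dirderiv (axis i 1) \<eta>)" for i by (rule sq_int_test_function[OF test_function_dirderiv[OF \<eta>]])
  note sv = slice_pairing[OF C_L2_sq_int[OF curves(1) t] outside_all(1) sD]
  note sw = slice_pairing[OF C_L2_sq_int[OF curves(2) t] outside_all(2) sq_int_test_function[OF \<eta>]]
  define h where "h = slice (w t) \<eta>"
  define b where "b z = (\<Sum>i\<in>UNIV. slice (v i t) (dirderiv (axis i 1) \<eta>) z)" for z
  have b: "integrable lborel b" "\<And>z. z \<notin> {-H<..<0} \<Longrightarrow> b z = 0" and h: "integrable lborel h" "\<And>z. z \<notin> {-H<..<0} \<Longrightarrow> h z = 0"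
    using sv sw unfolding b_def h_def by auto
  have bsum: "(\<Sum>i\<in>UNIV. LINT z|lborel. slice (v i t) (dirderiv (axis i 1) \<eta>) z * e z) = (LINT z|lborel. b z * e z)"
    if "bnd_borel e" for e
    unfolding b_def sum_distrib_right
    by (rule Bochner_Integration.integral_sum[symmetric]) (rule integrable_mult_bnd_borel[OF sv(1) that])
  \<comment> \<open>The slice equation says that the average \<open>h\<close> of \<open>w\<close>
    has weak derivative \<open>b\<close>, so it is a primitive of \<open>b\<close> up to a
    constant.\<close>
  obtain C where C: "AE z in lborel. z \<in> {-H<..<0} \<longrightarrow> h z = C + prim b z"
  proof (rule weak_derivative_prim[OF _ h(1) b(1) b(2) h(2)])
    show "(LINT y|lborel. h y * deriv e y) = - (LINT y|lborel. b y * e y)" if "test_function {-H<..<0} e" for e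
      using eq_div_slice[OF \<eta> that t] bsum[OF bnd_borel_test_function[OF that]] by (simp add: h_def)
  qed (use H_pos in auto)
  obtain h0 where h0: "continuous_on {-H..0} h0" "h0 (-H) = 0" "h0 0 = 0"
    "AE z in lborel. z \<in> {-H<..<0} \<longrightarrow> h z = h0 z"
    using traces[OF t] \<eta> unfolding zero_traces_def h_def by blast
  \<comment> \<open>Both sides are continuous on the closed interval. The left end value then forces
    \<open>C = 0\<close> and the right one forces \<open>b\<close> to have zero mean, so
    \<open>prim b\<close> is the factor that vanishes at both ends in the integration by parts
    below.\<close>
  have eq: "h0 z - (C + prim b z) = 0" if "z \<in> {-H..0}" for z
  proof (rule continuous_AE_zero[of "-H" 0 _ z])
    show "continuous_on {-H..0} (\<lambda>z. h0 z - (C + prim b z))" by (intro continuous_intros h0 prim_continuous b)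
    show "AE z in lborel. z \<in> {-H<..<0} \<longrightarrow> h0 z - (C + prim b z) = 0"
      using C h0(4) by eventually_elim auto
  qed (use H_pos that in auto)
  have C0: "C = 0" using eq[of "-H"] prim_left[of "-H" 0 b "-H"] b(2) h0(2) H_pos by simp
  have b0: "(LINT z|lborel. b z) = 0"
    using eq[of 0] prim_right[of "-H" 0 b 0] b(2) h0(3) H_pos C0 by simp
  have qi: "integrable lborel q" by (rule integrable_supported[OF q])
  have "(LINT y|lborel. q y * prim b y + (a + prim q y) * b y) = 0"
    by (rule prim_product_zero_ends(2)[OF qi b(1) q(2) b(2) b0])
  moreover have bb: "bnd_borel (\<lambda>z. a + prim q z)" by (intro bnd_borel_add bnd_borel_const bnd_borel_prim qi)
  moreover have "(LINT y|lborel. q y * prim b y) = (LINT y|lborel. h y * q y)"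
  proof (rule integral_cong_AE)
    show "AE y in lborel. q y * prim b y = h y * q y"
      using C by eventually_elim (use q(2) C0 in auto)
  qed (use bnd_borel_measurable[OF q(1)] prim_borel[OF b(1)] borel_measurable_integrable[OF h(1)] in auto)
  ultimately have "(LINT y|lborel. h y * q y) + (LINT y|lborel. b y * (a + prim q y)) = 0"
    using integrable_mult_bnd_borel[OF qi bnd_borel_prim[OF b(1)]] integrable_mult_bnd_borel[OF b(1) bb]
    by (simp add: mult.commute)
  then show ?thesis
    using bsum[OF bb] sv(3)[OF bb] sw(3)[OF q(1)] by (simp add: h_def)
qed

text \<open>The profile is \<open>G n\<close>, which does not vanish at the ends. Its derivative is
  \<open>- 1 / c n\<close> times the profile extracting the coefficient of \<open>w\<close>, which
  explains the factor \<open>c n\<close>.\<close>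

lemma mode_div:
  assumes \<phi>: "test \<phi>" and n: "n \<ge> 1"
  shows "curve_distr T UNIV (wn n) \<phi> = c n * (\<Sum>i\<in>UNIV. curve_distr T UNIV (vn i n) (Dx i \<phi>))"
proof -
  let ?q = "\<lambda>z. grav * Rp z * F n z / c n"
  have cn: "c n > 0" using c_pos n by simp
  let ?L = "\<lambda>i t. LINT p|lborel. v i t p * (Dx i \<phi> (t, fst p) * (I (snd p) * G n (snd p)))"
  let ?M = "\<lambda>t. LINT p|lborel. w t p * (\<phi> (t, fst p) * (- grav * Rp (snd p) * F n (snd p)))"
  have pt: "(\<Sum>i\<in>UNIV. ?L i t) = (1 / c n) * ?M t" if t: "t \<in> {0..T}" for t
  proof -
    have S: "(\<Sum>i\<in>UNIV. LINT p|lborel. v i t p * (dirderiv (axis i 1) (\<lambda>X. \<phi> (t, X)) (fst p) * ((A n + prim ?q (snd p)) * I (snd p))))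
      + (LINT p|lborel. w t p * (\<phi> (t, fst p) * (?q (snd p) * I (snd p)))) = 0"
      using eq_div_ends[OF test_function_section(1)[OF \<phi>] G'_bb[OF n] G'_outside t, of t "A n"] .
    have g: "A n + prim ?q z = G n z" for z using G_prim[OF n] by simp
    have M: "(LINT p|lborel. w t p * (\<phi> (t, fst p) * (?q (snd p) * I (snd p)))) = - (1 / c n) * ?M t"
    proof -
      have eq: "w t p * (\<phi> (t, fst p) * (?q (snd p) * I (snd p))) = - (1 / c n) * (w t p * (\<phi> (t, fst p) * (- grav * Rp (snd p) * F n (snd p))))" for p
        using Rp_outside[of "snd p"] by (cases "snd p \<in> {-H<..<0}") auto
      show ?thesis by (simp only: eq integral_mult_right_zero)
    qed
    have gen: "a = k * b" if "a + - k * b = 0" for a k b :: real using that by simp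
    have L: "dirderiv (axis i 1) (\<lambda>X. \<phi> (t, X)) X * (G n z * I z) = Dx i \<phi> (t, X) * (I z * G n z)" for i X z
      by (simp add: test_function_section(2)[OF \<phi>])
    show ?thesis by (rule gen[OF S[unfolded g M L]])
  qed
  have iL: "integrable lborel (\<lambda>t. indicator {0<..<T} t * ?L i t)" for i
    by (rule continuous_on_integrable_Ioo[OF pair_strip_inner_continuous[OF curves(1) test_D[OF \<phi>] sq_int_G(1)]])
  have "(\<Sum>i\<in>UNIV. curve_distr T UNIV (vn i n) (Dx i \<phi>)) = (\<Sum>i\<in>UNIV. LINT t|lborel. indicator {0<..<T} t * ?L i t)"
    unfolding coef_distr(1)[OF test_D[OF \<phi>]] pair_strip_alt ..
  also have "\<dots> = (LINT t|lborel. (\<Sum>i\<in>UNIV. indicator {0<..<T} t * ?L i t))"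
    by (rule Bochner_Integration.integral_sum[symmetric]) (rule iL)
  also have "\<dots> = (LINT t|lborel. (1 / c n) * (indicator {0<..<T} t * ?M t))"
  proof (rule Bochner_Integration.integral_cong[OF refl])
    fix t
    show "(\<Sum>i\<in>UNIV. indicator {0<..<T} t * ?L i t) = (1 / c n) * (indicator {0<..<T} t * ?M t)"
      unfolding sum_distrib_left[symmetric] using pt[of t] by (cases "t \<in> {0<..<T}") auto
  qed
  also have "\<dots> = (1 / c n) * curve_distr T UNIV (wn n) \<phi>"
    unfolding coef_distr(2)[OF \<phi> n] pair_strip_alt by (rule integral_mult_right_zero)
  finally show ?thesis using cn by simp
qed

subsection \<open>The zeroth mode\<close>

lemma C_L2_coef: "C_L2 T UNIV (vn i n)" "k \<ge> 1 \<Longrightarrow> C_L2 T UNIV (rn k)" "C_L2 T UNIV (Pn n)"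
  by (rule coefficient_C_L2[OF curves(1) sq_int_G(1) coef_borel(1) coef(1)], assumption+)
     (rule coefficient_C_L2[OF curves(3) sq_int_F(2) coef_borel(3) coef(3)], assumption+,
      rule coefficient_C_L2[OF curves(4) sq_int_G(2) coef_borel(4) coef(4)], assumption+)

text \<open>Needed because the Liouville theorem is applied at each time separately. Both sides are
  continuous in \<open>t\<close>, so testing with products determines them everywhere.\<close>

lemma curve_distr_fixed_time:
  assumes u: "C_L2 T UNIV u" and g: "C_L2 T UNIV g" and \<eta>: "test_function UNIV \<eta>" and t: "t \<in> {0..T}"
    and eq: "\<And>\<phi>. test \<phi> \<Longrightarrow> curve_distr T UNIV u (Dx i \<phi>) = curve_distr T UNIV g (Dx j \<phi>)"
  shows "(LINT X|lborel. u t X * dirderiv (axis i 1) \<eta> X) = (LINT X|lborel. g t X * dirderiv (axis j 1) \<eta> X)"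
proof -
  have sD: "sq_int (dirderiv (axis i 1) \<eta>)" for i by (rule sq_int_test_function[OF test_function_dirderiv[OF \<eta>]])
  let ?L = "\<lambda>u i t. LINT X|lborel. u t X * dirderiv (axis i 1) \<eta> X"
  have cont: "continuous_on {0..T} (?L u i)" if "C_L2 T UNIV u" for u i
    by (rule C_L2_pairing[OF that C_L2_const[OF sD]])
  have "?L u i t - ?L g j t = 0"
  proof (rule continuous_weak_zero[OF T_pos _ _ t])
    show "continuous_on {0..T} (\<lambda>t. ?L u i t - ?L g j t)" by (intro continuous_intros cont u g)
    fix \<theta> assume th: "test_function {0<..<T} \<theta>"
    have tt: "test (\<lambda>p. \<theta> (fst p) * \<eta> (snd p))" by (rule test_function_tensor[OF th \<eta>])
    have D: "Dx i (\<lambda>p. \<theta> (fst p) * \<eta> (snd p)) = (\<lambda>p. \<theta> (fst p) * dirderiv (axis i 1) \<eta> (snd p))" for i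
      by (rule ext) (use dirderiv_tensor[OF th \<eta>] in \<open>auto split: prod.split\<close>)
    have cd: "curve_distr T UNIV u (Dx i (\<lambda>p. \<theta> (fst p) * \<eta> (snd p))) = (LINT t|lborel. indicator {0<..<T} t * (\<theta> t * ?L u i t))" for u i
    proof -
      have "(\<lambda>X. u t X * (\<theta> t * dirderiv (axis i 1) \<eta> X)) = (\<lambda>X. \<theta> t * (u t X * dirderiv (axis i 1) \<eta> X))" for t
        by (simp add: ac_simps)
      then show ?thesis unfolding D curve_distr_UNIV by simp
    qed
    have int: "integrable lborel (\<lambda>t. indicator {0<..<T} t * (\<theta> t * ?L u i t))" if "C_L2 T UNIV u" for u i
      by (rule continuous_on_integrable_Ioo)
         (intro continuous_intros cont that continuous_on_subset[OF test_function_continuous[OF th]], simp)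
    have "(LINT t|lborel. indicator {0<..<T} t * (\<theta> t * (?L u i t - ?L g j t)))
      = (LINT t|lborel. indicator {0<..<T} t * (\<theta> t * ?L u i t) - indicator {0<..<T} t * (\<theta> t * ?L g j t))"
      by (simp add: right_diff_distrib)
    also have "\<dots> = 0" using int[OF u] int[OF g] eq[OF tt] unfolding cd by simp
    finally show "(LINT t|lborel. indicator {0<..<T} t * (\<theta> t * (?L u i t - ?L g j t))) = 0" .
  qed
  then show ?thesis by simp
qed

lemma integral_laplacian:
  assumes u: "sq_int u" and \<eta>: "test_function UNIV \<eta>"
  shows "(LINT X|lborel. u X * laplacian \<eta> X) = (\<Sum>j\<in>UNIV. LINT X|lborel. u X * dirderiv (axis j 1) (dirderiv (axis j 1) \<eta>) (X::real^'d))"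
  unfolding laplacian_def sum_Basis_axis sum_distrib_left
  by (rule Bochner_Integration.integral_sum)
     (intro sq_int_mult u sq_int_test_function[OF test_function_dirderiv[OF test_function_dirderiv[OF \<eta>]]])

lemma V0_vanishes:
  assumes t: "t \<in> {0..T}" shows "AE X in lborel. vn i 0 t X = 0"
proof (rule Liouville_L2)
  have sq: "sq_int (vn i 0 t)" for i by (rule C_L2_sq_int[OF C_L2_coef(1) t])
  show "sq_int (vn i 0 t)" by (rule sq)
  fix \<eta> :: "real^'d \<Rightarrow> real" assume \<eta>: "test_function UNIV \<eta>"
  have div0: "(\<Sum>i\<in>UNIV. LINT X|lborel. vn i 0 t X * dirderiv (axis i 1) \<eta> X) = 0" if \<eta>: "test_function UNIV \<eta>" for \<eta>
  proof -
    have pz: "prim (\<lambda>z. 0) z = 0" for z by (simp add: prim_def)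
    \<comment> \<open>The zeroth profile is constant, so its derivative is zero and \<open>w\<close>
      drops out of the divergence equation.\<close>
    have "(\<Sum>i\<in>UNIV. LINT p|lborel. v i t p * (dirderiv (axis i 1) \<eta> (fst p) * ((A 0 + prim (\<lambda>z. 0) (snd p)) * I (snd p)))) = 0"
      using eq_div_ends[OF \<eta> bnd_borel_const[of 0] _ t, of "A 0"] by simp
    moreover have "(LINT p|lborel. v i t p * (dirderiv (axis i 1) \<eta> (fst p) * (I (snd p) * G 0 (snd p))))
        = (LINT X|lborel. vn i 0 t X * dirderiv (axis i 1) \<eta> X)" for i
      by (rule coefficient_pairing[OF C_L2_sq_int[OF curves(1) t] sq_int_test_function[OF test_function_dirderiv[OF \<eta>]]
            sq_int_G(1) coef_borel(1)[OF t] coef(1)[OF t]])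
    ultimately show ?thesis by (simp add: G_0 pz mult.commute[of "A 0"])
  qed
  have "(LINT X|lborel. vn i 0 t X * laplacian \<eta> X) = (\<Sum>j\<in>UNIV. LINT X|lborel. vn i 0 t X * dirderiv (axis j 1) (dirderiv (axis j 1) \<eta>) X)"
    by (rule integral_laplacian[OF sq \<eta>])
  \<comment> \<open>Absence of curl exchanges the component with one of the two derivatives. What
    remains is the divergence tested with the \<open>i\<close>-th derivative of
    \<open>\<eta>\<close>.\<close>
  also have "\<dots> = (\<Sum>j\<in>UNIV. LINT X|lborel. vn j 0 t X * dirderiv (axis j 1) (dirderiv (axis i 1) \<eta>) X)"
  proof (rule sum.cong[OF refl])
    fix j
    have "(LINT X|lborel. vn i 0 t X * dirderiv (axis j 1) (dirderiv (axis j 1) \<eta>) X)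
      = (LINT X|lborel. vn j 0 t X * dirderiv (axis i 1) (dirderiv (axis j 1) \<eta>) X)"
      by (rule curve_distr_fixed_time[OF C_L2_coef(1) C_L2_coef(1) test_function_dirderiv[OF \<eta>] t mode_curl])
    then show "(LINT X|lborel. vn i 0 t X * dirderiv (axis j 1) (dirderiv (axis j 1) \<eta>) X)
      = (LINT X|lborel. vn j 0 t X * dirderiv (axis j 1) (dirderiv (axis i 1) \<eta>) X)"
      using dirderiv_commute[OF \<eta>, of "axis i 1" "axis j 1"] by simp
  qed
  also have "\<dots> = 0" by (rule div0[OF test_function_dirderiv[OF \<eta>]])
  finally show "(LINT X|lborel. vn i 0 t X * laplacian \<eta> X) = 0" .
qed

lemma P0_vanishes:
  assumes t: "t \<in> {0..T}" shows "AE X in lborel. Pn 0 t X = 0"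
proof (rule Liouville_L2)
  show sq: "sq_int (Pn 0 t)" by (rule C_L2_sq_int[OF C_L2_coef(3) t])
  fix \<eta> :: "real^'d \<Rightarrow> real" assume \<eta>: "test_function UNIV \<eta>"
  have v0: "curve_distr T UNIV (vn i 0) \<phi> = 0" if \<phi>: "test \<phi>" for i \<phi>
  proof -
    have eq: "indicator {0<..<T} t * (LINT x|lborel. vn i 0 t x * \<phi> (t, x)) = 0" for t
    proof (cases "t \<in> {0<..<T}")
      case True
      then have "AE X in lborel. vn i 0 t X * \<phi> (t, X) = 0"
        using V0_vanishes[of t i] by (auto elim: eventually_mono)
      then have "(LINT x|lborel. vn i 0 t x * \<phi> (t, x)) = 0" by (rule integral_eq_zero_AE)
      then show ?thesis by simp
    qed simp
    show ?thesis unfolding curve_distr_UNIV eq by simp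
  qed
  \<comment> \<open>With the zeroth velocity gone, the momentum equation leaves a zero pressure
    gradient, so every second derivative vanishes and not only the Laplacian.\<close>
  have "(LINT X|lborel. Pn 0 t X * dirderiv (axis j 1) (dirderiv (axis j 1) \<eta>) X) = 0" for j
  proof -
    have z: "C_L2 T UNIV (\<lambda>t X::real^'d. 0)" using C_L2_const[OF sq_int_0] .
    have "(LINT X|lborel. Pn 0 t X * dirderiv (axis j 1) (dirderiv (axis j 1) \<eta>) X)
        = (LINT X|lborel. (\<lambda>t X. 0) t X * dirderiv (axis j 1) (dirderiv (axis j 1) \<eta>) X)"
    proof (rule curve_distr_fixed_time[OF C_L2_coef(3) z test_function_dirderiv[OF \<eta>] t])
      fix \<phi> assume "test \<phi>"
      then show "curve_distr T UNIV (Pn 0) (Dx j \<phi>) = curve_distr T UNIV (\<lambda>t X. 0) (Dx j \<phi>)"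
        using mode_V[of \<phi> j 0] v0[OF test_D, of \<phi> j "(1, 0)"] by (simp add: curve_distr_UNIV)
    qed
    then show ?thesis by simp
  qed
  then show "(LINT X|lborel. Pn 0 t X * laplacian \<eta> X) = 0" unfolding integral_laplacian[OF sq \<eta>] by simp
qed

subsection \<open>The coupled equations\<close>

lemma mode_P_series:
  assumes \<phi>: "test \<phi>" and n: "n \<ge> 1"
  shows "(\<lambda>k. (LINT y|lborel. F (Suc k) y * F n y * R y) * dt (curve_distr T UNIV (wn (Suc k))) \<phi>)
    sums (curve_distr T UNIV (Pn n) \<phi> / c n - curve_distr T UNIV (rn n) \<phi>)"
  using sums_minus[OF mode_w_expansion[OF test_D[OF \<phi>, of "(1, 0)"] n]]
  unfolding ddiff_def mode_P[OF \<phi> n, symmetric] by simp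

text \<open>Without curl the Laplacian is the gradient of the divergence, and the divergence of the
  mode is \<open>- 1 / c k\<close> times the coefficient of \<open>w\<close>. One horizontal
  derivative stays on the test function, where the pressure gradient will need it.\<close>

lemma lap_dt_V:
  assumes \<phi>: "test \<phi>" and k: "k \<ge> 1"
  shows "c k * lapX (dt (curve_distr T UNIV (vn i k))) \<phi> = dt (curve_distr T UNIV (wn k)) (Dx i \<phi>)"
proof -
  have com: "dirderiv x (dirderiv y \<psi>) = dirderiv y (dirderiv x \<psi>)" if "test \<psi>" for x y \<psi>
    by (rule dirderiv_commute[OF that])
  have "lapX (dt (curve_distr T UNIV (vn i k))) \<phi> = - (\<Sum>j\<in>UNIV. curve_distr T UNIV (vn i k) (Dt (Dx j (Dx j \<phi>))))"
    unfolding lapX_def ddiff_def by (simp add: sum_negf)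
  also have "(\<Sum>j\<in>UNIV. curve_distr T UNIV (vn i k) (Dt (Dx j (Dx j \<phi>)))) = (\<Sum>j\<in>UNIV. curve_distr T UNIV (vn j k) (Dx j (Dt (Dx i \<phi>))))"
  proof (rule sum.cong[OF refl])
    fix j
    have "Dt (Dx j (Dx j \<phi>)) = Dx j (Dt (Dx j \<phi>))" by (rule com[OF test_D[OF \<phi>]])
    then have "curve_distr T UNIV (vn i k) (Dt (Dx j (Dx j \<phi>))) = curve_distr T UNIV (vn j k) (Dx i (Dt (Dx j \<phi>)))"
      using mode_curl[OF test_D[OF test_D[OF \<phi>]]] by simp
    moreover have "Dx i (Dt (Dx j \<phi>)) = Dx j (Dt (Dx i \<phi>))"
      using com[OF test_D[OF \<phi>], of "(0, axis i 1)" "(1, 0)" "(0, axis j 1)"] com[OF test_D[OF \<phi>], of "(0, axis j 1)" "(1, 0)" "(0, axis i 1)"]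
        com[OF \<phi>, of "(0, axis i 1)" "(0, axis j 1)"] by simp
    ultimately show "curve_distr T UNIV (vn i k) (Dt (Dx j (Dx j \<phi>))) = curve_distr T UNIV (vn j k) (Dx j (Dt (Dx i \<phi>)))"
      by simp
  qed
  finally show ?thesis unfolding ddiff_def mode_div[OF test_D[OF test_D[OF \<phi>]] k] by simp
qed

text \<open>Term by term this is the pressure series tested with \<open>Dx i \<phi>\<close> and
  multiplied by \<open>c n\<close>. Convergence of the series of Laplacians is thus inherited from
  the expansion of \<open>w\<close>.\<close>

lemma mode_V_series:
  assumes \<phi>: "test \<phi>" and n: "n \<ge> 1"
  shows "(\<lambda>k. c (Suc k) * c n * (LINT y|lborel. F (Suc k) y * F n y * R y) * lapX (dt (curve_distr T UNIV (vn i (Suc k)))) \<phi>)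
    sums (curve_distr T UNIV (Pn n) (Dx i \<phi>) - c n * curve_distr T UNIV (rn n) (Dx i \<phi>))"
proof -
  have "(\<lambda>k. c n * ((LINT y|lborel. F (Suc k) y * F n y * R y) * dt (curve_distr T UNIV (wn (Suc k))) (Dx i \<phi>)))
    sums (c n * (curve_distr T UNIV (Pn n) (Dx i \<phi>) / c n - curve_distr T UNIV (rn n) (Dx i \<phi>)))"
    by (intro sums_mult mode_P_series test_D \<phi> n)
  moreover have "c n * ((LINT y|lborel. F (Suc k) y * F n y * R y) * dt (curve_distr T UNIV (wn (Suc k))) (Dx i \<phi>))
      = c (Suc k) * c n * (LINT y|lborel. F (Suc k) y * F n y * R y) * lapX (dt (curve_distr T UNIV (vn i (Suc k)))) \<phi>" for k
    using lap_dt_V[OF \<phi>, of "Suc k" i] by simp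
  moreover have "c n * (x / c n - y) = x - c n * y" for x y using c_pos[OF n] by (simp add: right_diff_distrib)
  ultimately show ?thesis by simp
qed

end

section \<open>From the linear equations to the modal system\<close>

text \<open>The exceptional set is a full horizontal space times a null set, and infinity times zero
  is zero for measures.\<close>

lemma AE_lborel_snd:
  assumes "AE z in lborel. Q z"
  shows "AE p in lborel. Q (snd (p :: 'a::euclidean_space \<times> 'b::euclidean_space))"
proof -
  obtain N where N: "{z \<in> space lborel. \<not> Q z} \<subseteq> N" "emeasure lborel N = 0" "N \<in> sets lborel"
    using AE_E[OF assms] by metis
  let ?U = "(UNIV :: 'a set) \<times> N"
  have "emeasure (lborel \<Otimes>\<^sub>M lborel) ?U = emeasure lborel (UNIV :: 'a set) * emeasure lborel N"
    using N(3) by (intro lborel.emeasure_pair_measure_Times) simp_all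
  then have "emeasure lborel ?U = 0" unfolding lborel_prod N(2) by simp
  moreover have "?U \<in> sets (lborel \<Otimes>\<^sub>M lborel)" using N(3) by (intro pair_measureI) simp_all
  ultimately have "?U \<in> null_sets lborel" unfolding lborel_prod by (rule null_setsI)
  moreover have "{p \<in> space lborel. \<not> Q (snd p)} \<subseteq> ?U" using N(1) by (auto simp: subset_iff)
  ultimately show ?thesis by (rule AE_I')
qed

lemma strip_borel: "strip H \<in> sets (borel :: ((real^'d::finite) \<times> real) measure)"
  unfolding strip_def by (intro borel_open open_Times) auto

text \<open>Dropping the nonnegative Fourier term leaves the plain square integral, and Tonelli's
  theorem reassembles it from the slices.\<close>

lemma strip_nn_integral_le:
  fixes u :: "(real^'d::finite) \<times> real \<Rightarrow> real"
  assumes "(\<lambda>p. indicator (strip H) p * u p) \<in> borel_measurable borel"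
  shows "(\<integral>\<^sup>+p\<in>strip H. ennreal ((u p)\<^sup>2) \<partial>lborel) \<le> Hs0_sqnorm s H u"
proof -
  let ?f = "\<lambda>p. ennreal ((indicator (strip H) p * u p)\<^sup>2)"
  have f: "?f \<in> borel_measurable (lborel \<Otimes>\<^sub>M lborel)" using assms by (simp add: lborel_prod)
  have "(\<integral>\<^sup>+p\<in>strip H. ennreal ((u p)\<^sup>2) \<partial>lborel) = (\<integral>\<^sup>+p. ?f p \<partial>(lborel \<Otimes>\<^sub>M lborel))"
    unfolding lborel_prod by (rule nn_integral_cong) (auto simp: indicator_def)
  also have "\<dots> = (\<integral>\<^sup>+z. \<integral>\<^sup>+X. ?f (X, z) \<partial>lborel \<partial>lborel)"
    by (rule lborel_pair.nn_integral_snd[OF f, symmetric])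
  also have "\<dots> \<le> (\<integral>\<^sup>+z\<in>{-H<..<0}. Hs_sqnorm s (\<lambda>X. u (X, z)) \<partial>lborel)"
  proof (rule nn_integral_mono)
    fix z
    show "(\<integral>\<^sup>+X. ?f (X, z) \<partial>lborel) \<le> Hs_sqnorm s (\<lambda>X. u (X, z)) * indicator {-H<..<0} z"
      unfolding Hs_sqnorm_def by (cases "z \<in> {-H<..<0}") (auto simp: strip_def indicator_def)
  qed
  finally show ?thesis unfolding Hs0_sqnorm_def .
qed

lemma C_Hs0_C_L2:
  fixes u :: "real \<Rightarrow> (real^'d::finite) \<times> real \<Rightarrow> real"
  assumes "C_Hs0 s H T u" shows "C_L2 T (strip H) u"
proof -
  have m: "(\<lambda>p. indicator (strip H) p * u t p) \<in> borel_measurable borel" if "t \<in> {0..T}" for t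
    using assms that unfolding C_Hs0_def set_borel_measurable_def by simp
  have d: "(\<lambda>p. indicator (strip H) p * (u t p - u t' p)) \<in> borel_measurable borel"
    if "t \<in> {0..T}" "t' \<in> {0..T}" for t t'
    using borel_measurable_diff[OF m[OF that(1)] m[OF that(2)]] by (simp add: right_diff_distrib)
  show ?thesis unfolding C_L2_def
  proof (intro conjI ballI)
    fix t assume t: "t \<in> {0..T}"
    show "set_borel_measurable lborel (strip H) (u t)" using assms t unfolding C_Hs0_def by blast
    have "Hs0_sqnorm s H (u t) < \<infinity>" using assms t unfolding C_Hs0_def by blast
    then show "(\<integral>\<^sup>+x\<in>strip H. ennreal ((u t x)\<^sup>2) \<partial>lborel) < \<infinity>"
      by (rule order_le_less_trans[OF strip_nn_integral_le[OF m[OF t]]])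
    have "((\<lambda>t'. Hs0_sqnorm s H (\<lambda>p. u t' p - u t p)) \<longlongrightarrow> 0) (at t within {0..T})"
      using assms t unfolding C_Hs0_def by blast
    then show "((\<lambda>t'. \<integral>\<^sup>+x\<in>strip H. ennreal ((u t' x - u t x)\<^sup>2) \<partial>lborel) \<longlongrightarrow> 0) (at t within {0..T})"
    proof (rule tendsto_sandwich[rotated 3])
      show "eventually (\<lambda>t'. (\<integral>\<^sup>+x\<in>strip H. ennreal ((u t' x - u t x)\<^sup>2) \<partial>lborel) \<le> Hs0_sqnorm s H (\<lambda>p. u t' p - u t p)) (at t within {0..T})"
        using eventually_in_Icc by eventually_elim (rule strip_nn_integral_le[OF d[OF _ t]])
    qed auto
  qed
qed

text \<open>A coefficient depending on \<open>z\<close> alone can be moved onto the vertical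
  profile, and there be exchanged for its bounded Borel version \<open>k'\<close>. This is how the
  raw equations enter the calculus of pairings.\<close>

lemma curve_distr_strip_tensor:
  fixes u :: "real \<Rightarrow> (real^'d::finite) \<times> real \<Rightarrow> real"
  assumes u: "\<And>t. t \<in> {0..T} \<Longrightarrow> (\<lambda>p. indicator (strip H) p * u t p) \<in> borel_measurable borel"
    and g: "\<And>t p. g t p = k (snd p) * u t p"
    and k: "(\<lambda>z. indicator {-H<..<0} z * k z) \<in> borel_measurable borel" "bnd_borel k'"
      "AE z in lborel. z \<in> {-H<..<0} \<longrightarrow> k z = k' z"
    and \<phi>: "test_function (I \<times> UNIV) \<phi>" and e: "test_function J e"
  shows "curve_distr T (strip H) g (\<lambda>p. \<phi> (fst p, fst (snd p)) * e (snd (snd p)))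
    = pair_strip T (\<lambda>t p. indicator (strip H) p * u t p) \<phi> (\<lambda>z. e z * k' z)"
  unfolding curve_distr_def pair_strip_alt set_lebesgue_integral_def
proof (rule Bochner_Integration.integral_cong[OF refl])
  fix t :: real
  let ?L = "\<lambda>p. indicator (strip H) p *\<^sub>R (g t p * (\<phi> (fst (t, p), fst (snd (t, p))) * e (snd (snd (t, p)))))"
  let ?R = "\<lambda>p. indicator (strip H) p * u t p * (\<phi> (t, fst p) * (e (snd p) * k' (snd p)))"
  show "indicator {0<..<T} t *\<^sub>R (LINT p|lborel. ?L p) = indicator {0<..<T} t * (LINT p|lborel. ?R p)"
  proof (cases "t \<in> {0<..<T}")
    case True
    then have t: "t \<in> {0..T}" by auto
    have m: "(\<lambda>p. \<phi> (t, fst p)) \<in> borel_measurable (borel :: ((real^'d) \<times> real) measure)"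
      "(\<lambda>p. e (snd p)) \<in> borel_measurable (borel :: ((real^'d) \<times> real) measure)"
      "(\<lambda>p. k' (snd p)) \<in> borel_measurable (borel :: ((real^'d) \<times> real) measure)"
      "(\<lambda>p. indicator {-H<..<0} (snd p) * k (snd p)) \<in> borel_measurable (borel :: ((real^'d) \<times> real) measure)"
      by (rule measurable_compose[OF _ test_function_borel[OF test_function_section(1)[OF \<phi>]]]
            measurable_compose[OF _ test_function_borel[OF e]] measurable_compose[OF _ bnd_borel_measurable[OF k(2)]]
            measurable_compose[OF _ k(1)], simp add: borel_prod[symmetric])+
    have "(LINT p|lborel. ?L p) = (LINT p|lborel. ?R p)"
    proof (rule integral_cong_AE)
      have eq: "?L p = (indicator {-H<..<0} (snd p) * k (snd p)) * (indicator (strip H) p * u t p) * (\<phi> (t, fst p) * e (snd p))" for p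
        unfolding g by (auto simp: strip_def indicator_def)
      show "?L \<in> borel_measurable lborel" unfolding eq
        using borel_measurable_times[OF borel_measurable_times[OF m(4) u[OF t]] borel_measurable_times[OF m(1,2)]] by simp
      show "?R \<in> borel_measurable lborel"
        using borel_measurable_times[OF u[OF t] borel_measurable_times[OF m(1) borel_measurable_times[OF m(2,3)]]] by simp
      show "AE p in lborel. ?L p = ?R p"
        using AE_lborel_snd[OF k(3)]
      proof eventually_elim
        case (elim p)
        then show ?case unfolding g by (cases "p \<in> strip H") (auto simp: strip_def)
      qed
    qed
    then show ?thesis by simp
  qed simp
qed

lemma tensor_derivatives:
  fixes \<phi> :: "real \<times> (real^'d::finite) \<Rightarrow> real"
  assumes "test_function (I \<times> UNIV) \<phi>" "test_function J e"
  shows "dirderiv (1, 0) (\<lambda>p. \<phi> (fst p, fst (snd p)) * e (snd (snd p)))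
      = (\<lambda>p. dirderiv (1, 0) \<phi> (fst p, fst (snd p)) * e (snd (snd p)))"
    "dirderiv (0, (axis i 1, 0)) (\<lambda>p. \<phi> (fst p, fst (snd p)) * e (snd (snd p)))
      = (\<lambda>p. dirderiv (0, axis i 1) \<phi> (fst p, fst (snd p)) * e (snd (snd p)))"
    "dirderiv (0, (0, 1)) (\<lambda>p. \<phi> (fst p, fst (snd p)) * e (snd (snd p)))
      = (\<lambda>p. \<phi> (fst p, fst (snd p)) * deriv e (snd (snd p)))"
proof -
  have z: "dirderiv (0, 0) \<phi> x = 0" for x
    using dirderiv_zero[OF test_function_differentiable[OF assms(1)]] by (simp add: zero_prod_def)
  note d = dirderiv_tensor_strip[OF assms]
  show "dirderiv (1, 0) (\<lambda>p. \<phi> (fst p, fst (snd p)) * e (snd (snd p)))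
      = (\<lambda>p. dirderiv (1, 0) \<phi> (fst p, fst (snd p)) * e (snd (snd p)))"
    using d[of 1 0 0] by (auto simp: fun_eq_iff zero_prod_def)
  show "dirderiv (0, (axis i 1, 0)) (\<lambda>p. \<phi> (fst p, fst (snd p)) * e (snd (snd p)))
      = (\<lambda>p. dirderiv (0, axis i 1) \<phi> (fst p, fst (snd p)) * e (snd (snd p)))"
    using d[of 0 "axis i 1" 0] by (auto simp: fun_eq_iff)
  show "dirderiv (0, (0, 1)) (\<lambda>p. \<phi> (fst p, fst (snd p)) * e (snd (snd p)))
      = (\<lambda>p. \<phi> (fst p, fst (snd p)) * deriv e (snd (snd p)))"
    using d[of 0 0 1] by (auto simp: fun_eq_iff z)
qed

theorem proposition4:
  fixes H grav T s :: real
    and \<rho>eq \<rho>eq' :: "real \<Rightarrow> real"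
    and f :: "nat \<Rightarrow> real \<Rightarrow> real" and c :: "nat \<Rightarrow> real"
    and V :: "real \<Rightarrow> (real^'d::finite) \<times> real \<Rightarrow> (real^'d)"
    and w \<rho> P :: "real \<Rightarrow> (real^'d) \<times> real \<Rightarrow> real"
    and V0 :: "(real^'d) \<times> real \<Rightarrow> (real^'d)"
    and w0 \<rho>0 :: "(real^'d) \<times> real \<Rightarrow> real"
    and Vn :: "nat \<Rightarrow> real \<Rightarrow> (real^'d) \<Rightarrow> (real^'d)"
    and wn \<rho>n Pn :: "nat \<Rightarrow> real \<Rightarrow> (real^'d) \<Rightarrow> real"
    and V0n :: "nat \<Rightarrow> (real^'d) \<Rightarrow> (real^'d)"
    and \<rho>0n :: "nat \<Rightarrow> (real^'d) \<Rightarrow> real"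
  assumes dim: "CARD('d) \<in> {1, 2}"
    and "H > 0" and "grav > 0" and "T > 0" and "s \<ge> 0"
    and rho_eq: "W_1_infty (-H) 0 \<rho>eq \<rho>eq'"
    and rho_eq_pos: "\<exists>m>0. AE z in lborel. z \<in> {-H<..<0} \<longrightarrow> m \<le> \<rho>eq z"
    and N_pos: "\<exists>m>0. AE z in lborel. z \<in> {-H<..<0} \<longrightarrow> m \<le> N_sq grav \<rho>eq \<rho>eq' z"
    and modes: "SL_modes H grav \<rho>eq \<rho>eq' f c"
    and reg: "\<And>i. C_Hs0 s H T (\<lambda>t p. V t p $ i)" "C_Hs0 s H T w" "C_Hs0 s H T \<rho>"
    and reg_P: "C_L2 T (strip H) P"
    and eqs: "linear_equations H grav T \<rho>eq \<rho>eq' V w \<rho> P"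
    and init: "AE p in lborel. p \<in> strip H \<longrightarrow> V 0 p = V0 p \<and> w 0 p = w0 p \<and> \<rho> 0 p = \<rho>0 p"
    and vort: "zero_vertical_vorticity H T V"
    and dec_V: "\<And>i t. t \<in> {0..T} \<Longrightarrow> modal_decomposition H 0 (g_mode H \<rho>eq f c)
                  (\<lambda>p. V t p $ i) (\<lambda>n X. Vn n t X $ i)"
    and dec_w: "\<And>t. t \<in> {0..T} \<Longrightarrow> modal_decomposition H 1 f (w t) (\<lambda>n. wn n t)"
    and dec_P: "\<And>t. t \<in> {0..T} \<Longrightarrow> modal_decomposition H 0 (\<lambda>n z. \<rho>eq z * g_mode H \<rho>eq f c n z)
                  (P t) (\<lambda>n. Pn n t)"
    and dec_rho: "\<And>t. t \<in> {0..T} \<Longrightarrow>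
                  modal_decomposition H 1 (\<lambda>n z. 1 / grav * \<rho>eq z * N_sq grav \<rho>eq \<rho>eq' z * f n z)
                  (\<rho> t) (\<lambda>n. \<rho>n n t)"
    and dec_V0: "\<And>i. modal_decomposition H 0 (g_mode H \<rho>eq f c)
                  (\<lambda>p. V0 p $ i) (\<lambda>n X. V0n n X $ i)"
    and dec_rho0: "modal_decomposition H 1 (\<lambda>n z. 1 / grav * \<rho>eq z * N_sq grav \<rho>eq \<rho>eq' z * f n z)
                  \<rho>0 \<rho>0n"
  shows
    "(\<forall>n\<ge>1.
       (\<forall>\<phi>. test_function ({0<..<T} \<times> UNIV) \<phi> \<longrightarrow>
          (\<forall>i. summable (\<lambda>m. c (Suc m) * c n * alpha H \<rho>eq f (Suc m) n
                   * lapX (dt (curve_distr T UNIV (\<lambda>t X. Vn (Suc m) t X $ i))) \<phi>)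
             \<and> dt (curve_distr T UNIV (\<lambda>t X. Vn n t X $ i)) \<phi>
               - (\<Sum>m. c (Suc m) * c n * alpha H \<rho>eq f (Suc m) n
                   * lapX (dt (curve_distr T UNIV (\<lambda>t X. Vn (Suc m) t X $ i))) \<phi>)
               + c n * dX i (curve_distr T UNIV (\<rho>n n)) \<phi> = 0)
        \<and> dt (curve_distr T UNIV (\<rho>n n)) \<phi>
            + c n * (\<Sum>i\<in>UNIV. dX i (curve_distr T UNIV (\<lambda>t X. Vn n t X $ i)) \<phi>) = 0
        \<and> curve_distr T UNIV (wn n) \<phi>
            = - c n * (\<Sum>i\<in>UNIV. dX i (curve_distr T UNIV (\<lambda>t X. Vn n t X $ i)) \<phi>)
        \<and> summable (\<lambda>m. alpha H \<rho>eq f (Suc m) n * dt (curve_distr T UNIV (wn (Suc m))) \<phi>)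
        \<and> curve_distr T UNIV (Pn n) \<phi> = c n * curve_distr T UNIV (\<rho>n n) \<phi>
            + c n * (\<Sum>m. alpha H \<rho>eq f (Suc m) n * dt (curve_distr T UNIV (wn (Suc m))) \<phi>))
     \<and> (\<forall>i. C_L2 T UNIV (\<lambda>t X. Vn n t X $ i)) \<and> C_L2 T UNIV (\<rho>n n)
     \<and> (AE X in lborel. Vn n 0 X = V0n n X \<and> \<rho>n n 0 X = \<rho>0n n X))
     \<and> (\<forall>t\<in>{0..T}. AE X in lborel. Pn 0 t X = 0 \<and> Vn 0 t X = 0)"
proof -
  let ?J = "{-H<..<0::real}"
  let ?S = "indicat_real (strip H :: ((real^'d) \<times> real) set)"
  obtain R Rp A F G R0 m where mp: "mode_profile H grav c R Rp A F G R0 m"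
    and rm: "(\<lambda>z. indicator ?J z * \<rho>eq z) \<in> borel_measurable borel"
      "(\<lambda>z. indicator ?J z * \<rho>eq' z) \<in> borel_measurable borel"
    and rho: "AE z in lborel. z \<in> ?J \<longrightarrow> \<rho>eq z = R z \<and> \<rho>eq' z = Rp z \<and> \<rho>eq z * N_sq grav \<rho>eq \<rho>eq' z = - grav * Rp z"
    and fF: "\<And>n z. n \<ge> 1 \<Longrightarrow> z \<in> ?J \<Longrightarrow> f n z = F n z"
    and gG: "\<And>n. AE z in lborel. z \<in> ?J \<longrightarrow> g_mode H \<rho>eq f c n z = G n z / R z"
    and alpha: "\<And>k n. k \<ge> 1 \<Longrightarrow> n \<ge> 1 \<Longrightarrow> alpha H \<rho>eq f k n = (LINT z|lborel. F k z * F n z * R z)"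
    by (rule mode_profile_exists[OF \<open>H > 0\<close> \<open>grav > 0\<close> rho_eq rho_eq_pos N_pos modes]) (rule that, assumption+)
  interpret mode_profile H grav c R Rp A F G R0 m by (rule mp)
  define vz where "vz i t p = ?S p * V t p $ i" for i t p
  define wz where "wz t p = ?S p * w t p" for t p
  define rz where "rz t p = ?S p * \<rho> t p" for t p
  define Pz where "Pz t p = ?S p * P t p" for t p
  have curves: "C_L2 T UNIV (vz i)" "C_L2 T UNIV wz" "C_L2 T UNIV rz" "C_L2 T UNIV Pz" for i
    unfolding vz_def[abs_def] wz_def[abs_def] rz_def[abs_def] Pz_def[abs_def]
    by (intro C_L2_zero_extension strip_borel C_Hs0_C_L2[OF reg(1)] C_Hs0_C_L2[OF reg(2)] C_Hs0_C_L2[OF reg(3)] reg_P)+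
  have meas: "(\<lambda>p. ?S p * V t p $ i) \<in> borel_measurable borel" "(\<lambda>p. ?S p * w t p) \<in> borel_measurable borel"
    "(\<lambda>p. ?S p * \<rho> t p) \<in> borel_measurable borel" "(\<lambda>p. ?S p * P t p) \<in> borel_measurable borel"
    if "t \<in> {0..T}" for t i
    using sq_int_borel[OF C_L2_sq_int[OF curves(1) that]] sq_int_borel[OF C_L2_sq_int[OF curves(2) that]]
      sq_int_borel[OF C_L2_sq_int[OF curves(3) that]] sq_int_borel[OF C_L2_sq_int[OF curves(4) that]]
    unfolding vz_def[abs_def] wz_def[abs_def] rz_def[abs_def] Pz_def[abs_def] .
  have outside: "vz i t p = 0" "wz t p = 0" "rz t p = 0" "Pz t p = 0" if "p \<notin> strip H" for i t p
    using that by (simp_all add: vz_def wz_def rz_def Pz_def)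

  have kI: "(\<lambda>z. indicat_real ?J z * 1) \<in> borel_measurable borel" by simp
  have k1: "(\<lambda>z. indicator ?J z * (1 / \<rho>eq z)) \<in> borel_measurable borel"
  proof -
    have e: "indicator ?J z * (1 / \<rho>eq z) = indicator ?J z / (indicator ?J z * \<rho>eq z)" for z by (simp add: indicator_def)
    show ?thesis unfolding e by (intro borel_measurable_divide rm) simp
  qed
  have k2: "(\<lambda>z. indicator ?J z * (\<rho>eq' z / (\<rho>eq z)\<^sup>2)) \<in> borel_measurable borel"
  proof -
    have e: "indicator ?J z * (\<rho>eq' z / (\<rho>eq z)\<^sup>2) = (indicator ?J z * \<rho>eq' z) / (indicator ?J z * \<rho>eq z)\<^sup>2" for z
      by (simp add: indicator_def)
    show ?thesis unfolding e by (intro borel_measurable_divide borel_measurable_power rm)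
  qed
  have k3: "(\<lambda>z. indicator ?J z * (grav / \<rho>eq z)) \<in> borel_measurable borel"
  proof -
    have e: "indicator ?J z * (grav / \<rho>eq z) = grav * (indicator ?J z * (1 / \<rho>eq z))" for z by simp
    show ?thesis unfolding e by (intro borel_measurable_times k1) simp
  qed
  have b2: "bnd_borel (\<lambda>z. Rp z / (R z)\<^sup>2)"
    using divide_R_bb[OF divide_R_bb[OF Rp_bb]] by (simp add: power2_eq_square)
  have b3: "bnd_borel (\<lambda>z. grav / R z)" using divide_R_bb[OF bnd_borel_const[of grav]] .
  have kAE: "AE z in lborel. z \<in> ?J \<longrightarrow> 1 / \<rho>eq z = 1 / R z" "AE z in lborel. z \<in> ?J \<longrightarrow> \<rho>eq' z / (\<rho>eq z)\<^sup>2 = Rp z / (R z)\<^sup>2"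
    "AE z in lborel. z \<in> ?J \<longrightarrow> grav / \<rho>eq z = grav / R z" "AE z in lborel. z \<in> ?J \<longrightarrow> \<rho>eq' z = Rp z"
    "AE z in lborel. z \<in> ?J \<longrightarrow> (1::real) = 1"
    using rho by (auto elim: eventually_mono)

  \<comment> \<open>From here on each term of the equations is evaluated on a product test function,
    with its coefficient shifted to the profile.\<close>
  have cV: "curve_distr T (strip H) (\<lambda>t p. V t p $ i) (\<lambda>p. \<phi> (fst p, fst (snd p)) * e (snd (snd p)))
      = pair_strip T (vz i) \<phi> e" if "test_function ({0<..<T} \<times> UNIV) \<phi>" "test_function ?J e" for i \<phi> e
    unfolding vz_def[abs_def]
    by (rule curve_distr_strip_tensor[OF meas(1) _ kI bnd_borel_const[of 1] kAE(5) that, unfolded mult_1_right]) simp_all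
  have cw: "curve_distr T (strip H) w (\<lambda>p. \<phi> (fst p, fst (snd p)) * e (snd (snd p)))
      = pair_strip T wz \<phi> e" if "test_function ({0<..<T} \<times> UNIV) \<phi>" "test_function ?J e" for \<phi> e
    unfolding wz_def[abs_def]
    by (rule curve_distr_strip_tensor[OF meas(2) _ kI bnd_borel_const[of 1] kAE(5) that, unfolded mult_1_right]) simp_all
  have cr: "curve_distr T (strip H) \<rho> (\<lambda>p. \<phi> (fst p, fst (snd p)) * e (snd (snd p)))
      = pair_strip T rz \<phi> e" if "test_function ({0<..<T} \<times> UNIV) \<phi>" "test_function ?J e" for \<phi> e
    unfolding rz_def[abs_def]
    by (rule curve_distr_strip_tensor[OF meas(3) _ kI bnd_borel_const[of 1] kAE(5) that, unfolded mult_1_right]) simp_all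
  have cP1: "curve_distr T (strip H) (\<lambda>t p. 1 / \<rho>eq (snd p) * P t p) (\<lambda>p. \<phi> (fst p, fst (snd p)) * e (snd (snd p)))
      = pair_strip T Pz \<phi> (\<lambda>z. e z * (1 / R z))" if "test_function ({0<..<T} \<times> UNIV) \<phi>" "test_function ?J e" for \<phi> e
    unfolding Pz_def[abs_def]
    by (rule curve_distr_strip_tensor[OF meas(4) _ k1 inverse_R_bb kAE(1) that]) simp_all
  have cP2: "curve_distr T (strip H) (\<lambda>t p. P t p / \<rho>eq (snd p)) (\<lambda>p. \<phi> (fst p, fst (snd p)) * e (snd (snd p)))
      = pair_strip T Pz \<phi> (\<lambda>z. e z * (1 / R z))" if "test_function ({0<..<T} \<times> UNIV) \<phi>" "test_function ?J e" for \<phi> e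
    unfolding Pz_def[abs_def]
    by (rule curve_distr_strip_tensor[OF meas(4) _ k1 inverse_R_bb kAE(1) that]) simp_all
  have cP3: "curve_distr T (strip H) (\<lambda>t p. P t p * \<rho>eq' (snd p) / (\<rho>eq (snd p))\<^sup>2) (\<lambda>p. \<phi> (fst p, fst (snd p)) * e (snd (snd p)))
      = pair_strip T Pz \<phi> (\<lambda>z. e z * (Rp z / (R z)\<^sup>2))" if "test_function ({0<..<T} \<times> UNIV) \<phi>" "test_function ?J e" for \<phi> e
    unfolding Pz_def[abs_def]
    by (rule curve_distr_strip_tensor[OF meas(4) _ k2 b2 kAE(2) that]) simp_all
  have cr2: "curve_distr T (strip H) (\<lambda>t p. \<rho> t p / \<rho>eq (snd p) * grav) (\<lambda>p. \<phi> (fst p, fst (snd p)) * e (snd (snd p)))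
      = pair_strip T rz \<phi> (\<lambda>z. e z * (grav / R z))" if "test_function ({0<..<T} \<times> UNIV) \<phi>" "test_function ?J e" for \<phi> e
    unfolding rz_def[abs_def]
    by (rule curve_distr_strip_tensor[OF meas(3) _ k3 b3 kAE(3) that]) simp_all
  have cw2: "curve_distr T (strip H) (\<lambda>t p. w t p * \<rho>eq' (snd p)) (\<lambda>p. \<phi> (fst p, fst (snd p)) * e (snd (snd p)))
      = pair_strip T wz \<phi> (\<lambda>z. e z * Rp z)" if "test_function ({0<..<T} \<times> UNIV) \<phi>" "test_function ?J e" for \<phi> e
    unfolding wz_def[abs_def]
    by (rule curve_distr_strip_tensor[OF meas(2) _ rm(2) Rp_bb kAE(4) that]) simp_all

  \<comment> \<open>Stated for any \<open>U\<close> agreeing with the velocity almost everywhere, so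
    that it covers both the solution and the initial data. The velocity modes are
    \<open>G j / R\<close>, and \<open>G n\<close> is dual to them.\<close>
  have V_coef: "AE X in lborel. a n X = (LINT z|lborel. vz i t (X, z) * (indicator ?J z * G n z))"
    if "modal_decomposition H 0 (g_mode H \<rho>eq f c) (\<lambda>p. U p $ i) a" and t: "t \<in> {0..T}"
      and "AE p in lborel. p \<in> strip H \<longrightarrow> U p $ i = V t p $ i" for U i t n and a :: "nat \<Rightarrow> real^'d \<Rightarrow> real"
  proof (rule modal_coefficient[OF that(1) C_L2_sq_int[OF curves(1) t] _ _ outside(1)])
    show "AE p in lborel. p \<in> strip H \<longrightarrow> U p $ i = vz i t p" using that(3) by eventually_elim (simp add: vz_def)
    show "AE z in lborel. z \<in> ?J \<longrightarrow> g_mode H \<rho>eq f c j z = indicator ?J z * G j z / R z" for j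
      using gG[of j] by eventually_elim simp
    show "sq_int (\<lambda>z. indicator ?J z * G j z / R z)" "sq_int (\<lambda>z. indicator ?J z * G n z)" for j
      by (intro sq_int_supported divide_R_bb bnd_borel_mult I_bb G_bb; simp)+
    have "(\<lambda>z. indicator ?J z * G j z / R z * (indicator ?J z * G n z)) = (\<lambda>z. indicator ?J z * G j z * G n z / R z)" for j
      by (auto simp: indicator_def)
    then show "(LINT z|lborel. indicator ?J z * G j z / R z * (indicator ?J z * G n z)) = (if j = n then 1 else 0)" for j
      using G_orthonormal[of j n] by simp
  qed auto
  \<comment> \<open>The modes \<open>F j\<close> are orthonormal for the weight
    \<open>- grav * Rp\<close>, so the dual profile is \<open>F n\<close> times this weight.\<close>
  have w_coef: "AE X in lborel. wn n t X = (LINT z|lborel. wz t (X, z) * (- grav * Rp z * F n z))"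
    if t: "t \<in> {0..T}" and n: "n \<ge> 1" for t n
  proof (rule modal_coefficient[OF dec_w[OF t] C_L2_sq_int[OF curves(2) t] n _ outside(2)])
    show "AE p in lborel. p \<in> strip H \<longrightarrow> w t p = wz t p" by (simp add: wz_def)
    show "AE z in lborel. z \<in> ?J \<longrightarrow> f j z = F j z" if "j \<ge> 1" for j using fF[OF that] by simp
    show "sq_int (F j)" if "j \<ge> 1" for j by (rule sq_int_supported[OF F_bb[OF that] F_outside[OF that]])
    show "sq_int (\<lambda>z. - grav * Rp z * F n z)"
      by (intro sq_int_supported bnd_borel_mult bnd_borel_cmult Rp_bb F_bb n) (simp add: Rp_outside)
    show "(LINT z|lborel. F j z * (- grav * Rp z * F n z)) = (if j = n then 1 else 0)" if "j \<ge> 1" for j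
    proof -
      have "(\<lambda>z. F j z * (- grav * Rp z * F n z)) = (\<lambda>z. F j z * F n z * (- grav * Rp z))" by (auto simp: ac_simps)
      then show ?thesis using F_orthonormal[OF that n] by simp
    qed
  qed (assumption | erule (1) F_outside)+
  \<comment> \<open>The density modes already contain the weight divided by \<open>grav\<close>, so
    the dual profile is \<open>grav * F n\<close>. Again \<open>U\<close> may be the initial
    density.\<close>
  have r_coef: "AE X in lborel. a n X = (LINT z|lborel. rz t (X, z) * (grav * F n z))"
    if "modal_decomposition H 1 (\<lambda>n z. 1 / grav * \<rho>eq z * N_sq grav \<rho>eq \<rho>eq' z * f n z) U a" and t: "t \<in> {0..T}"
      and "AE p in lborel. p \<in> strip H \<longrightarrow> U p = \<rho> t p" and n: "n \<ge> 1" for U t n a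
  proof (rule modal_coefficient[OF that(1) C_L2_sq_int[OF curves(3) t] n _ outside(3)])
    show "AE p in lborel. p \<in> strip H \<longrightarrow> U p = rz t p" using that(3) by eventually_elim (simp add: rz_def)
    show "AE z in lborel. z \<in> ?J \<longrightarrow> 1 / grav * \<rho>eq z * N_sq grav \<rho>eq \<rho>eq' z * f j z = - Rp z * F j z" if "j \<ge> 1" for j
      using rho
    proof eventually_elim
      case (elim z)
      show ?case
      proof
        assume z: "z \<in> ?J"
        have w: "\<rho>eq z * N_sq grav \<rho>eq \<rho>eq' z = - grav * Rp z" using elim z by blast
        have "1 / grav * \<rho>eq z * N_sq grav \<rho>eq \<rho>eq' z * f j z = (\<rho>eq z * N_sq grav \<rho>eq \<rho>eq' z) * f j z / grav" by simp
        also have "\<dots> = - grav * Rp z * F j z / grav" unfolding w fF[OF that z] ..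
        finally show "1 / grav * \<rho>eq z * N_sq grav \<rho>eq \<rho>eq' z * f j z = - Rp z * F j z" using grav_pos by simp
      qed
    qed
    have "bnd_borel (\<lambda>z. - Rp z)" using bnd_borel_cmult[OF Rp_bb, of "-1"] by simp
    then show "sq_int (\<lambda>z. - Rp z * F j z)" if "j \<ge> 1" for j
      by (intro sq_int_supported bnd_borel_mult F_bb that) (simp_all add: Rp_outside)
    show "- Rp z * F j z = 0" if "z \<notin> ?J" for j z using that by (simp add: Rp_outside)
    show "sq_int (\<lambda>z. grav * F n z)"
      by (intro sq_int_cmult sq_int_supported F_bb F_outside n)
    show "(LINT z|lborel. - Rp z * F j z * (grav * F n z)) = (if j = n then 1 else 0)" if "j \<ge> 1" for j
    proof -
      have "(\<lambda>z. - Rp z * F j z * (grav * F n z)) = (\<lambda>z. F j z * F n z * (- grav * Rp z))" by (auto simp: ac_simps)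
      then show ?thesis using F_orthonormal[OF that n] by simp
    qed
  qed assumption
  \<comment> \<open>The roles are reversed compared with the velocity: the pressure modes are
    \<open>G j\<close>, and \<open>G n / R\<close> is dual to them.\<close>
  have P_coef: "AE X in lborel. Pn n t X = (LINT z|lborel. Pz t (X, z) * (indicator ?J z * G n z / R z))"
    if t: "t \<in> {0..T}" for t n
  proof (rule modal_coefficient[OF dec_P[OF t] C_L2_sq_int[OF curves(4) t] _ _ outside(4)])
    show "AE p in lborel. p \<in> strip H \<longrightarrow> P t p = Pz t p" by (simp add: Pz_def)
    show "AE z in lborel. z \<in> ?J \<longrightarrow> \<rho>eq z * g_mode H \<rho>eq f c j z = indicator ?J z * G j z" for j
      using gG[of j] rho by eventually_elim (use R_pos in \<open>auto simp: less_imp_neq[symmetric]\<close>)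
    show "sq_int (\<lambda>z. indicator ?J z * G n z / R z)" "sq_int (\<lambda>z. indicator ?J z * G j z)" for j
      by (intro sq_int_supported divide_R_bb bnd_borel_mult I_bb G_bb; simp)+
    have "(\<lambda>z. indicator ?J z * G j z * (indicator ?J z * G n z / R z)) = (\<lambda>z. indicator ?J z * G j z * G n z / R z)" for j
      by (auto simp: indicator_def)
    then show "(LINT z|lborel. indicator ?J z * G j z * (indicator ?J z * G n z / R z)) = (if j = n then 1 else 0)" for j
      using G_orthonormal[of j n] by simp
  qed auto

  have T_test: "test_function ({0<..<T} \<times> strip H) (\<lambda>p. \<phi> (fst p, fst (snd p)) * e (snd (snd p)))"
    if "test_function ({0<..<T} \<times> UNIV) \<phi>" "test_function ?J e" for \<phi> :: "real \<times> (real^'d) \<Rightarrow> real" and e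
    using test_function_tensor_strip[OF that] by (simp add: strip_def)
  interpret sys: modal_system H grav c R Rp A F G R0 m T vz wz rz Pz "\<lambda>i n t X. Vn n t X $ i" wn \<rho>n Pn
  proof
    fix \<phi> :: "real \<times> (real^'d) \<Rightarrow> real" and e :: "real \<Rightarrow> real" and i j :: 'd
    assume \<phi>: "test_function ({0<..<T} \<times> UNIV) \<phi>" and e: "test_function ?J e"
    note D\<phi> = test_function_dirderiv[OF \<phi>] and De = test_function_deriv[OF e]
    note E = eqs[unfolded linear_equations_def, THEN conjunct1, rule_format, OF T_test[OF \<phi> e]]
    note simps = ddiff_def tensor_derivatives[OF \<phi> e] cV[OF D\<phi> e] cw[OF D\<phi> e] cr[OF D\<phi> e] cw[OF \<phi> De] cP1[OF D\<phi> e]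
      cP2[OF \<phi> De] cP3[OF \<phi> e] cr2[OF \<phi> e] cw2[OF \<phi> e]
    show "pair_strip T (vz i) (dirderiv (1, 0) \<phi>) e + pair_strip T Pz (dirderiv (0, axis i 1) \<phi>) (\<lambda>z. e z / R z) = 0"
      using E[THEN conjunct1, rule_format, of i] unfolding simps by simp
    show "- pair_strip T wz (dirderiv (1, 0) \<phi>) e - pair_strip T Pz \<phi> (\<lambda>z. deriv e z / R z)
        + pair_strip T Pz \<phi> (\<lambda>z. e z * (Rp z / (R z)\<^sup>2)) + pair_strip T rz \<phi> (\<lambda>z. e z * (grav / R z)) = 0"
      using E[THEN conjunct2, THEN conjunct1] unfolding simps by simp
    show "pair_strip T rz (dirderiv (1, 0) \<phi>) e - pair_strip T wz \<phi> (\<lambda>z. e z * Rp z) = 0"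
      using E[THEN conjunct2, THEN conjunct2, THEN conjunct1] unfolding simps by simp
    show "(\<Sum>i\<in>UNIV. pair_strip T (vz i) (dirderiv (0, axis i 1) \<phi>) e) + pair_strip T wz \<phi> (deriv e) = 0"
      using E[THEN conjunct2, THEN conjunct2, THEN conjunct2] unfolding simps by (simp add: sum_negf)
    show "pair_strip T (vz j) (dirderiv (0, axis i 1) \<phi>) e - pair_strip T (vz i) (dirderiv (0, axis j 1) \<phi>) e = 0"
      using vort[unfolded zero_vertical_vorticity_def, rule_format, OF T_test[OF \<phi> e], of i j] unfolding simps by simp
  next
    fix t assume t: "t \<in> {0..T}"
    have "zero_traces H (w t)" using eqs t unfolding linear_equations_def by blast
    then show "zero_traces H (wz t)" unfolding zero_traces_def wz_def by (simp add: strip_def indicator_def)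
    show "(\<lambda>X. Vn n t X $ i) \<in> borel_measurable borel" "Pn n t \<in> borel_measurable borel" for n i
      using dec_V[OF t, of i] dec_P[OF t] unfolding modal_decomposition_def by blast+
    show "wn n t \<in> borel_measurable borel" "\<rho>n n t \<in> borel_measurable borel" if "n \<ge> 1" for n
      using dec_w[OF t] dec_rho[OF t] that unfolding modal_decomposition_def by blast+
    show "AE X in lborel. Vn n t X $ i = (LINT z|lborel. vz i t (X, z) * (indicator ?J z * G n z))" for n i
      by (rule V_coef[OF dec_V[OF t] t]) simp
    show "AE X in lborel. \<rho>n n t X = (LINT z|lborel. rz t (X, z) * (grav * F n z))" if "n \<ge> 1" for n
      by (rule r_coef[OF dec_rho[OF t] t _ that]) simp
  qed (use \<open>T > 0\<close> curves outside w_coef P_coef in auto)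

  \<comment> \<open>Coefficients at time 0 and coefficients of the initial data are integrals of the
    same extended function against the same profile, hence agree almost everywhere.\<close>
  have initial: "AE X in lborel. Vn n 0 X = V0n n X \<and> \<rho>n n 0 X = \<rho>0n n X" if n: "n \<ge> 1" for n
  proof -
    have t0: "0 \<in> {0..T}" using \<open>T > 0\<close> by simp
    have "AE X in lborel. Vn n 0 X $ i = V0n n X $ i" for i
    proof -
      have "AE p in lborel. p \<in> strip H \<longrightarrow> V0 p $ i = V 0 p $ i" using init by eventually_elim auto
      from V_coef[OF dec_V0 t0 this, of n] sys.coef(1)[OF t0, of n i] show ?thesis by eventually_elim simp
    qed
    then have vv: "AE X in lborel. \<forall>i. Vn n 0 X $ i = V0n n X $ i" by (subst AE_all_countable) blast
    have rr: "AE p in lborel. p \<in> strip H \<longrightarrow> \<rho>0 p = \<rho> 0 p" using init by eventually_elim auto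
    show ?thesis
      using vv r_coef[OF dec_rho0 t0 rr n] sys.coef(3)[OF t0 n] by eventually_elim (simp add: vec_eq_iff)
  qed
  have zeroth: "AE X in lborel. Pn 0 t X = 0 \<and> Vn 0 t X = 0" if t: "t \<in> {0..T}" for t
  proof -
    have "AE X in lborel. \<forall>i. Vn 0 t X $ i = 0" using sys.V0_vanishes[OF t] by (subst AE_all_countable) blast
    then show ?thesis using sys.P0_vanishes[OF t] by eventually_elim (simp add: vec_eq_iff)
  qed
  have equations: "(\<forall>i. summable (\<lambda>m. c (Suc m) * c n * alpha H \<rho>eq f (Suc m) n
                   * lapX (dt (curve_distr T UNIV (\<lambda>t X. Vn (Suc m) t X $ i))) \<phi>)
             \<and> dt (curve_distr T UNIV (\<lambda>t X. Vn n t X $ i)) \<phi>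
               - (\<Sum>m. c (Suc m) * c n * alpha H \<rho>eq f (Suc m) n
                   * lapX (dt (curve_distr T UNIV (\<lambda>t X. Vn (Suc m) t X $ i))) \<phi>)
               + c n * dX i (curve_distr T UNIV (\<rho>n n)) \<phi> = 0)
        \<and> dt (curve_distr T UNIV (\<rho>n n)) \<phi>
            + c n * (\<Sum>i\<in>UNIV. dX i (curve_distr T UNIV (\<lambda>t X. Vn n t X $ i)) \<phi>) = 0
        \<and> curve_distr T UNIV (wn n) \<phi>
            = - c n * (\<Sum>i\<in>UNIV. dX i (curve_distr T UNIV (\<lambda>t X. Vn n t X $ i)) \<phi>)
        \<and> summable (\<lambda>m. alpha H \<rho>eq f (Suc m) n * dt (curve_distr T UNIV (wn (Suc m))) \<phi>)
        \<and> curve_distr T UNIV (Pn n) \<phi> = c n * curve_distr T UNIV (\<rho>n n) \<phi>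
            + c n * (\<Sum>m. alpha H \<rho>eq f (Suc m) n * dt (curve_distr T UNIV (wn (Suc m))) \<phi>)"
    if n: "n \<ge> 1" and \<phi>: "test_function ({0<..<T} \<times> UNIV) \<phi>" for n and \<phi> :: "real \<times> (real^'d) \<Rightarrow> real"
  proof -
    have al: "alpha H \<rho>eq f (Suc k) n = (LINT z|lborel. F (Suc k) z * F n z * R z)" for k
      by (rule alpha) (use n in auto)
    note SV = sys.mode_V_series[OF \<phi> n] and SP = sys.mode_P_series[OF \<phi> n]
    have cn: "c n > 0" by (rule c_pos[OF n])
    show ?thesis
      unfolding al
    proof (intro conjI allI)
      fix i
      show "summable (\<lambda>m. c (Suc m) * c n * (LINT z|lborel. F (Suc m) z * F n z * R z) * lapX (dt (curve_distr T UNIV (\<lambda>t X. Vn (Suc m) t X $ i))) \<phi>)"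
        by (rule sums_summable[OF SV])
      show "dt (curve_distr T UNIV (\<lambda>t X. Vn n t X $ i)) \<phi>
          - (\<Sum>m. c (Suc m) * c n * (LINT z|lborel. F (Suc m) z * F n z * R z) * lapX (dt (curve_distr T UNIV (\<lambda>t X. Vn (Suc m) t X $ i))) \<phi>)
          + c n * dX i (curve_distr T UNIV (\<rho>n n)) \<phi> = 0"
        unfolding sums_unique[OF SV, symmetric] ddiff_def using sys.mode_V[OF \<phi>, where i = i and n = n] by simp
    next
      show "dt (curve_distr T UNIV (\<rho>n n)) \<phi> + c n * (\<Sum>i\<in>UNIV. dX i (curve_distr T UNIV (\<lambda>t X. Vn n t X $ i)) \<phi>) = 0"
        unfolding ddiff_def sys.mode_r[OF \<phi> n] sys.mode_div[OF \<phi> n] by (simp add: sum_negf)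
      show "curve_distr T UNIV (wn n) \<phi> = - c n * (\<Sum>i\<in>UNIV. dX i (curve_distr T UNIV (\<lambda>t X. Vn n t X $ i)) \<phi>)"
        unfolding ddiff_def sys.mode_div[OF \<phi> n] by (simp add: sum_negf)
      show "summable (\<lambda>m. (LINT z|lborel. F (Suc m) z * F n z * R z) * dt (curve_distr T UNIV (wn (Suc m))) \<phi>)"
        by (rule sums_summable[OF SP])
      show "curve_distr T UNIV (Pn n) \<phi> = c n * curve_distr T UNIV (\<rho>n n) \<phi>
          + c n * (\<Sum>m. (LINT z|lborel. F (Suc m) z * F n z * R z) * dt (curve_distr T UNIV (wn (Suc m))) \<phi>)"
        unfolding sums_unique[OF SP, symmetric] using cn by (simp add: right_diff_distrib)
    qed
  qed
  show ?thesis
    by (rule conjI, rule allI, rule impI, rule conjI, rule allI, rule impI, rule equations, assumption+,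
        intro conjI allI sys.C_L2_coef initial, assumption+, rule ballI, rule zeroth, assumption)
qed

end
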